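(* Let $(\Omega,\sigma)$ be minimal. Let $f\in C^{0,2}(\Omega\times\mathbb{R},\mathbb{R})$ be $(\mathrm{Co})$ and $(\mathrm{DC})$, with $f(\omega,0)=0$ for all $\omega\in\Omega$, and let $[-\lambda_+,-\lambda_-]$ be the Sacker and Sell spectrum of $f_x$ on $\hat{\mathcal{M}}_0=\Omega\times\{0\}$, with $\lambda_-\le\lambda_+$. Let $\hat\tau_\lambda$ be the flow given by $x'=f(\omega\cdot t,x)+\lambda x$ and let $\hat{\mathcal{A}}_\lambda=\bigcup_{\omega\in\Omega}(\{\omega\}\times[\hat\alpha_\lambda(\omega),\hat\beta_\lambda(\omega)])$ be its global attractor. Then: (i) If $f_{xx}(\omega,0)\ge0$ (resp. $f_{xx}(\omega,0)\le0$) for all $\omega\in\Omega$, then $\hat\alpha_\lambda$ (resp. $\hat\beta_\lambda$) takes the value $0$ at its continuity points for all $\lambda<\lambda_+$. (ii) If $f$ is $(\mathrm{SDC})$ and $f_{xx}(\omega,0)=0$ for all $\omega\in\Omega$, then the bifurcation diagram is that of a global pitchfork bifurcation of minimal sets around $\hat{\mathcal{M}}_0$ at $\lambda_+$: $\hat\tau_\lambda$ admits three different hyperbolic minimal sets $\hat{\mathcal{M}}^l_\lambda<\hat{\mathcal{M}}_0<\hat{\mathcal{M}}^u_\lambda$, with $\hat{\mathcal{M}}^l_\lambda$ and $\hat{\mathcal{M}}^u_\lambda$ the graphs of $\hat\alpha_\lambda$ and $\hat\beta_\lambda$, for $\lambda>\lambda_+$; both $\hat\alpha_\lambda$ and $\hat\beta_\lambda$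 collide with $0$ on a residual $\sigma$-invariant set as $\lambda\downarrow\lambda_+$; $\hat{\mathcal{M}}_0$ is the unique $\hat\tau_\lambda$-minimal set if $\lambda\le\lambda_+$; and $\hat{\mathcal{A}}_\lambda=\hat{\mathcal{M}}_0$ if $\lambda<\lambda_-$.
   Context: $\Omega$ is a compact metric space with a continuous flow $\sigma:\mathbb{R}\times\Omega\to\Omega$, $\sigma(t,\omega)=\omega\cdot t$; minimal means every $\sigma$-orbit is dense. $C^{0,k}(\Omega\times\mathbb{R},\mathbb{R})$: functions $f$ such that $f$ and its $x$-derivatives up to order $k$ exist and are jointly continuous. $t\mapsto\hat u_\lambda(t,\omega,x_0)$ is the maximal solution of $x'=f(\omega\cdot t,x)+\lambda x$ with $\hat u_\lambda(0,\omega,x_0)=x_0$; $\hat\tau_\lambda(t,\omega,x_0)=(\omega\cdot t,\hat u_\lambda(t,\omega,x_0))$. $f$ is $(\mathrm{Co})$ if $\lim_{|x|\to\infty}f(\omega,x)/x=-\infty$ uniformly on $\Omega$; then $\hat\tau_\lambda$ has a global attractor $\hat{\mathcal{A}}_\lambda$ (a compact invariant set attracting every bounded set in the Hausdorff semidistance) of the displayed form, where $\hat\alpha_\lambda,\hat\beta_\lambda$ are lower and upper semicontinuous equilibria (an equilibrium is a map $\beta:\Omega\to\mathbb{R}$ with $\beta(\omega\cdot t)=\hat u_\lambda(t,\omega,\beta(\omega))$ for all $\omega,t$). A minimal set is a nonempty compact invariant set containing properly no other such set. $\mathcal{M}_1<\mathcal{M}_2$ means $x<y$ whenever $(\omega,x)\in\mathcal{M}_1,(\omega,y)\in\mathcal{M}_2$.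 A minimal set is hyperbolic if it is uniformly exponentially asymptotically stable at $+\infty$ or at $-\infty$: there are $\delta>0,k\ge1,\gamma>0$ such that if $(\omega,x)$ is in the set and $|y-x|<\delta$ then $|\hat u_\lambda(t,\omega,y)-\hat u_\lambda(t,\omega,x)|\le ke^{-\gamma|t|}|y-x|$ for all $t\ge0$ (or, respectively, for all $t\le0$). The Sacker and Sell spectrum of $f_x$ on $\Omega\times\{0\}$ is that of $a(\omega)=f_x(\omega,0)$: the set of $\lambda\in\mathbb{R}$ such that $x'=(a(\omega\cdot t)-\lambda)x$ does not have exponential dichotomy over $\Omega$; here $x'=c(\omega\cdot t)x$ has exponential dichotomy over $\Omega$ if there are $k\ge1,\delta>0$ such that either $\exp\int_0^tc(\omega\cdot s)ds\le ke^{-\delta t}$ for all $\omega\in\Omega,t\ge0$ or $\exp\int_0^tc(\omega\cdot s)ds\le ke^{\delta t}$ for all $\omega\in\Omega,t\le0$. $f$ is $(\mathrm{DC})$ if $f_x(\omega,\cdot)$ is concave on $\mathbb{R}$ for all $\omega$. For a compact nondegenerate interval $J$ of length $l(J)$ and $\epsilon\in[0,l(J)]$, $b_{J,\epsilon}(\omega)=\frac{\epsilon}{4l(J)^2}\min_{x\in J_\epsilon}\{2f_x(\omega,x)-f_x(\omega,x-\epsilon/2)-f_x(\omega,x+\epsilon/2)\}$ with $J_\epsilon=\{x:[x-\epsilon/2,x+\epsilon/2]\subseteq J\}$. $f$ is $(\mathrm{SDC})$ if it is (DC) and $m(\{b_{J,\epsilon}>0\})>0$ for every compact nondegenerate interval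 $J$, every $\epsilon\in(0,l(J)/2]$ and every normalized $\sigma$-ergodic Borel measure $m$ on $\Omega$. An equilibrium family collides with $0$ on a residual $\sigma$-invariant set as $\lambda\to\lambda_1$ if its pointwise limit as $\lambda\to\lambda_1$ vanishes on a residual $\sigma$-invariant subset of $\Omega$. *)

theory Defs
  imports "HOL-Probability.Probability"
begin
definition continuous_flow :: "(real \<Rightarrow> 'w::metric_space \<Rightarrow> 'w) \<Rightarrow> bool" where
  "continuous_flow \<sigma> \<longleftrightarrow>
     continuous_on UNIV (\<lambda>(t, \<omega>). \<sigma> t \<omega>) \<and>
     (\<forall>\<omega>. \<sigma> 0 \<omega> = \<omega>) \<and>
     (\<forall>s t \<omega>. \<sigma> (s + t) \<omega> = \<sigma> s (\<sigma> t \<omega>))"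

definition minimal_flow :: "(real \<Rightarrow> 'w::metric_space \<Rightarrow> 'w) \<Rightarrow> bool" where
  "minimal_flow \<sigma> \<longleftrightarrow> (\<forall>\<omega>. closure (range (\<lambda>t. \<sigma> t \<omega>)) = UNIV)"

definition flow_invariant :: "(real \<Rightarrow> 'w \<Rightarrow> 'w) \<Rightarrow> 'w set \<Rightarrow> bool" where
  "flow_invariant \<sigma> R \<longleftrightarrow> (\<forall>t. \<sigma> t ` R = R)"

definition residual_set :: "'w::topological_space set \<Rightarrow> bool" where
  "residual_set R \<longleftrightarrow>
     (\<exists>G :: nat \<Rightarrow> 'w set. (\<forall>n. open (G n) \<and> closure (G n) = UNIV) \<and> (\<Inter>n. G n) \<subseteq> R)"

definition ergodic_measure :: "(real \<Rightarrow> 'w::metric_space \<Rightarrow> 'w) \<Rightarrow> 'w measure \<Rightarrow> bool" where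
  "ergodic_measure \<sigma> m \<longleftrightarrow>
     sets m = sets borel \<and> prob_space m \<and>
     (\<forall>t. \<forall>B\<in>sets m. emeasure m (\<sigma> t ` B) = emeasure m B) \<and>
     (\<forall>B\<in>sets m. flow_invariant \<sigma> B \<longrightarrow> emeasure m B = 0 \<or> emeasure m B = 1)"

text \<open>\<open>solves_on \<sigma> g \<omega> x0 I u\<close>: on the open interval \<open>I\<close> around \<open>0\<close>, \<open>u\<close> solves
  \<open>x' = g (\<sigma> t \<omega>) x\<close> with \<open>u 0 = x0\<close>.  The maximal solution lives on the union of all such
  intervals (an interval of reals, possibly bounded); its value \<open>sol \<sigma> g t \<omega> x0\<close> is meaningful
  only for \<open>t \<in> sol_dom \<sigma> g \<omega> x0\<close>, and well defined there when \<open>g\<close> is continuous and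
  locally Lipschitz in \<open>x\<close>.\<close>

definition solves_on ::
  "(real \<Rightarrow> 'w \<Rightarrow> 'w) \<Rightarrow> ('w \<Rightarrow> real \<Rightarrow> real) \<Rightarrow> 'w \<Rightarrow> real \<Rightarrow> real set \<Rightarrow> (real \<Rightarrow> real) \<Rightarrow> bool" where
  "solves_on \<sigma> g \<omega> x0 I u \<longleftrightarrow>
     open I \<and> is_interval I \<and> 0 \<in> I \<and> u 0 = x0 \<and>
     (\<forall>t\<in>I. (u has_real_derivative g (\<sigma> t \<omega>) (u t)) (at t))"

definition sol_dom ::
  "(real \<Rightarrow> 'w \<Rightarrow> 'w) \<Rightarrow> ('w \<Rightarrow> real \<Rightarrow> real) \<Rightarrow> 'w \<Rightarrow> real \<Rightarrow> real set" where
  "sol_dom \<sigma> g \<omega> x0 = \<Union> {I. \<exists>u. solves_on \<sigma> g \<omega> x0 I u}"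

definition sol ::
  "(real \<Rightarrow> 'w \<Rightarrow> 'w) \<Rightarrow> ('w \<Rightarrow> real \<Rightarrow> real) \<Rightarrow> real \<Rightarrow> 'w \<Rightarrow> real \<Rightarrow> real" where
  "sol \<sigma> g t \<omega> x0 = (THE y. \<exists>I u. solves_on \<sigma> g \<omega> x0 I u \<and> t \<in> I \<and> u t = y)"

definition skew ::
  "(real \<Rightarrow> 'w \<Rightarrow> 'w) \<Rightarrow> ('w \<Rightarrow> real \<Rightarrow> real) \<Rightarrow> real \<Rightarrow> 'w \<times> real \<Rightarrow> 'w \<times> real" where
  "skew \<sigma> g t = (\<lambda>(\<omega>, x). (\<sigma> t \<omega>, sol \<sigma> g t \<omega> x))"

text \<open>Invariant sets consist of globally defined orbits.\<close>

definition skew_invariant ::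
  "(real \<Rightarrow> 'w \<Rightarrow> 'w) \<Rightarrow> ('w \<Rightarrow> real \<Rightarrow> real) \<Rightarrow> ('w \<times> real) set \<Rightarrow> bool" where
  "skew_invariant \<sigma> g K \<longleftrightarrow>
     (\<forall>(\<omega>, x)\<in>K. sol_dom \<sigma> g \<omega> x = UNIV) \<and> (\<forall>t. skew \<sigma> g t ` K = K)"

text \<open>Taken in \<^typ>\<open>ennreal\<close>, so that it is \<open>\<infinity>\<close> from a nonempty set to the empty set or
  from a set not at bounded distance.\<close>

definition semidist :: "'b::metric_space set \<Rightarrow> 'b set \<Rightarrow> ennreal" where
  "semidist C A = (SUP c\<in>C. INF a\<in>A. ennreal (dist c a))"

definition global_attractor ::
  "(real \<Rightarrow> 'w \<Rightarrow> 'w) \<Rightarrow> ('w::metric_space \<Rightarrow> real \<Rightarrow> real) \<Rightarrow> ('w \<times> real) set \<Rightarrow> bool" where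
  "global_attractor \<sigma> g A \<longleftrightarrow>
     compact A \<and> skew_invariant \<sigma> g A \<and>
     (\<forall>C. bounded C \<longrightarrow>
        (\<forall>(\<omega>, x)\<in>C. {0..} \<subseteq> sol_dom \<sigma> g \<omega> x) \<and>
        ((\<lambda>t. semidist (skew \<sigma> g t ` C) A) \<longlongrightarrow> 0) at_top)"

definition minimal_set ::
  "(real \<Rightarrow> 'w \<Rightarrow> 'w) \<Rightarrow> ('w::metric_space \<Rightarrow> real \<Rightarrow> real) \<Rightarrow> ('w \<times> real) set \<Rightarrow> bool" where
  "minimal_set \<sigma> g M \<longleftrightarrow>
     M \<noteq> {} \<and> compact M \<and> skew_invariant \<sigma> g M \<and>
     (\<forall>K. K \<noteq> {} \<and> compact K \<and> skew_invariant \<sigma> g K \<longrightarrow> \<not> K \<subset> M)"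

definition unif_exp_stable ::
  "real set \<Rightarrow> (real \<Rightarrow> 'w \<Rightarrow> 'w) \<Rightarrow> ('w \<Rightarrow> real \<Rightarrow> real) \<Rightarrow> ('w \<times> real) set \<Rightarrow> bool" where
  "unif_exp_stable T \<sigma> g M \<longleftrightarrow>
     (\<exists>\<delta>>0. \<exists>k\<ge>1. \<exists>\<gamma>>0. \<forall>(\<omega>, x)\<in>M. \<forall>y. \<bar>y - x\<bar> < \<delta> \<longrightarrow>
        (\<forall>t\<in>T. t \<in> sol_dom \<sigma> g \<omega> y \<and>
           \<bar>sol \<sigma> g t \<omega> y - sol \<sigma> g t \<omega> x\<bar> \<le> k * exp (- \<gamma> * \<bar>t\<bar>) * \<bar>y - x\<bar>))"

definition hyperbolic_minimal_set ::
  "(real \<Rightarrow> 'w \<Rightarrow> 'w) \<Rightarrow> ('w::metric_space \<Rightarrow> real \<Rightarrow> real) \<Rightarrow> ('w \<times> real) set \<Rightarrow> bool" where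
  "hyperbolic_minimal_set \<sigma> g M \<longleftrightarrow>
     minimal_set \<sigma> g M \<and> (unif_exp_stable {0..} \<sigma> g M \<or> unif_exp_stable {..0} \<sigma> g M)"

definition fibre_less :: "('w \<times> real) set \<Rightarrow> ('w \<times> real) set \<Rightarrow> bool" where
  "fibre_less M N \<longleftrightarrow> (\<forall>\<omega> x y. (\<omega>, x) \<in> M \<and> (\<omega>, y) \<in> N \<longrightarrow> x < y)"

definition graph_of :: "('w \<Rightarrow> real) \<Rightarrow> ('w \<times> real) set" where
  "graph_of b = range (\<lambda>\<omega>. (\<omega>, b \<omega>))"

definition zero_section :: "('w \<times> real) set" where
  "zero_section = UNIV \<times> {0}"

definition collides_with_zero ::
  "(real \<Rightarrow> 'w::topological_space \<Rightarrow> 'w) \<Rightarrow> (real \<Rightarrow> 'w \<Rightarrow> real) \<Rightarrow> real filter \<Rightarrow> bool" where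
  "collides_with_zero \<sigma> b F \<longleftrightarrow>
     (\<exists>b0. (\<forall>\<omega>. ((\<lambda>l. b l \<omega>) \<longlongrightarrow> b0 \<omega>) F) \<and>
        (\<exists>R. residual_set R \<and> flow_invariant \<sigma> R \<and> (\<forall>\<omega>\<in>R. b0 \<omega> = 0)))"

text \<open>The interval integral is oriented, as needed for negative \<open>t\<close>.\<close>

definition exp_dichotomy :: "(real \<Rightarrow> 'w \<Rightarrow> 'w) \<Rightarrow> ('w \<Rightarrow> real) \<Rightarrow> bool" where
  "exp_dichotomy \<sigma> c \<longleftrightarrow>
     (\<exists>k\<ge>1. \<exists>\<delta>>0.
        (\<forall>\<omega>. \<forall>t\<ge>0. exp (LBINT s=ereal 0..ereal t. c (\<sigma> s \<omega>)) \<le> k * exp (- \<delta> * t)) \<or>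
        (\<forall>\<omega>. \<forall>t\<le>0. exp (LBINT s=ereal 0..ereal t. c (\<sigma> s \<omega>)) \<le> k * exp (\<delta> * t)))"

definition sacker_sell_spectrum :: "(real \<Rightarrow> 'w \<Rightarrow> 'w) \<Rightarrow> ('w \<Rightarrow> real) \<Rightarrow> real set" where
  "sacker_sell_spectrum \<sigma> a = {l. \<not> exp_dichotomy \<sigma> (\<lambda>\<omega>. a \<omega> - l)}"

definition C0k :: "nat \<Rightarrow> ('w::topological_space \<Rightarrow> real \<Rightarrow> real) \<Rightarrow> bool" where
  "C0k k f \<longleftrightarrow>
     (\<forall>j<k. \<forall>\<omega> x. (deriv ^^ j) (f \<omega>) field_differentiable at x) \<and>
     (\<forall>j\<le>k. continuous_on UNIV (\<lambda>(\<omega>, x). (deriv ^^ j) (f \<omega>) x))"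

definition Co :: "('w \<Rightarrow> real \<Rightarrow> real) \<Rightarrow> bool" where
  "Co f \<longleftrightarrow> (\<forall>M. \<forall>\<^sub>F x in at_infinity. \<forall>\<omega>. f \<omega> x / x < M)"

definition DC :: "('w \<Rightarrow> real \<Rightarrow> real) \<Rightarrow> bool" where
  "DC f \<longleftrightarrow> (\<forall>\<omega>. concave_on UNIV (deriv (f \<omega>)))"

text \<open>\<open>b\<^sub>J\<^sub>,\<^sub>\<epsilon>\<close> for \<open>J = {p..q}\<close>; for continuous \<open>f\<^sub>x\<close> and \<open>0 \<le> \<epsilon> \<le> q - p\<close> the infimum is over
  a nonempty compact set and hence a minimum.\<close>

definition b_mod ::
  "('w \<Rightarrow> real \<Rightarrow> real) \<Rightarrow> real \<Rightarrow> real \<Rightarrow> real \<Rightarrow> 'w \<Rightarrow> real" where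
  "b_mod f p q \<epsilon> \<omega> =
     \<epsilon> / (4 * (q - p)\<^sup>2) *
     (INF x\<in>{x. {x - \<epsilon> / 2..x + \<epsilon> / 2} \<subseteq> {p..q}}.
        2 * deriv (f \<omega>) x - deriv (f \<omega>) (x - \<epsilon> / 2) - deriv (f \<omega>) (x + \<epsilon> / 2))"

definition SDC :: "(real \<Rightarrow> 'w::metric_space \<Rightarrow> 'w) \<Rightarrow> ('w \<Rightarrow> real \<Rightarrow> real) \<Rightarrow> bool" where
  "SDC \<sigma> f \<longleftrightarrow>
     DC f \<and>
     (\<forall>p q \<epsilon> m. p < q \<and> 0 < \<epsilon> \<and> \<epsilon> \<le> (q - p) / 2 \<and> ergodic_measure \<sigma> m \<longrightarrow>
        emeasure m {\<omega>. b_mod f p q \<epsilon> \<omega> > 0} > 0)"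

definition shifted :: "('w \<Rightarrow> real \<Rightarrow> real) \<Rightarrow> real \<Rightarrow> 'w \<Rightarrow> real \<Rightarrow> real" where
  "shifted f l \<omega> x = f \<omega> x + l * x"

end

theory Submission
  imports Defs
begin

text \<open>
  Over each base point \<open>w\<close> the attractor at the parameter \<open>l\<close> is the set of values at time \<open>0\<close> of
  the bounded complete solutions, and \<open>\<beta> l w\<close> is the largest of them. The arguments concern
  positive solutions; those for \<open>\<alpha>\<close> follow by the reflection \<open>x \<mapsto> - x\<close>, which turns \<open>f\<close> into an
  equation of the same kind (\<open>reflect\<close>).

  For a positive solution \<open>u\<close> one has \<open>(ln u)' = f w u / u + l\<close>. When the slope \<open>f\<^sub>x\<close> is concave and
  \<open>f\<^sub>x\<^sub>x \<le> 0\<close> at zero, the slope is decreasing on the positive half-line, so \<open>f w x / x\<close> is at most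
  the slope at zero and decreases in \<open>x\<close>. Two consequences carry the proof.

  First, suppose that over every base point there is a complete solution with values between two
  fixed positive constants. Since \<open>ln u\<close> is bounded and grows no faster than the exponent of the
  linearisation at zero, this exponent is bounded above in backward time. At every larger parameter
  the linearisation then has an exponential dichotomy; as it has none at \<open>lp\<close>, necessarily
  \<open>lp \<le> l\<close> (\<open>separated_imp_ge\<close>). Part (i) follows: if \<open>\<beta> l\<close> were continuous and positive at a
  point, it would be bounded below on an open set, hence everywhere, because minimality brings each
  orbit back to this set within a bounded time (\<open>equilibrium_lower_bound\<close>).

  Second, in logarithmic coordinates the equation does not expand distances. Strict concavity makes
  the slope nonconstant arbitrarily close to zero over some base point, hence over an open set of
  them; minimality makes each orbit spend a uniformly positive proportion of time there
  (\<open>linear_growth\<close>). Then the inequality above is strict, \<open>lp < l\<close> (\<open>separated_imp_gt\<close>), and the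
  logarithmic distance of two solutions between positive constants decays exponentially
  (\<open>contraction\<close>).

  Part (ii) results from these facts. For \<open>lp < l\<close> zero repels, so \<open>\<beta> l\<close> is bounded away from zero
  (\<open>above_threshold\<close>). By contraction it is the only such complete solution, hence its graph is
  closed and \<open>\<beta> l\<close> is continuous, and it is exponentially stable. As \<open>l\<close> decreases to \<open>lp\<close> the
  equilibria decrease to an equilibrium at \<open>lp\<close>, which cannot be bounded below on any open set by
  the strict inequality; being upper semicontinuous, it vanishes on a residual set. A minimal set
  other than the zero section lies on one side of zero, at a positive distance, which requires
  \<open>lp < l\<close>. For \<open>l < lm\<close> the linearisation contracts and dominates all solutions.

  Strict concavity is a statement about all ergodic measures, so it is void unless one exists.
  Therefore an ergodic measure is constructed first: time averages produce an invariant mean on the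
  continuous functions, the compact convex set of such means has an extreme point, and the Borel
  measure representing it is ergodic.
\<close>

section \<open>Means on a compact metric space and their representing measures\<close>

text \<open>Normalised positive linear functionals on the continuous functions, extended by zero to all
  functions: such a functional is determined by its values on continuous functions, and the set
  of all of them is closed in the product topology.\<close>

definition mean :: "(('w::metric_space \<Rightarrow> real) \<Rightarrow> real) \<Rightarrow> bool" where
  "mean L \<longleftrightarrow>
     (\<forall>g. \<not> continuous_on UNIV g \<longrightarrow> L g = 0) \<and>
     (\<forall>g h. continuous_on UNIV g \<and> continuous_on UNIV h \<longrightarrow> L (\<lambda>x. g x + h x) = L g + L h) \<and>
     (\<forall>c g. continuous_on UNIV g \<longrightarrow> L (\<lambda>x. c * g x) = c * L g) \<and>
     (\<forall>g. continuous_on UNIV g \<and> (\<forall>x. 0 \<le> g x) \<longrightarrow> 0 \<le> L g) \<and>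
     L (\<lambda>_. 1) = 1"

text \<open>The distance to the complement of \<open>U\<close>, a continuous function that is positive exactly on an
  open \<open>U\<close>. For \<open>U = UNIV\<close> the distance to the empty set would be \<open>0\<close>, hence the case
  distinction.\<close>

definition gap :: "'w::metric_space set \<Rightarrow> 'w \<Rightarrow> real" where
  "gap U x = (if U = UNIV then 1 else infdist x (- U))"

lemma continuous_gap: "continuous_on UNIV (gap U)"
  by (cases "U = UNIV") (auto simp: gap_def[abs_def] intro!: continuous_intros)

lemma gap_nonneg: "0 \<le> gap U x"
  by (simp add: gap_def infdist_nonneg)

lemma gap_pos_iff: "open U \<Longrightarrow> 0 < gap U x \<longleftrightarrow> x \<in> U"
proof -
  assume "open U"
  show ?thesis
  proof (cases "U = UNIV")
    case False
    then have "(x \<in> - U) = (infdist x (- U) = 0)"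
      by (intro in_closed_iff_infdist_zero) (use \<open>open U\<close> in auto)
    with False show ?thesis
      using infdist_nonneg[of x "- U"] by (auto simp: gap_def)
  qed (simp add: gap_def)
qed

lemma gap_outside: "open U \<Longrightarrow> x \<notin> U \<Longrightarrow> gap U x = 0"
  using gap_pos_iff[of U x] gap_nonneg[of U x] by linarith

text \<open>The layer decomposition: a bounded function is the sum of the truncations of its slices of
  height one. The next lemma counts the levels below \<open>y\<close>.\<close>

lemma sum_clamp: "0 \<le> y \<Longrightarrow> (\<Sum>k<n. max 0 (min 1 (y - real k))) = min y (real n)"
  by (induction n) (auto simp: max_def min_def)

lemma sum_clamp_ind: "0 \<le> y \<Longrightarrow> (\<Sum>k<n. (if real k < y then 1 else 0)) \<le> min (real n) (y + 1)"
proof (induction n)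
  case (Suc n)
  show ?case
  proof (cases "real n < y")
    case True
    then show ?thesis using Suc by simp
  next
    case False
    then show ?thesis using Suc by simp
  qed
qed simp

locale compact_mean =
  fixes L :: "('w::metric_space \<Rightarrow> real) \<Rightarrow> real"
  assumes compact_UNIV: "compact (UNIV :: 'w set)" and mean: "mean L"
begin

lemma L_add: "continuous_on UNIV g \<Longrightarrow> continuous_on UNIV h \<Longrightarrow> L (\<lambda>x. g x + h x) = L g + L h"
  and L_cmult: "continuous_on UNIV g \<Longrightarrow> L (\<lambda>x. c * g x) = c * L g"
  and L_nonneg: "continuous_on UNIV g \<Longrightarrow> (\<And>x. 0 \<le> g x) \<Longrightarrow> 0 \<le> L g"
  and L_one: "L (\<lambda>_. 1) = 1"
  using mean by (auto simp: mean_def)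

lemma L_const: "L (\<lambda>_. c) = c"
  using L_cmult[of "\<lambda>_. 1" c] L_one by simp

lemma L_diff:
  assumes "continuous_on UNIV g" "continuous_on UNIV h"
  shows "L (\<lambda>x. g x - h x) = L g - L h"
proof -
  have "L (\<lambda>x. g x + (-1) * h x) = L g + L (\<lambda>x. (-1) * h x)"
    using assms by (intro L_add continuous_intros)
  then show ?thesis using L_cmult[OF assms(2), of "-1"] by simp
qed

lemma L_mono:
  assumes "continuous_on UNIV g" "continuous_on UNIV h" "\<And>x. g x \<le> h x"
  shows "L g \<le> L h"
proof -
  have "0 \<le> L (\<lambda>x. h x - g x)"
    using assms by (intro L_nonneg continuous_intros) (auto simp: algebra_simps)
  then show ?thesis using L_diff[OF assms(2,1)] by simp
qed

lemma L_sum: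
  assumes "finite I" "\<And>i. i \<in> I \<Longrightarrow> continuous_on UNIV (g i)"
  shows "L (\<lambda>x. \<Sum>i\<in>I. g i x) = (\<Sum>i\<in>I. L (g i))"
  using assms
proof (induction I rule: finite_induct)
  case empty
  then show ?case using L_const[of 0] by simp
next
  case (insert i I)
  then show ?case by (simp add: L_add continuous_on_sum)
qed

text \<open>Riesz' construction of the representing measure: an open set has as content the supremum of
  the functional over the continuous functions between \<open>0\<close> and \<open>1\<close> that vanish off the set, and
  open supersets give an outer measure.\<close>

definition tests :: "'w set \<Rightarrow> ('w \<Rightarrow> real) set" where
  "tests U = {g. continuous_on UNIV g \<and> (\<forall>x. 0 \<le> g x \<and> g x \<le> 1) \<and> (\<forall>x. x \<notin> U \<longrightarrow> g x = 0)}"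

definition content :: "'w set \<Rightarrow> real" where
  "content U = (SUP g\<in>tests U. L g)"

definition outer :: "'w set \<Rightarrow> ennreal" where
  "outer A = (INF U\<in>{U. open U \<and> A \<subseteq> U}. ennreal (content U))"

lemma zero_in_tests: "(\<lambda>_. 0) \<in> tests U"
  by (simp add: tests_def)

lemma tests_le_one: "g \<in> tests U \<Longrightarrow> L g \<le> 1"
  using L_mono[of g "\<lambda>_. 1"] L_one by (auto simp: tests_def)

lemma bdd_tests: "bdd_above (L ` tests U)"
  using tests_le_one by (auto intro!: bdd_aboveI2[where M = 1])

lemma tests_le_content: "g \<in> tests U \<Longrightarrow> L g \<le> content U"
  unfolding content_def by (intro cSUP_upper bdd_tests)

lemma content_nonneg: "0 \<le> content U"
  using tests_le_content[OF zero_in_tests] L_const[of 0] by simp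

lemma content_leI: "(\<And>g. g \<in> tests U \<Longrightarrow> L g \<le> c) \<Longrightarrow> content U \<le> c"
  unfolding content_def using zero_in_tests by (intro cSUP_least) auto

lemma content_approx:
  assumes "e > 0" obtains g where "g \<in> tests U" "content U - e < L g"
proof -
  have "\<exists>g\<in>tests U. content U - e < L g"
    using assms zero_in_tests unfolding content_def
    by (subst less_cSUP_iff[symmetric]) (auto simp: bdd_tests)
  then show ?thesis using that by blast
qed

lemma content_mono: "U \<subseteq> V \<Longrightarrow> content U \<le> content V"
  by (intro content_leI tests_le_content) (auto simp: tests_def)

lemma content_empty: "content {} = 0"
proof -
  have "tests {} = {\<lambda>_. 0}" by (auto simp: tests_def)
  then show ?thesis by (simp add: content_def L_const)
qed

lemma content_UNIV: "content UNIV = 1"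
proof (rule antisym)
  show "1 \<le> content UNIV"
    using tests_le_content[of "\<lambda>_. 1" UNIV] L_one by (simp add: tests_def)
qed (intro content_leI tests_le_one)

lemma outer_le: "open U \<Longrightarrow> A \<subseteq> U \<Longrightarrow> outer A \<le> ennreal (content U)"
  unfolding outer_def by (rule INF_lower) auto

lemma outer_open: "open U \<Longrightarrow> outer U = ennreal (content U)"
  by (rule antisym, rule outer_le) (auto simp: outer_def intro!: INF_greatest ennreal_leI content_mono)

lemma outer_mono: "A \<subseteq> B \<Longrightarrow> outer A \<le> outer B"
  unfolding outer_def by (rule INF_superset_mono) auto

text \<open>A test function on a union is, up to \<open>e\<close>, a finite sum of test functions on the pieces:
  on the compact set where it is at least \<open>e\<close> finitely many pieces suffice, and the
  normalised gap functions of these pieces divide it.\<close>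

lemma content_UN:
  assumes U: "\<And>i::nat. open (U i)"
  shows "ennreal (content (\<Union>i. U i)) \<le> (\<Sum>i. ennreal (content (U i)))"
proof -
  have main: "ennreal (L g) \<le> (\<Sum>i. ennreal (content (U i))) + ennreal e"
    if g: "g \<in> tests (\<Union>i. U i)" and e: "e > 0" for g e
  proof -
    define K where "K = {x. e \<le> g x}"
    have cg: "continuous_on UNIV g" and g01: "\<And>x. 0 \<le> g x" "\<And>x. g x \<le> 1"
      and g0: "\<And>x. x \<notin> (\<Union>i. U i) \<Longrightarrow> g x = 0"
      using g by (auto simp: tests_def)
    have "closed K" unfolding K_def by (intro closed_Collect_le continuous_intros cg)
    then have K: "compact K" using compact_UNIV compact_Int_closed[of UNIV K] by simp
    have sub: "K \<subseteq> (\<Union>i\<in>UNIV. U i)"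
    proof
      fix x assume "x \<in> K"
      then have "g x \<noteq> 0" using e by (auto simp: K_def)
      then show "x \<in> (\<Union>i\<in>UNIV. U i)" using g0 by blast
    qed
    obtain J where J: "finite J" "K \<subseteq> (\<Union>i\<in>J. U i)"
      by (rule compactE_image[OF K _ sub]) (use U in auto)
    define s where "s x = (\<Sum>i\<in>J. gap (U i) x)" for x
    have cs: "continuous_on UNIV s"
      unfolding s_def[abs_def] by (intro continuous_on_sum continuous_gap)
    have s_pos: "0 < s x" if xK: "x \<in> K" for x
    proof -
      obtain j where "j \<in> J" "x \<in> U j" using xK J by blast
      then have "0 < gap (U j) x" using gap_pos_iff[OF U] by blast
      also have "\<dots> \<le> s x" unfolding s_def
        using \<open>j \<in> J\<close> J by (intro member_le_sum) (auto simp: gap_nonneg)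
      finally show ?thesis .
    qed
    obtain m where m: "m > 0" "\<And>x. x \<in> K \<Longrightarrow> m \<le> s x"
    proof (cases "K = {}")
      case False
      then obtain x where "x \<in> K" "\<And>y. y \<in> K \<Longrightarrow> s x \<le> s y"
        using continuous_attains_inf[OF K False continuous_on_subset[OF cs]] by blast
      then show ?thesis using that[of "s x"] s_pos by blast
    qed (use that[of 1] in auto)
    \<comment> \<open>dividing by at least \<open>m\<close> keeps the parts continuous off \<open>K\<close> and changes nothing on \<open>K\<close>\<close>
    define \<psi> where "\<psi> i x = g x * gap (U i) x / max (s x) m" for i x
    have c\<psi>: "continuous_on UNIV (\<psi> i)" for i
      unfolding \<psi>_def[abs_def] using m by (intro continuous_intros cg cs continuous_gap) (auto simp: max_def)
    have \<psi>t: "\<psi> i \<in> tests (U i)" if i: "i \<in> J" for i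
    proof -
      have "\<psi> i x \<le> 1" for x
      proof -
        have "gap (U i) x \<le> s x"
          unfolding s_def using i J by (intro member_le_sum) (auto simp: gap_nonneg)
        then have "g x * gap (U i) x \<le> 1 * max (s x) m"
          using g01 gap_nonneg[of "U i" x] by (intro mult_mono) auto
        then show ?thesis using m by (simp add: \<psi>_def divide_le_eq max_def)
      qed
      moreover have "0 \<le> \<psi> i x" for x
        unfolding \<psi>_def using m g01 gap_nonneg[of "U i" x] by (intro divide_nonneg_nonneg) auto
      moreover have "\<psi> i x = 0" if "x \<notin> U i" for x
        using gap_outside[OF U that] by (simp add: \<psi>_def)
      ultimately show ?thesis using c\<psi> by (simp add: tests_def)
    qed
    have le: "g x \<le> (\<Sum>i\<in>J. \<psi> i x) + e" for x
    proof (cases "x \<in> K")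
      case True
      have "(\<Sum>i\<in>J. \<psi> i x) = g x * s x / max (s x) m"
        unfolding \<psi>_def s_def by (simp add: sum_distrib_left sum_divide_distrib)
      also have "\<dots> = g x" using m(2)[OF True] m(1) by (simp add: max_def)
      finally show ?thesis using e by simp
    next
      case False
      then have "g x < e" by (simp add: K_def)
      moreover have "0 \<le> (\<Sum>i\<in>J. \<psi> i x)"
        using \<psi>t by (intro sum_nonneg) (auto simp: tests_def)
      ultimately show ?thesis by simp
    qed
    have "L g \<le> L (\<lambda>x. (\<Sum>i\<in>J. \<psi> i x) + e)"
      by (intro L_mono cg continuous_intros c\<psi> le)
    also have "\<dots> = (\<Sum>i\<in>J. L (\<psi> i)) + e"
      using J c\<psi> by (subst L_add) (auto simp: L_sum L_const intro!: continuous_intros)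
    also have "\<dots> \<le> (\<Sum>i\<in>J. content (U i)) + e"
      using \<psi>t by (intro add_right_mono sum_mono tests_le_content)
    finally have "ennreal (L g) \<le> ennreal ((\<Sum>i\<in>J. content (U i)) + e)"
      by (rule ennreal_leI)
    also have "\<dots> = (\<Sum>i\<in>J. ennreal (content (U i))) + ennreal e"
      using e by (subst ennreal_plus) (auto intro!: sum_nonneg simp: content_nonneg sum_ennreal)
    also have "(\<Sum>i\<in>J. ennreal (content (U i))) \<le> (\<Sum>i. ennreal (content (U i)))"
      using J by (intro sum_le_suminf) auto
    finally show ?thesis by (simp add: add_right_mono)
  qed
  let ?S = "\<Sum>i. ennreal (content (U i))"
  show ?thesis
  proof (cases "?S < \<top>")
    case True
    have "L g \<le> enn2real ?S" if g: "g \<in> tests (\<Union>i. U i)" for g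
    proof -
      have "ennreal (L g) \<le> ?S"
        by (rule ennreal_le_epsilon) (rule main[OF g])
      then have "enn2real (ennreal (L g)) \<le> enn2real ?S"
        using True by (intro enn2real_mono)
      moreover have "0 \<le> L g" using g by (intro L_nonneg) (auto simp: tests_def)
      ultimately show ?thesis by simp
    qed
    then have "content (\<Union>i. U i) \<le> enn2real ?S"
      by (rule content_leI)
    then have "ennreal (content (\<Union>i. U i)) \<le> ennreal (enn2real ?S)"
      by (rule ennreal_leI)
    also have "\<dots> = ?S" using True by (rule ennreal_enn2real)
    finally show ?thesis .
  next
    case False
    then have "?S = \<top>" by (simp only: less_top[symmetric] not_not)
    then show ?thesis by (simp only: top_greatest)
  qed
qed

lemma outer_UN: "outer (\<Union>i::nat. A i) \<le> (\<Sum>i. outer (A i))"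
proof (rule ennreal_le_epsilon)
  fix e :: real assume e: "0 < e"
  have fin: "outer B < \<top>" for B
    using outer_le[of UNIV B] by (simp add: order_le_less_trans)
  have "\<exists>U. open U \<and> A i \<subseteq> U \<and> ennreal (content U) \<le> outer (A i) + ennreal (e * (1/2)^Suc i)" for i
  proof -
    have "outer (A i) < outer (A i) + ennreal (e * (1/2)^Suc i)"
      using fin[of "A i"] e by simp
    then have "\<exists>U\<in>{U. open U \<and> A i \<subseteq> U}. ennreal (content U) < outer (A i) + ennreal (e * (1/2)^Suc i)"
      unfolding outer_def by (subst (asm) (1) INF_less_iff) auto
    then show ?thesis by (auto intro: less_imp_le)
  qed
  then obtain U where U: "\<And>i. open (U i)" "\<And>i. A i \<subseteq> U i"
      "\<And>i. ennreal (content (U i)) \<le> outer (A i) + ennreal (e * (1/2)^Suc i)"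
    by metis
  have "(\<lambda>i. e * (1/2)^Suc i) sums (e * 1)"
    by (rule sums_mult[OF power_half_series])
  then have half: "(\<Sum>i. ennreal (e * (1/2)^Suc i)) = ennreal (e * 1)"
    using e by (intro suminf_ennreal_eq mult_nonneg_nonneg zero_le_power) auto
  have "outer (\<Union>i. A i) \<le> ennreal (content (\<Union>i. U i))"
    using U by (intro outer_le) auto
  also have "\<dots> \<le> (\<Sum>i. ennreal (content (U i)))"
    using U by (intro content_UN)
  also have "\<dots> \<le> (\<Sum>i. outer (A i) + ennreal (e * (1/2)^Suc i))"
    using U by (intro suminf_le) auto
  also have "\<dots> = (\<Sum>i. outer (A i)) + (\<Sum>i. ennreal (e * (1/2)^Suc i))"
    by (rule suminf_add[symmetric]) auto
  also have "\<dots> = (\<Sum>i. outer (A i)) + ennreal e"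
    unfolding half by simp
  finally show "outer (\<Union>i. A i) \<le> (\<Sum>i. outer (A i)) + ennreal e" .
qed

lemma outer_measure_space: "outer_measure_space (Pow UNIV) outer"
  unfolding outer_measure_space_def
proof (intro conjI)
  show "positive (Pow UNIV) outer"
    by (simp add: positive_def outer_open content_empty)
  show "increasing (Pow UNIV) outer"
    by (simp add: increasing_def outer_mono)
  show "countably_subadditive (Pow UNIV) outer"
    by (auto simp: countably_subadditive_def outer_UN)
qed

text \<open>Open sets satisfy Caratheodory's condition. A test function \<open>g\<close> on \<open>V \<inter> U\<close> that nearly attains
  the content may be lowered by \<open>d\<close> at a small cost; afterwards it vanishes off the closed set
  where \<open>d \<le> g\<close>, and a test function of the complement of that set in \<open>V\<close> can be added to it
  without exceeding \<open>1\<close>.\<close>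

lemma outer_split_open:
  assumes U: "open U" shows "outer (A \<inter> U) + outer (A - U) \<le> outer A"
  unfolding outer_def[of A]
proof (rule INF_greatest, clarsimp)
  fix V assume V: "open V" "A \<subseteq> V"
  show "outer (A \<inter> U) + outer (A - U) \<le> ennreal (content V)"
  proof (rule ennreal_le_epsilon)
    fix e :: real assume "e > 0"
    define d where "d = e / 3"
    have d: "d > 0" using \<open>e > 0\<close> by (simp add: d_def)
    obtain g where g: "g \<in> tests (V \<inter> U)" "content (V \<inter> U) - d < L g"
      using content_approx[OF d] .
    have cg: "continuous_on UNIV g" using g by (simp add: tests_def)
    define k where "k x = max 0 (g x - d)" for x
    have ck: "continuous_on UNIV k"
      unfolding k_def[abs_def] by (intro continuous_intros cg)
    define W where "W = V - {x. d \<le> g x}"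
    have W: "open W"
      unfolding W_def using V by (intro open_Diff closed_Collect_le continuous_intros cg)
    obtain h where h: "h \<in> tests W" "content W - d < L h"
      using content_approx[OF d] .
    have ch: "continuous_on UNIV h" using h by (simp add: tests_def)
    have "(\<lambda>x. k x + h x) \<in> tests V"
    proof -
      have "0 \<le> k x + h x \<and> k x + h x \<le> 1 \<and> (x \<notin> V \<longrightarrow> k x + h x = 0)" for x
      proof (cases "d \<le> g x")
        case True
        then have "h x = 0" "x \<in> V" using h g d by (auto simp: tests_def W_def)
        moreover have "g x \<le> 1" using g by (simp add: tests_def)
        ultimately show ?thesis using True d by (simp add: k_def)
      next
        case False
        then have "k x = 0" by (simp add: k_def)
        then show ?thesis using h by (auto simp: tests_def W_def)
      qed
      then show ?thesis using ck ch by (auto simp: tests_def intro!: continuous_intros)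
    qed
    then have "L k + L h \<le> content V"
      using tests_le_content L_add[OF ck ch] by fastforce
    moreover have "L g - d \<le> L k"
    proof -
      have "L (\<lambda>x. g x - d) \<le> L k"
        using cg ck by (intro L_mono continuous_intros) (auto simp: k_def)
      then show ?thesis using L_diff[OF cg, of "\<lambda>_. d"] L_const by simp
    qed
    ultimately have *: "content (V \<inter> U) + content W \<le> content V + e"
      using g h by (simp add: d_def)
    have "A - U \<subseteq> W"
    proof
      fix x assume "x \<in> A - U"
      then have "x \<in> V" "g x = 0" using V g by (auto simp: tests_def)
      then show "x \<in> W" using d by (simp add: W_def)
    qed
    then have "outer (A \<inter> U) + outer (A - U) \<le> ennreal (content (V \<inter> U)) + ennreal (content W)"
      using V U W by (intro add_mono outer_le) auto
    also have "\<dots> = ennreal (content (V \<inter> U) + content W)"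
      by (simp add: content_nonneg)
    also have "\<dots> \<le> ennreal (content V + e)" using * by (rule ennreal_leI)
    finally show "outer (A \<inter> U) + outer (A - U) \<le> ennreal (content V) + ennreal e"
      using \<open>e > 0\<close> by (simp add: content_nonneg)
  qed
qed

lemma open_in_lambda_system: "open U \<Longrightarrow> U \<in> lambda_system UNIV (Pow UNIV) outer"
proof -
  assume U: "open U"
  interpret algebra UNIV "Pow (UNIV :: 'w set)" by (rule algebra_Pow)
  have "outer A \<le> outer (A \<inter> U) + outer (A - U)" for A
  proof -
    have "subadditive (Pow UNIV) outer"
      using outer_measure_space countably_subadditive_subadditive
      unfolding outer_measure_space_def by blast
    then have "outer ((A \<inter> U) \<union> (A - U)) \<le> outer (A \<inter> U) + outer (A - U)"
      unfolding subadditive_def by (drule_tac bspec[of _ _ "A \<inter> U"]) auto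
    then show ?thesis by (simp add: Int_Diff_Un)
  qed
  then have "outer (A \<inter> U) + outer (A - U) = outer A" for A
    using outer_split_open[OF U] by (intro antisym)
  then show ?thesis
    by (subst lambda_system_eq) simp
qed

definition rep :: "'w measure" where
  "rep = measure_of UNIV (sets borel) outer"

lemma sets_rep[simp, measurable_cong]: "sets rep = sets borel"
  unfolding rep_def by (metis sets_measure_of space_borel sets.sets_measure_of_eq sets.space_closed)

lemma space_rep[simp]: "space rep = UNIV"
  by (simp add: rep_def space_measure_of_conv)

lemma emeasure_rep: "A \<in> sets borel \<Longrightarrow> emeasure rep A = outer A"
proof -
  assume A: "A \<in> sets borel"
  interpret sigma_algebra UNIV "Pow (UNIV :: 'w set)" by (rule sigma_algebra_Pow)
  let ?S = "lambda_system UNIV (Pow UNIV) outer"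
  have ms: "measure_space UNIV ?S outer"
    using caratheodory_lemma[OF outer_measure_space] by simp
  then have sa: "sigma_algebra UNIV ?S" and "countably_additive ?S outer"
    by (auto simp: measure_space_def)
  have sub: "sets borel \<subseteq> ?S"
    using sigma_algebra.sigma_sets_subset[OF sa, of "Collect open"] open_in_lambda_system
    by (auto simp only: sets_borel)
  have ca: "countably_additive (sets borel) outer"
    unfolding countably_additive_def
  proof safe
    fix B :: "nat \<Rightarrow> 'w set"
    assume "range B \<subseteq> sets borel" "disjoint_family B" "(\<Union>i. B i) \<in> sets borel"
    with sub have "range B \<subseteq> ?S" "(\<Union>i. B i) \<in> ?S" "disjoint_family B" by blast+
    then show "(\<Sum>i. outer (B i)) = outer (\<Union>i. B i)"
      using \<open>countably_additive ?S outer\<close> unfolding countably_additive_def by blast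
  qed
  have pos: "positive (sets borel) outer"
    by (simp add: positive_def outer_open content_empty)
  show ?thesis
    by (rule emeasure_measure_of[OF rep_def]) (use A pos ca in auto)
qed

lemma prob_rep: "prob_space rep"
  by (rule prob_spaceI) (simp add: emeasure_rep outer_open content_UNIV)

lemma measure_rep_UNIV[simp]: "measure rep UNIV = 1"
  by (simp add: measure_def emeasure_rep outer_open content_UNIV)

lemma measure_rep_open: "open U \<Longrightarrow> measure rep U = content U"
  by (simp add: measure_def emeasure_rep outer_open content_nonneg)

lemma integrable_rep: 
  assumes "continuous_on UNIV g" shows "integrable rep (g :: 'w \<Rightarrow> real)"
proof -
  interpret prob_space rep by (rule prob_rep)
  have "compact (range g)" by (rule compact_continuous_image[OF assms compact_UNIV])
  then obtain B where "\<And>x. \<bar>g x\<bar> \<le> B"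
    using compact_imp_bounded bounded_iff[of "range g"] by auto
  moreover have "g \<in> borel_measurable rep"
    using borel_measurable_continuous_onI[OF assms] by (simp cong: measurable_cong_sets)
  ultimately show ?thesis
    by (intro integrable_const_bound[of _ B]) auto
qed

text \<open>The slices of \<open>n * g\<close> are test functions on the superlevel sets of \<open>g\<close>, so the functional is
  bounded by a Riemann sum for the integral with error \<open>1 / n\<close>.\<close>

lemma L_le_integral:
  assumes g: "g \<in> tests UNIV" shows "L g \<le> integral\<^sup>L rep g"
proof -
  interpret prob_space rep by (rule prob_rep)
  have cg: "continuous_on UNIV g" and g01: "\<And>x. 0 \<le> g x" "\<And>x. g x \<le> 1"
    using g by (auto simp: tests_def)
  have *: "L g \<le> integral\<^sup>L rep g + 1 / real n" if n: "n > 0" for n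
  proof -
    define h where "h k x = max 0 (min 1 (real n * g x - real k))" for k x
    define V where "V k = {x. real k < real n * g x}" for k :: nat
    have oV: "open (V k)" for k
      unfolding V_def by (intro open_Collect_less continuous_intros cg)
    have ch: "continuous_on UNIV (h k)" for k
      unfolding h_def[abs_def] by (intro continuous_intros cg)
    have ht: "h k \<in> tests (V k)" for k
      using ch by (auto simp: tests_def h_def V_def)
    have iV: "integrable rep (\<lambda>x. indicator (V k) x :: real)" for k
      using oV[of k] by (intro integrable_real_indicator) (auto simp: emeasure_eq_measure)
    have "real n * L g = L (\<lambda>x. \<Sum>k<n. h k x)"
    proof -
      have "(\<Sum>k<n. h k x) = real n * g x" for x
      proof -
        have "real n * g x \<le> real n * 1" using g01 by (intro mult_left_mono) auto
        then show ?thesis unfolding h_def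
          by (subst sum_clamp) (use g01[of x] in auto)
      qed
      then show ?thesis using L_cmult[OF cg] by simp
    qed
    also have "\<dots> = (\<Sum>k<n. L (h k))" using ch by (intro L_sum) auto
    also have "\<dots> \<le> (\<Sum>k<n. measure rep (V k))"
      using tests_le_content[OF ht] measure_rep_open[OF oV] by (intro sum_mono) simp
    also have "\<dots> = (\<Sum>k<n. integral\<^sup>L rep (indicator (V k)))"
      using oV by (intro sum.cong) auto
    also have "\<dots> = integral\<^sup>L rep (\<lambda>x. \<Sum>k<n. indicator (V k) x)"
      using iV by (subst Bochner_Integration.integral_sum) auto
    also have "\<dots> \<le> integral\<^sup>L rep (\<lambda>x. real n * g x + 1)"
    proof (rule integral_mono)
      show "integrable rep (\<lambda>x. \<Sum>k<n. indicator (V k) x :: real)"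
        using iV by (intro Bochner_Integration.integrable_sum)
      show "integrable rep (\<lambda>x. real n * g x + 1)"
        using integrable_rep[OF cg] by simp
      fix x
      have "(\<Sum>k<n. indicator (V k) x) = (\<Sum>k<n. if real k < real n * g x then 1 else 0 :: real)"
        by (intro sum.cong) (auto simp: V_def indicator_def)
      also have "\<dots> \<le> min (real n) (real n * g x + 1)"
        using g01[of x] by (intro sum_clamp_ind) auto
      finally show "(\<Sum>k<n. indicator (V k) x) \<le> real n * g x + 1" by simp
    qed
    also have "\<dots> = real n * integral\<^sup>L rep g + 1"
      using integrable_rep[OF cg] by simp
    finally show ?thesis using n by (simp add: field_simps)
  qed
  have "(\<lambda>n. integral\<^sup>L rep g + 1 / real n) \<longlonglongrightarrow> integral\<^sup>L rep g + 0"
    by (intro tendsto_intros lim_1_over_n)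
  then have "(\<lambda>n. integral\<^sup>L rep g + 1 / real n) \<longlonglongrightarrow> integral\<^sup>L rep g" by simp
  moreover have "eventually (\<lambda>n. L g \<le> integral\<^sup>L rep g + 1 / real n) sequentially"
    using * by (intro eventually_sequentiallyI[of 1]) auto
  ultimately show ?thesis by (rule tendsto_lowerbound) simp
qed

text \<open>Applied to \<open>g\<close> and to \<open>1 - g\<close>, the previous inequality becomes an equality, and scaling
  removes the bounds on \<open>g\<close>.\<close>

theorem integral_rep:
  assumes cg: "continuous_on UNIV g" shows "integral\<^sup>L rep g = L g"
proof -
  interpret prob_space rep by (rule prob_rep)
  have "compact (range g)" by (rule compact_continuous_image[OF cg compact_UNIV])
  then obtain B where B: "B > 0" "\<And>x. \<bar>g x\<bar> \<le> B"
    using compact_imp_bounded bounded_pos[of "range g"] by auto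
  define h where "h x = (1/(2*B)) * g x + 1/2" for x
  have ch: "continuous_on UNIV h" unfolding h_def[abs_def] by (intro continuous_intros cg)
  have h01: "0 \<le> h x" "h x \<le> 1" for x
    using B(2)[of x] B(1) by (auto simp: h_def field_simps abs_le_iff)
  have "L h \<le> integral\<^sup>L rep h"
    using ch h01 by (intro L_le_integral) (auto simp: tests_def)
  moreover have "L (\<lambda>x. 1 - h x) \<le> integral\<^sup>L rep (\<lambda>x. 1 - h x)"
    using ch h01 by (intro L_le_integral) (auto simp: tests_def intro!: continuous_intros)
  ultimately have "integral\<^sup>L rep h = L h"
    using integrable_rep[OF ch] L_diff[OF _ ch, of "\<lambda>_. 1"] L_one by simp
  moreover have "L h = (1/(2*B)) * L g + 1/2"
  proof -
    have "L h = L (\<lambda>x. (1/(2*B)) * g x) + L (\<lambda>_. 1/2)"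
      unfolding h_def by (intro L_add continuous_intros cg)
    then show ?thesis by (simp only: L_cmult[OF cg] L_const)
  qed
  moreover have "integral\<^sup>L rep h = (1/(2*B)) * integral\<^sup>L rep g + 1/2"
    unfolding h_def using integrable_rep[OF cg] by simp
  ultimately show ?thesis using B(1) by simp
qed

end

section \<open>Existence of an ergodic measure\<close>

text \<open>A finite Borel measure is determined by the integrals of continuous functions, since
  indicators of open sets are limits of truncated multiples of gap functions.\<close>

lemma finite_measure_eqI_integral:
  fixes M N :: "'w::metric_space measure"
  assumes M: "finite_measure M" "sets M = sets borel" and N: "finite_measure N" "sets N = sets borel"
    and eq: "\<And>g :: 'w \<Rightarrow> real. continuous_on UNIV g \<Longrightarrow> (\<And>x. 0 \<le> g x \<and> g x \<le> 1) \<Longrightarrow> integral\<^sup>L M g = integral\<^sup>L N g"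
  shows "M = N"
proof -
  interpret M: finite_measure M by fact
  interpret N: finite_measure N by fact
  define g where "g U n x = min 1 (real n * gap U x)" for U :: "'w set" and n x
  have cg: "continuous_on UNIV (g U n)" for U n
    unfolding g_def[abs_def] by (intro continuous_intros continuous_gap)
  have g01: "0 \<le> g U n x \<and> g U n x \<le> 1" for U n x
    using gap_nonneg[of U x] by (auto simp: g_def)
  have lim: "(\<lambda>n. g U n x) \<longlonglongrightarrow> indicator U x" if "open U" for U x
  proof (cases "x \<in> U")
    case True
    then have pos: "gap U x > 0" using gap_pos_iff[OF that] by blast
    obtain n0 :: nat where n0: "1 / gap U x < real n0" using reals_Archimedean2 by blast
    have "g U n x = 1" if "n \<ge> n0" for n
    proof -
      have "1 / gap U x < real n" using n0 that by linarith
      then show ?thesis using pos by (simp add: g_def field_simps)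
    qed
    then have "eventually (\<lambda>n. g U n x = indicator U x) sequentially"
      using True by (auto intro: eventually_sequentiallyI[of n0])
    then show ?thesis by (rule tendsto_eventually)
  next
    case False
    then show ?thesis using gap_outside[OF that] by (simp add: g_def)
  qed
  have lim_int: "(\<lambda>n. integral\<^sup>L P (g U n)) \<longlonglongrightarrow> measure P U"
    if "finite_measure P" "sets P = sets borel" "open U" for P U
  proof -
    interpret P: finite_measure P by fact
    have "(\<lambda>n. integral\<^sup>L P (g U n)) \<longlonglongrightarrow> integral\<^sup>L P (indicator U)"
    proof (rule integral_dominated_convergence[where w = "\<lambda>_. 1"])
      show "indicator U \<in> borel_measurable P"
        by (rule borel_measurable_indicator) (use that in simp)
      show "g U n \<in> borel_measurable P" for n
        using borel_measurable_continuous_onI[OF cg] that by (simp cong: measurable_cong_sets)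
    qed (use lim[OF that(3)] g01 in auto)
    moreover have "space P = UNIV" using sets_eq_imp_space_eq[OF that(2)] by simp
    ultimately show ?thesis by simp
  qed
  have open_eq: "emeasure M U = emeasure N U" if "open U" for U
  proof -
    have "(\<lambda>n. integral\<^sup>L M (g U n)) \<longlonglongrightarrow> measure N U"
      using lim_int[OF N that] eq[OF cg g01] by simp
    then have "measure M U = measure N U"
      using lim_int[OF M that] LIMSEQ_unique by blast
    then show ?thesis by (simp add: M.emeasure_eq_measure N.emeasure_eq_measure)
  qed
  show ?thesis
  proof (rule measure_eqI_generator_eq[where E = "Collect open" and \<Omega> = UNIV and A = "\<lambda>_. UNIV"])
    show "Int_stable (Collect open :: 'w set set)" by (auto simp: Int_stable_def)
  qed (use M N open_eq in \<open>auto simp: sets_borel\<close>)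
qed

locale compact_flow =
  fixes \<sigma> :: "real \<Rightarrow> 'w::metric_space \<Rightarrow> 'w"
  assumes compact_base: "compact (UNIV :: 'w set)" and flow: "continuous_flow \<sigma>"
begin

lemma flow_zero [simp]: "\<sigma> 0 w = w"
  and flow_add: "\<sigma> s (\<sigma> t w) = \<sigma> (s + t) w"
  using flow by (auto simp: continuous_flow_def)

lemma continuous_flow_comp [continuous_intros]:
  assumes "continuous_on S a" "continuous_on S b"
  shows "continuous_on S (\<lambda>x. \<sigma> (a x) (b x))"
proof -
  have "continuous_on UNIV (\<lambda>(t, w). \<sigma> t w)" using flow by (simp add: continuous_flow_def)
  from continuous_on_compose2[OF this continuous_on_Pair[OF assms]] show ?thesis by simp
qed

text \<open>The growth exponent of the linear equation \<open>x' = c (\<sigma> t w) x\<close>. Its properties are obtained by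
  recognising antiderivatives along orbits, not by manipulating integrals.\<close>

definition cocycle :: "('w \<Rightarrow> real) \<Rightarrow> 'w \<Rightarrow> real \<Rightarrow> real" where
  "cocycle c w t = (LBINT s=ereal 0..ereal t. c (\<sigma> s w))"

lemma continuous_along: "continuous_on UNIV (c :: 'w \<Rightarrow> 'b::topological_space) \<Longrightarrow> continuous_on S (\<lambda>s. c (\<sigma> s w))"
  by (rule continuous_on_compose2[of UNIV c]) (auto intro!: continuous_intros)

lemma cocycle_eqI:
  assumes "continuous_on UNIV c" "\<And>s. (P has_real_derivative c (\<sigma> s w)) (at s)" "P 0 = 0"
  shows "cocycle c w t = P t"
proof -
  have "(LBINT s=ereal 0..ereal t. c (\<sigma> s w)) = P t - P 0"
    using assms(2) by (intro interval_integral_FTC_finite continuous_along assms)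
      (auto simp: has_real_derivative_iff_has_vector_derivative intro: has_vector_derivative_at_within)
  then show ?thesis using assms by (simp add: cocycle_def)
qed

lemma cocycle_deriv:
  assumes "continuous_on UNIV c"
  shows "(cocycle c w has_real_derivative c (\<sigma> t w)) (at t)"
proof -
  define r where "r = \<bar>t\<bar> + 1"
  have "((\<lambda>u. LBINT y=ereal 0..ereal u. c (\<sigma> y w)) has_vector_derivative c (\<sigma> t w)) (at t within {-r..r})"
    by (rule interval_integral_FTC2) (auto intro: continuous_along assms simp: r_def)
  moreover have "at t within {-r..r} = at t"
    by (rule at_within_Icc_at) (auto simp: r_def)
  ultimately have "((\<lambda>u. LBINT y=ereal 0..ereal u. c (\<sigma> y w)) has_vector_derivative c (\<sigma> t w)) (at t)"
    by (simp only:)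
  then show ?thesis
    by (simp add: has_real_derivative_iff_has_vector_derivative cocycle_def[abs_def])
qed

lemma cocycle_zero [simp]: "cocycle c w 0 = 0"
  by (simp add: cocycle_def)

lemma cocycle_shift:
  assumes "continuous_on UNIV c"
  shows "cocycle c (\<sigma> r w) t = cocycle c w (t + r) - cocycle c w r"
proof (rule cocycle_eqI[OF assms])
  fix s
  show "((\<lambda>t. cocycle c w (t + r) - cocycle c w r) has_real_derivative c (\<sigma> s (\<sigma> r w))) (at s)"
    using DERIV_shift[of "cocycle c w" "c (\<sigma> (s + r) w)" s r] cocycle_deriv[OF assms, of w "s + r"]
    by (auto simp: flow_add intro!: derivative_eq_intros)
qed simp

definition invariant_means :: "(('w \<Rightarrow> real) \<Rightarrow> real) set" where
  "invariant_means = {L. mean L \<and> (\<forall>t g. continuous_on UNIV g \<longrightarrow> L (\<lambda>x. g (\<sigma> t x)) = L g)}"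

text \<open>The value \<open>0\<close> on discontinuous functions matches the extension of means by zero, so that
  \<open>sup_abs\<close> bounds every mean on all functions.\<close>

definition sup_abs :: "('w \<Rightarrow> real) \<Rightarrow> real" where
  "sup_abs g = (if continuous_on UNIV g then SUP x. \<bar>g x\<bar> else 0)"

lemma sup_abs: "continuous_on UNIV g \<Longrightarrow> \<bar>g x\<bar> \<le> sup_abs g"
proof -
  assume g: "continuous_on UNIV g"
  have "compact (range g)" by (rule compact_continuous_image[OF g compact_base])
  then obtain B where "\<And>x. \<bar>g x\<bar> \<le> B"
    using compact_imp_bounded bounded_iff[of "range g"] by auto
  then have "bdd_above (range (\<lambda>x. \<bar>g x\<bar>))" by (auto intro!: bdd_aboveI2)
  then show ?thesis using g by (auto simp: sup_abs_def intro: cSUP_upper)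
qed

lemma mean_bound:
  assumes "mean L" shows "\<bar>L g\<bar> \<le> sup_abs g"
proof (cases "continuous_on UNIV g")
  case True
  interpret compact_mean L using assms compact_base by unfold_locales
  have "- sup_abs g \<le> g x" "g x \<le> sup_abs g" for x
    using sup_abs[OF True, of x] by auto
  then have "L g \<le> L (\<lambda>_. sup_abs g)" "L (\<lambda>_. - sup_abs g) \<le> L g"
    by (auto intro!: L_mono True)
  then show ?thesis by (simp add: L_const abs_le_iff)
next
  case False
  then show ?thesis using assms by (auto simp: mean_def sup_abs_def)
qed

text \<open>Tychonoff's theorem.\<close>

lemma compact_bounded_functionals:
  "compact {L :: ('w \<Rightarrow> real) \<Rightarrow> real. \<forall>g. \<bar>L g\<bar> \<le> sup_abs g}"
proof -
  have "compactin (product_topology (\<lambda>_. euclidean) UNIV) (PiE UNIV (\<lambda>g. {- sup_abs g..sup_abs g}))"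
    by (subst compactin_PiE) auto
  moreover have "PiE UNIV (\<lambda>g. {- sup_abs g..sup_abs g}) = {L. \<forall>g. \<bar>L g\<bar> \<le> sup_abs g}"
    by (auto simp: PiE_UNIV_domain abs_le_iff minus_le_iff)
  ultimately show ?thesis by (simp add: euclidean_product_topology)
qed

lemma continuous_eval: "continuous_on S (\<lambda>L :: ('w \<Rightarrow> real) \<Rightarrow> real. L g)"
  by (rule continuous_on_subset[OF continuous_on_product_coordinates]) simp

lemma closed_means: "closed {L :: ('w \<Rightarrow> real) \<Rightarrow> real. mean L}"
  unfolding mean_def
  by (intro closed_Collect_conj closed_Collect_all closed_Collect_imp open_Collect_const
        closed_Collect_eq closed_Collect_le continuous_intros continuous_eval)

lemma compact_means: "compact {L :: ('w \<Rightarrow> real) \<Rightarrow> real. mean L}"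
proof -
  have "{L. mean L} = {L. \<forall>g. \<bar>L g\<bar> \<le> sup_abs g} \<inter> {L. mean L}"
    using mean_bound by auto
  then show ?thesis
    using compact_Int_closed[OF compact_bounded_functionals closed_means] by simp
qed

lemma compact_invariant_means: "compact invariant_means"
proof -
  have "closed {L :: ('w \<Rightarrow> real) \<Rightarrow> real. \<forall>t g. continuous_on UNIV g \<longrightarrow> L (\<lambda>x. g (\<sigma> t x)) = L g}"
    by (intro closed_Collect_all closed_Collect_imp open_Collect_const
        closed_Collect_eq continuous_eval)
  from compact_Int_closed[OF compact_means this] show ?thesis
    unfolding invariant_means_def by (simp add: Collect_conj_eq)
qed

text \<open>Time averages along an orbit over longer and longer intervals are asymptotically invariant
  means; a cluster point of them is an invariant mean.\<close>

lemma invariant_means_nonempty: "invariant_means \<noteq> {}"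
proof -
  obtain w :: 'w where True by blast
  define A where "A n g = (if continuous_on UNIV g then cocycle g w (real (Suc n)) / real (Suc n) else 0)" for n g
  have mA: "mean (A n)" for n
    unfolding mean_def
  proof (intro conjI allI impI)
    fix g h :: "'w \<Rightarrow> real" assume "continuous_on UNIV g \<and> continuous_on UNIV h"
    then have c: "continuous_on UNIV g" "continuous_on UNIV h" by auto
    have "cocycle (\<lambda>x. g x + h x) w t = cocycle g w t + cocycle h w t" for t
      by (rule cocycle_eqI) (auto intro!: continuous_intros c DERIV_add cocycle_deriv)
    then show "A n (\<lambda>x. g x + h x) = A n g + A n h"
      using c by (simp add: A_def add_divide_distrib continuous_on_add)
  next
    fix k and g :: "'w \<Rightarrow> real" assume c: "continuous_on UNIV g"
    have "cocycle (\<lambda>x. k * g x) w t = k * cocycle g w t" for t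
      by (rule cocycle_eqI) (auto intro!: continuous_intros c DERIV_cmult cocycle_deriv)
    then show "A n (\<lambda>x. k * g x) = k * A n g"
      using c by (simp add: A_def continuous_on_mult_left)
  next
    fix g :: "'w \<Rightarrow> real" assume c: "continuous_on UNIV g \<and> (\<forall>x. 0 \<le> g x)"
    have "cocycle g w 0 \<le> cocycle g w (real (Suc n))"
      by (rule DERIV_nonneg_imp_nondecreasing) (use c cocycle_deriv[of g w] in auto)
    then show "0 \<le> A n g" by (simp add: A_def)
  next
    have "cocycle (\<lambda>_. 1) w t = t" for t
      by (rule cocycle_eqI) (auto intro!: derivative_eq_intros)
    then show "A n (\<lambda>_. 1) = 1" by (simp add: A_def)
  qed (simp add: A_def)
  have inv: "\<bar>A n (\<lambda>x. g (\<sigma> t x)) - A n g\<bar> \<le> 2 * sup_abs g * \<bar>t\<bar> / real (Suc n)"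
    if c: "continuous_on UNIV g" for n t g
  proof -
    have c': "continuous_on UNIV (\<lambda>x. g (\<sigma> t x))"
      by (rule continuous_on_compose2[OF c]) (auto intro!: continuous_intros)
    have eq: "cocycle (\<lambda>x. g (\<sigma> t x)) w s = cocycle g w (s + t) - cocycle g w t" for s
    proof (rule cocycle_eqI[OF c'])
      fix s
      show "((\<lambda>s. cocycle g w (s + t) - cocycle g w t) has_real_derivative g (\<sigma> t (\<sigma> s w))) (at s)"
        using DERIV_shift[of "cocycle g w" "g (\<sigma> (s + t) w)" s t] cocycle_deriv[OF c, of w "s + t"]
        by (auto simp: flow_add add.commute intro!: derivative_eq_intros)
    qed simp
    have lip: "\<bar>cocycle g w (s + t) - cocycle g w s\<bar> \<le> sup_abs g * \<bar>t\<bar>" for s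
    proof -
      have "norm (cocycle g w (s + t) - cocycle g w s) \<le> sup_abs g * norm ((s + t) - s)"
        by (rule field_differentiable_bound[of UNIV])
          (auto intro!: cocycle_deriv[OF c] sup_abs[OF c])
      then show ?thesis by simp
    qed
    let ?N = "real (Suc n)"
    have "\<bar>cocycle (\<lambda>x. g (\<sigma> t x)) w ?N - cocycle g w ?N\<bar> \<le> 2 * sup_abs g * \<bar>t\<bar>"
      using lip[of ?N] lip[of 0] unfolding eq by simp
    then have "\<bar>cocycle (\<lambda>x. g (\<sigma> t x)) w ?N - cocycle g w ?N\<bar> / ?N \<le> 2 * sup_abs g * \<bar>t\<bar> / ?N"
      by (intro divide_right_mono) auto
    moreover have "A n (\<lambda>x. g (\<sigma> t x)) - A n g = (cocycle (\<lambda>x. g (\<sigma> t x)) w ?N - cocycle g w ?N) / ?N"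
      using c c' by (simp add: A_def diff_divide_distrib)
    ultimately show ?thesis by (simp add: abs_divide)
  qed
  have "filtermap A sequentially \<noteq> bot" by (simp add: filtermap_bot_iff)
  moreover have "eventually (\<lambda>L. L \<in> {L. mean L}) (filtermap A sequentially)"
    using mA by (simp add: eventually_filtermap)
  ultimately obtain L where L: "mean L" and cluster: "inf (nhds L) (filtermap A sequentially) \<noteq> bot"
    using compact_means[unfolded compact_filter] by blast
  \<comment> \<open>a cluster point inherits every closed condition that holds eventually\<close>
  have closed_mem: "L \<in> C" if "closed C" "eventually (\<lambda>n. A n \<in> C) sequentially" for C
  proof (rule ccontr)
    assume "L \<notin> C"
    then have 1: "eventually (\<lambda>x. x \<in> - C) (nhds L)"
      using that by (intro eventually_nhds_in_open) auto
    have 2: "eventually (\<lambda>x. x \<in> C) (filtermap A sequentially)"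
      using that by (simp add: eventually_filtermap)
    have "eventually (\<lambda>_. False) (inf (nhds L) (filtermap A sequentially))"
      unfolding eventually_inf using 1 2 by (intro exI conjI) auto
    with cluster show False by (simp add: trivial_limit_def)
  qed
  have "L (\<lambda>x. g (\<sigma> t x)) = L g" if c: "continuous_on UNIV g" for t g
  proof -
    have "\<bar>L (\<lambda>x. g (\<sigma> t x)) - L g\<bar> \<le> 0 + e" if "e > 0" for e
    proof -
      let ?C = "{M :: ('w \<Rightarrow> real) \<Rightarrow> real. \<bar>M (\<lambda>x. g (\<sigma> t x)) - M g\<bar> \<le> e}"
      have "closed ?C" by (intro closed_Collect_le continuous_intros continuous_eval)
      moreover have "eventually (\<lambda>n. A n \<in> ?C) sequentially"
      proof -
        have "(\<lambda>n. 2 * sup_abs g * \<bar>t\<bar> / real (Suc n)) \<longlonglongrightarrow> 0"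
          by (intro LIMSEQ_Suc lim_const_over_n)
        then have "eventually (\<lambda>n. 2 * sup_abs g * \<bar>t\<bar> / real (Suc n) < e) sequentially"
          using that by (rule order_tendstoD)
        then show ?thesis
        proof eventually_elim
          case (elim n)
          then show ?case using inv[OF c, of n t] by simp
        qed
      qed
      ultimately have "L \<in> ?C" by (rule closed_mem)
      then show ?thesis by simp
    qed
    then have "\<bar>L (\<lambda>x. g (\<sigma> t x)) - L g\<bar> \<le> 0"
      by (rule field_le_epsilon)
    then show ?thesis by simp
  qed
  with L show ?thesis unfolding invariant_means_def by blast
qed

end

context compact_flow
begin

lemma closed_invariant_means: "closed invariant_means"
  unfolding invariant_means_def mean_def
  by (intro closed_Collect_conj closed_Collect_all closed_Collect_imp open_Collect_const
        closed_Collect_eq closed_Collect_le continuous_intros continuous_eval)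

text \<open>Extreme points of the compact convex set of invariant means exist: in a minimal closed
  face every evaluation is constant, because its maximisers form a closed subface.\<close>

definition closed_face :: "(('w \<Rightarrow> real) \<Rightarrow> real) set \<Rightarrow> bool" where
  "closed_face C \<longleftrightarrow> C \<subseteq> invariant_means \<and> closed C \<and> C \<noteq> {} \<and>
     (\<forall>L1\<in>invariant_means. \<forall>L2\<in>invariant_means. \<forall>t. 0 < t \<and> t < 1 \<and>
        (\<lambda>g. t * L1 g + (1 - t) * L2 g) \<in> C \<longrightarrow> L1 \<in> C \<and> L2 \<in> C)"

lemma closed_faceI:
  assumes "C \<subseteq> invariant_means" "closed C" "C \<noteq> {}"
    "\<And>L1 L2 t. L1 \<in> invariant_means \<Longrightarrow> L2 \<in> invariant_means \<Longrightarrow> 0 < t \<Longrightarrow> t < 1 \<Longrightarrow>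
      (\<lambda>g. t * L1 g + (1 - t) * L2 g) \<in> C \<Longrightarrow> L1 \<in> C \<and> L2 \<in> C"
  shows "closed_face C"
  unfolding closed_face_def using assms by blast

lemma closed_faceD:
  assumes "closed_face C"
  shows "C \<subseteq> invariant_means" "closed C" "C \<noteq> {}"
    "\<And>L1 L2 t. L1 \<in> invariant_means \<Longrightarrow> L2 \<in> invariant_means \<Longrightarrow> 0 < t \<Longrightarrow> t < 1 \<Longrightarrow>
      (\<lambda>g. t * L1 g + (1 - t) * L2 g) \<in> C \<Longrightarrow> L1 \<in> C \<and> L2 \<in> C"
  using assms unfolding closed_face_def by blast+

lemma closed_face_Inter:
  assumes ne: "F \<noteq> {}" and face: "\<And>C. C \<in> F \<Longrightarrow> closed_face C"
    and chain: "\<And>C D. C \<in> F \<Longrightarrow> D \<in> F \<Longrightarrow> C \<subseteq> D \<or> D \<subseteq> C"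
  shows "closed_face (\<Inter>F)"
proof (rule closed_faceI)
  show "\<Inter>F \<subseteq> invariant_means" using ne closed_faceD(1)[OF face] by blast
  show "closed (\<Inter>F)" using closed_faceD(2)[OF face] by (intro closed_Inter) blast
  have "invariant_means \<inter> \<Inter>F \<noteq> {}"
  proof (rule compact_imp_fip[OF compact_invariant_means])
    show "closed T" if "T \<in> F" for T using closed_faceD(2)[OF face[OF that]] .
    fix F' assume "finite F'" "F' \<subseteq> F"
    then have "F' = {} \<or> \<Inter>F' \<in> F"
    proof (induction F' rule: finite_induct)
      case (insert C F')
      then have C: "C \<in> F" by blast
      show ?case
      proof (cases "F' = {}")
        case False
        then have D: "\<Inter>F' \<in> F" using insert by blast
        have "\<Inter>(insert C F') = C \<or> \<Inter>(insert C F') = \<Inter>F'"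
          using chain[OF C D] by auto
        then show ?thesis using C D by metis
      qed (use C in simp)
    qed simp
    then show "invariant_means \<inter> \<Inter>F' \<noteq> {}"
    proof
      assume "\<Inter>F' \<in> F"
      from closed_faceD(1,3)[OF face[OF this]] show ?thesis by blast
    qed (use invariant_means_nonempty in simp)
  qed
  then show "\<Inter>F \<noteq> {}" by blast
  fix L1 L2 and t :: real
  assume "L1 \<in> invariant_means" "L2 \<in> invariant_means" "0 < t" "t < 1"
    and *: "(\<lambda>g. t * L1 g + (1 - t) * L2 g) \<in> \<Inter>F"
  then have "L1 \<in> C \<and> L2 \<in> C" if "C \<in> F" for C
    using closed_faceD(4)[OF face[OF that], of L1 L2 t] that by blast
  then show "L1 \<in> \<Inter>F \<and> L2 \<in> \<Inter>F" by blast
qed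

lemma extreme_invariant_mean:
  obtains L where "L \<in> invariant_means"
    "\<And>L1 L2 t. L1 \<in> invariant_means \<Longrightarrow> L2 \<in> invariant_means \<Longrightarrow> 0 < t \<Longrightarrow> t < 1 \<Longrightarrow>
      L = (\<lambda>g. t * L1 g + (1 - t) * L2 g) \<Longrightarrow> L1 = L"
proof -
  let ?A = "uminus ` Collect closed_face"
  have "closed_face invariant_means"
    using closed_invariant_means invariant_means_nonempty by (intro closed_faceI) auto
  then have "?A \<noteq> {}" by blast
  moreover have "\<Union>CC \<in> ?A" if "CC \<noteq> {}" "subset.chain ?A CC" for CC
  proof -
    have "closed_face (\<Inter>(uminus ` CC))"
    proof (rule closed_face_Inter)
      show "uminus ` CC \<noteq> {}" using that by blast
      show "closed_face C" if "C \<in> uminus ` CC" for C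
        using that \<open>subset.chain ?A CC\<close> by (auto simp: subset_chain_def)
      show "C \<subseteq> D \<or> D \<subseteq> C" if "C \<in> uminus ` CC" "D \<in> uminus ` CC" for C D
        using that \<open>subset.chain ?A CC\<close> unfolding subset_chain_def by blast
    qed
    moreover have "\<Union>CC = - \<Inter>(uminus ` CC)" by auto
    ultimately show ?thesis by blast
  qed
  ultimately have "\<exists>D\<in>?A. \<forall>X\<in>?A. D \<subseteq> X \<longrightarrow> X = D"
    by (rule subset_Zorn_nonempty)
  then obtain D where D: "D \<in> ?A" "\<forall>X\<in>?A. D \<subseteq> X \<longrightarrow> X = D" ..
  then obtain C where C: "closed_face C" "D = - C" by blast
  have min: "X = C" if "closed_face X" "X \<subseteq> C" for X
  proof -
    have "- X = D" using that C D(2) by blast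
    then show ?thesis using C by auto
  qed
  note Cf = closed_faceD[OF C(1)]
  have cC: "compact C"
    using compact_Int_closed[OF compact_invariant_means Cf(2)] Cf(1) by (simp add: Int_absorb1)
  have const: "M g = N g" if MN: "M \<in> C" "N \<in> C" for M N g
  proof -
    obtain L0 where L0: "L0 \<in> C" "\<And>L. L \<in> C \<Longrightarrow> L g \<le> L0 g"
      using continuous_attains_sup[OF cC Cf(3), of "\<lambda>L. L g"] continuous_eval by blast
    have "closed_face (C \<inter> {L. L0 g \<le> L g})"
    proof (rule closed_faceI)
      show "closed (C \<inter> {L. L0 g \<le> L g})"
        by (intro closed_Int Cf closed_Collect_le continuous_intros continuous_eval)
      show "C \<inter> {L. L0 g \<le> L g} \<noteq> {}" using L0 by blast
      fix L1 L2 and t :: real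
      assume *: "L1 \<in> invariant_means" "L2 \<in> invariant_means" "0 < t" "t < 1"
        and "(\<lambda>g. t * L1 g + (1 - t) * L2 g) \<in> C \<inter> {L. L0 g \<le> L g}"
      then have **: "(\<lambda>g. t * L1 g + (1 - t) * L2 g) \<in> C" "L0 g \<le> t * L1 g + (1 - t) * L2 g" by auto
      have in_C: "L1 \<in> C" "L2 \<in> C" using Cf(4)[OF * **(1)] by auto
      have le: "t * L1 g \<le> t * L0 g" "(1 - t) * L2 g \<le> (1 - t) * L0 g"
        using L0(2)[OF in_C(1)] L0(2)[OF in_C(2)] * by (auto intro!: mult_left_mono)
      have "t * L0 g \<le> t * L1 g" "(1 - t) * L0 g \<le> (1 - t) * L2 g"
        using le **(2) by (auto simp: algebra_simps)
      then show "L1 \<in> C \<inter> {L. L0 g \<le> L g} \<and> L2 \<in> C \<inter> {L. L0 g \<le> L g}"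
        using in_C * by simp
    qed (use Cf in blast)
    then have "C \<inter> {L. L0 g \<le> L g} = C" by (rule min) blast
    then have eq: "L g = L0 g" if "L \<in> C" for L
      using that L0(2)[OF that] by (metis (mono_tags, lifting) IntD2 antisym mem_Collect_eq)
    show ?thesis using eq[OF MN(1)] eq[OF MN(2)] by simp
  qed
  obtain L where L: "L \<in> C" using Cf(3) by blast
  show ?thesis
  proof (rule that)
    show "L \<in> invariant_means" using L Cf(1) by blast
    fix L1 L2 and t :: real
    assume *: "L1 \<in> invariant_means" "L2 \<in> invariant_means" "0 < t" "t < 1"
      and "L = (\<lambda>g. t * L1 g + (1 - t) * L2 g)"
    then have "L1 \<in> C" using Cf(4)[OF *] L by blast
    then show "L1 = L" using const L by blast
  qed
qed

lemma continuous_translate: "continuous_on UNIV g \<Longrightarrow> continuous_on UNIV (\<lambda>x. g (\<sigma> t x))"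
  by (rule continuous_on_compose2[of UNIV g]) (auto intro!: continuous_intros)

text \<open>The measure of an extreme invariant mean is ergodic: conditioning it on an invariant set
  and on its complement would write the mean as a nontrivial combination of invariant means.\<close>

theorem ergodic_measure_exists: "\<exists>m. ergodic_measure \<sigma> m"
proof -
  obtain L where inv: "L \<in> invariant_means" and ext: "\<And>L1 L2 t. L1 \<in> invariant_means \<Longrightarrow>
      L2 \<in> invariant_means \<Longrightarrow> 0 < t \<Longrightarrow> t < 1 \<Longrightarrow>
      L = (\<lambda>g. t * L1 g + (1 - t) * L2 g) \<Longrightarrow> L1 = L"
    by (rule extreme_invariant_mean) (rule that)
  have Linv: "L (\<lambda>x. g (\<sigma> t x)) = L g" if "continuous_on UNIV g" for t g
    using inv that by (auto simp: invariant_means_def)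
  have "mean L" using inv by (simp add: invariant_means_def)
  then interpret compact_mean L by (intro compact_mean.intro compact_base)
  interpret prob_space rep by (rule prob_rep)
  have meas: "\<sigma> t \<in> measurable rep rep" for t
  proof -
    have "\<sigma> t \<in> borel_measurable borel"
      by (intro borel_measurable_continuous_onI) (auto intro!: continuous_intros)
    then show ?thesis by (simp cong: measurable_cong_sets)
  qed
  have distr: "distr rep rep (\<sigma> t) = rep" for t
  proof (rule finite_measure_eqI_integral)
    show "finite_measure (distr rep rep (\<sigma> t))" by (rule finite_measure_distr[OF meas])
    fix g :: "'w \<Rightarrow> real" assume g: "continuous_on UNIV g"
    have "g \<in> borel_measurable rep"
      using borel_measurable_continuous_onI[OF g] by (simp cong: measurable_cong_sets)
    then have "integral\<^sup>L (distr rep rep (\<sigma> t)) g = integral\<^sup>L rep (\<lambda>x. g (\<sigma> t x))"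
      by (rule integral_distr[OF meas])
    also have "\<dots> = integral\<^sup>L rep g"
      by (simp only: integral_rep[OF g] integral_rep[OF continuous_translate[OF g]] Linv[OF g])
    finally show "integral\<^sup>L (distr rep rep (\<sigma> t)) g = integral\<^sup>L rep g" .
  qed (auto intro: finite_measure_axioms)
  have image: "\<sigma> t ` B = \<sigma> (- t) -` B" for t B
  proof safe
    fix x assume "\<sigma> (- t) x \<in> B"
    moreover have "x = \<sigma> t (\<sigma> (- t) x)" by (simp add: flow_add)
    ultimately show "x \<in> \<sigma> t ` B" by blast
  qed (simp add: flow_add)
  have inv_emeasure: "emeasure rep (\<sigma> t ` B) = emeasure rep B" if "B \<in> sets rep" for t B
  proof -
    have "emeasure (distr rep rep (\<sigma> (- t))) B = emeasure rep (\<sigma> (- t) -` B)"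
      using that by (subst emeasure_distr[OF meas]) auto
    then show ?thesis by (simp add: distr image)
  qed
  have erg: "emeasure rep B = 0 \<or> emeasure rep B = 1"
    if B: "B \<in> sets rep" and Binv: "flow_invariant \<sigma> B" for B
  proof (rule ccontr)
    assume contra: "\<not> (emeasure rep B = 0 \<or> emeasure rep B = 1)"
    define p where "p = measure rep B"
    have p: "0 < p" "p < 1"
    proof -
      have "p \<noteq> 0" "p \<noteq> 1" using contra by (auto simp: p_def emeasure_eq_measure)
      moreover have "0 \<le> p" "p \<le> 1" by (auto simp: p_def)
      ultimately show "0 < p" "p < 1" by auto
    qed
    have ig: "integrable rep (\<lambda>x. indicator S x * g x :: real)"
      if "S \<in> sets rep" "continuous_on UNIV g" for S g
      using integrable_real_mult_indicator[OF that(1) integrable_rep[OF that(2)]] by (simp add: mult.commute)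
    \<comment> \<open>the mean conditioned on \<open>S\<close>, for \<open>q\<close> the measure of \<open>S\<close>\<close>
    define K where "K S q g = (if continuous_on UNIV g then integral\<^sup>L rep (\<lambda>x. indicator S x * g x) / q else 0)"
      for S and q :: real and g
    have K: "K S q \<in> invariant_means"
      if S: "S \<in> sets rep" "flow_invariant \<sigma> S" and q: "q = measure rep S" "q > 0" for S q
      unfolding invariant_means_def mean_def mem_Collect_eq
    proof (intro conjI allI impI)
      fix g h :: "'w \<Rightarrow> real" assume "continuous_on UNIV g \<and> continuous_on UNIV h"
      then have c: "continuous_on UNIV g" "continuous_on UNIV h" by auto
      have "integral\<^sup>L rep (\<lambda>x. indicator S x * (g x + h x))
          = integral\<^sup>L rep (\<lambda>x. indicator S x * g x) + integral\<^sup>L rep (\<lambda>x. indicator S x * h x)"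
        using ig[OF S(1) c(1)] ig[OF S(1) c(2)] by (simp add: distrib_left)
      then show "K S q (\<lambda>x. g x + h x) = K S q g + K S q h"
        using c by (simp add: K_def continuous_on_add add_divide_distrib)
    next
      fix k and g :: "'w \<Rightarrow> real" assume c: "continuous_on UNIV g"
      have "integral\<^sup>L rep (\<lambda>x. indicator S x * (k * g x)) = k * integral\<^sup>L rep (\<lambda>x. indicator S x * g x)"
        by (subst integral_mult_right_zero[symmetric]) (simp add: ac_simps)
      then show "K S q (\<lambda>x. k * g x) = k * K S q g"
        using c by (simp add: K_def continuous_on_mult_left)
    next
      fix g :: "'w \<Rightarrow> real" assume c: "continuous_on UNIV g \<and> (\<forall>x. 0 \<le> g x)"
      have "0 \<le> integral\<^sup>L rep (\<lambda>x. indicator S x * g x)"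
        using c by (intro integral_nonneg_AE) auto
      then show "0 \<le> K S q g" using q by (simp add: K_def)
    next
      show "K S q (\<lambda>_. 1) = 1" using q S by (simp add: K_def)
    next
      fix t and g :: "'w \<Rightarrow> real" assume c: "continuous_on UNIV g"
      have ind: "indicator S (\<sigma> t x) = (indicator S x :: real)" for x
      proof -
        have "\<sigma> t -` S = S" using image[of "- t" S] S(2) by (simp add: flow_invariant_def)
        then show ?thesis by (auto simp: indicator_def)
      qed
      have "(\<lambda>x. indicator S x * g x) \<in> borel_measurable rep"
        using ig[OF S(1) c] by (rule borel_measurable_integrable)
      then have "integral\<^sup>L (distr rep rep (\<sigma> t)) (\<lambda>x. indicator S x * g x)
          = integral\<^sup>L rep (\<lambda>x. indicator S (\<sigma> t x) * g (\<sigma> t x))"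
        by (rule integral_distr[OF meas])
      then show "K S q (\<lambda>x. g (\<sigma> t x)) = K S q g"
        using c continuous_translate[OF c] by (simp add: K_def distr ind)
    qed (simp add: K_def)
    have cB: "- B \<in> sets rep" "flow_invariant \<sigma> (- B)" "1 - p = measure rep (- B)"
    proof -
      show "- B \<in> sets rep" using B sets.compl_sets[OF B] by (simp add: Compl_eq_Diff_UNIV)
      show "flow_invariant \<sigma> (- B)"
        using Binv unfolding flow_invariant_def image by blast
      show "1 - p = measure rep (- B)"
        using prob_compl[OF B] by (simp add: p_def Compl_eq_Diff_UNIV)
    qed
    have "L = (\<lambda>g. p * K B p g + (1 - p) * K (- B) (1 - p) g)"
    proof
      fix g
      show "L g = p * K B p g + (1 - p) * K (- B) (1 - p) g"
      proof (cases "continuous_on UNIV g")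
        case True
        have "L g = integral\<^sup>L rep (\<lambda>x. indicator B x * g x + indicator (- B) x * g x)"
          unfolding integral_rep[OF True, symmetric]
          by (intro Bochner_Integration.integral_cong) (auto simp: indicator_def)
        also have "\<dots> = integral\<^sup>L rep (\<lambda>x. indicator B x * g x) + integral\<^sup>L rep (\<lambda>x. indicator (- B) x * g x)"
          by (intro Bochner_Integration.integral_add ig True B cB)
        finally show ?thesis using True p by (simp add: K_def)
      next
        case False
        then show ?thesis using \<open>mean L\<close> by (simp add: K_def mean_def)
      qed
    qed
    then have KL: "K B p = L"
      using p cB by (intro ext[OF K[OF B Binv p_def p(1)] K[OF cB]]) auto
    \<comment> \<open>restricting the measure to \<open>B\<close> merely rescales it, although it removes all mass from \<open>- B\<close>\<close>
    have "density rep (indicator B) = density rep (\<lambda>_. ennreal p)"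
    proof (rule finite_measure_eqI_integral)
      show "finite_measure (density rep (indicator B))"
        using B by (intro finite_measureI) (simp add: emeasure_density emeasure_eq_measure)
      show "finite_measure (density rep (\<lambda>_. ennreal p))"
        by (intro finite_measureI) (simp add: emeasure_density_const emeasure_eq_measure ennreal_mult_eq_top_iff)
      fix g :: "'w \<Rightarrow> real" assume g: "continuous_on UNIV g"
      have "g \<in> borel_measurable rep"
        using integrable_rep[OF g] by (rule borel_measurable_integrable)
      then have "integral\<^sup>L (density rep (\<lambda>x. ennreal (indicator B x))) g = integral\<^sup>L rep (\<lambda>x. indicator B x *\<^sub>R g x)"
        using B by (intro integral_density) auto
      also have "\<dots> = p * K B p g" using g p by (simp add: K_def)
      also have "\<dots> = p * integral\<^sup>L rep g" by (simp add: KL integral_rep[OF g])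
      also have "\<dots> = integral\<^sup>L (density rep (\<lambda>_. ennreal p)) g"
        using p \<open>g \<in> borel_measurable rep\<close> by (subst integral_density) auto
      finally show "integral\<^sup>L (density rep (indicator B)) g = integral\<^sup>L (density rep (\<lambda>_. ennreal p)) g"
        by (simp add: ennreal_indicator)
    qed auto
    then have "emeasure (density rep (indicator B)) (- B) = emeasure (density rep (\<lambda>_. ennreal p)) (- B)"
      by simp
    moreover have "emeasure (density rep (indicator B)) (- B) = 0"
      using B cB(1) by (simp add: emeasure_density flip: indicator_inter_arith)
    moreover have "emeasure (density rep (\<lambda>_. ennreal p)) (- B) = ennreal p * ennreal (1 - p)"
      unfolding cB(3) emeasure_eq_measure[symmetric] by (rule emeasure_density_const[OF cB(1)])
    ultimately have "0 = ennreal p * ennreal (1 - p)" by simp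
    then show False using p by (simp add: ennreal_mult'[symmetric])
  qed
  have "ergodic_measure \<sigma> rep"
    unfolding ergodic_measure_def using inv_emeasure erg prob_rep by simp
  then show ?thesis by blast
qed

end

section \<open>Growth along recurrent orbits\<close>

lemma deriv_ge_imp_diff_ge:
  fixes \<phi> :: "real \<Rightarrow> real"
  assumes "a \<le> b"
    and "\<And>t. a \<le> t \<Longrightarrow> t \<le> b \<Longrightarrow> (\<phi> has_real_derivative \<phi>' t) (at t)"
    and "\<And>t. a \<le> t \<Longrightarrow> t \<le> b \<Longrightarrow> m \<le> \<phi>' t"
  shows "m * (b - a) \<le> \<phi> b - \<phi> a"
proof -
  have "\<phi> a - m * a \<le> \<phi> b - m * b"
  proof (rule DERIV_nonneg_imp_nondecreasing[OF assms(1), of "\<lambda>t. \<phi> t - m * t"])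
    fix t assume t: "a \<le> t" "t \<le> b"
    have "((\<lambda>t. \<phi> t - m * t) has_real_derivative \<phi>' t - m) (at t)"
      using assms(2)[OF t] by (auto intro!: derivative_eq_intros)
    then show "\<exists>y. ((\<lambda>t. \<phi> t - m * t) has_real_derivative y) (at t) \<and> 0 \<le> y"
      using assms(3)[OF t] by auto
  qed
  then show ?thesis by (simp add: algebra_simps)
qed

locale minimal_compact_flow = compact_flow \<sigma>
  for \<sigma> :: "real \<Rightarrow> 'w::metric_space \<Rightarrow> 'w" +
  assumes minimal: "minimal_flow \<sigma>"
begin

lemma visit: 
  assumes "open V" "V \<noteq> {}" shows "\<exists>t. \<sigma> t w \<in> V"
proof -
  have "V \<inter> closure (range (\<lambda>t. \<sigma> t w)) \<noteq> {}"
    using minimal assms by (simp add: minimal_flow_def)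
  then have "V \<inter> range (\<lambda>t. \<sigma> t w) \<noteq> {}"
    using open_Int_closure_eq_empty[OF assms(1)] by blast
  then show ?thesis by auto
qed

text \<open>Every orbit meets \<open>V\<close>, so the preimages of \<open>V\<close> under the flow cover the base; a finite
  subcover bounds the waiting time, and shifting by that bound makes all times nonnegative.\<close>

lemma uniform_visit:
  assumes "open V" "V \<noteq> {}"
  obtains T where "T > 0" "\<And>w. \<exists>t. 0 \<le> t \<and> t \<le> T \<and> \<sigma> t w \<in> V"
proof -
  have op: "open (\<sigma> t -` V)" for t
    by (rule open_vimage[OF assms(1)]) (auto intro!: continuous_intros)
  have cov: "UNIV \<subseteq> (\<Union>t\<in>UNIV. \<sigma> t -` V)"
    using visit[OF assms] by blast
  obtain J where J: "finite J" "UNIV \<subseteq> (\<Union>t\<in>J. \<sigma> t -` V)"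
    by (rule compactE_image[OF compact_base _ cov]) (use op in auto)
  define M where "M = (\<Sum>t\<in>J. \<bar>t\<bar>) + 1"
  have M: "\<bar>t\<bar> \<le> M" if "t \<in> J" for t
    using member_le_sum[OF that, of abs] J by (simp add: M_def)
  have "0 < M" unfolding M_def by (intro add_nonneg_pos sum_nonneg) auto
  have "\<exists>t. 0 \<le> t \<and> t \<le> 2 * M \<and> \<sigma> t w \<in> V" for w
  proof -
    obtain t where t: "t \<in> J" "\<sigma> t (\<sigma> M w) \<in> V" using J by blast
    then show ?thesis using M[OF t(1)] by (intro exI[of _ "t + M"]) (auto simp: flow_add abs_le_iff)
  qed
  then show ?thesis using that[of "2 * M"] \<open>0 < M\<close> by auto
qed

text \<open>The uniform lower bound on growth along orbits provided by the next lemmas. It is applied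
  to the excess of an exponent over the logarithm of a solution and to minus the logarithm of a
  logarithmic distance.\<close>

definition growth_bound :: "'w set \<Rightarrow> real \<Rightarrow> real \<Rightarrow> real \<Rightarrow> bool" where
  "growth_bound U \<eta> \<gamma> C \<longleftrightarrow> (\<forall>w \<phi> \<phi>' a b. a \<le> b \<and>
     (\<forall>t\<in>{a..b}. (\<phi> has_real_derivative \<phi>' t) (at t) \<and> 0 \<le> \<phi>' t \<and> (\<sigma> t w \<in> U \<longrightarrow> \<eta> \<le> \<phi>' t)) \<longrightarrow>
     \<gamma> * (b - a) - C \<le> \<phi> b - \<phi> a)"

lemma growth_boundD:
  assumes "growth_bound U \<eta> \<gamma> C" "a \<le> b"
    and "\<And>t. a \<le> t \<Longrightarrow> t \<le> b \<Longrightarrow> (\<phi> has_real_derivative \<phi>' t) (at t)"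
    and "\<And>t. a \<le> t \<Longrightarrow> t \<le> b \<Longrightarrow> 0 \<le> \<phi>' t"
    and "\<And>t. a \<le> t \<Longrightarrow> t \<le> b \<Longrightarrow> \<sigma> t w \<in> U \<Longrightarrow> \<eta> \<le> \<phi>' t"
  shows "\<gamma> * (b - a) - C \<le> \<phi> b - \<phi> a"
proof -
  have "\<forall>t\<in>{a..b}. (\<phi> has_real_derivative \<phi>' t) (at t) \<and> 0 \<le> \<phi>' t \<and> (\<sigma> t w \<in> U \<longrightarrow> \<eta> \<le> \<phi>' t)"
    using assms(3-5) by simp
  then show ?thesis using assms(1,2) unfolding growth_bound_def by blast
qed

text \<open>Visits to the open set \<open>U\<close> have at least a fixed duration and recur within a bounded time, both
  uniformly over all orbits; so what \<open>\<phi>\<close> gains during them amounts to a linear rate.\<close>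

lemma linear_growth:
  assumes U: "open U" "u0 \<in> U" and \<eta>: "\<eta> > 0"
  shows "\<exists>\<gamma>>0. \<exists>C. growth_bound U \<eta> \<gamma> C"
proof -
  \<comment> \<open>after a visit to a smaller neighbourhood \<open>V\<close> of \<open>u0\<close> the orbit stays in \<open>U\<close> for the time \<open>\<tau>\<close>\<close>
  have op: "open {p. \<sigma> (fst p) (snd p) \<in> U}"
    using open_vimage[OF U(1), of "\<lambda>p. \<sigma> (fst p) (snd p)"]
    by (simp add: vimage_def continuous_flow_comp continuous_on_fst continuous_on_snd continuous_on_id)
  have in0: "(0, u0) \<in> {p. \<sigma> (fst p) (snd p) \<in> U}" using U by simp
  obtain P V where P: "open P" "0 \<in> P" and V: "open V" "u0 \<in> V"
    and PV: "P \<times> V \<subseteq> {p. \<sigma> (fst p) (snd p) \<in> U}"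
    using open_prod_elim[OF op in0] by (metis mem_Sigma_iff)
  obtain e where e: "e > 0" "ball 0 e \<subseteq> P" using P openE by blast
  define \<tau> where "\<tau> = e / 2"
  have \<tau>: "\<tau> > 0" using e by (simp add: \<tau>_def)
  have stay: "\<sigma> s w \<in> U" if "w \<in> V" "0 \<le> s" "s \<le> \<tau>" for s w
  proof -
    have "s \<in> P" using that e by (intro subsetD[OF e(2)]) (auto simp: \<tau>_def)
    then show ?thesis using PV that by auto
  qed
  obtain T where T: "T > 0" "\<And>w. \<exists>t. 0 \<le> t \<and> t \<le> T \<and> \<sigma> t w \<in> V"
    using uniform_visit[OF V(1)] V(2) by blast
  define S where "S = T + \<tau>"
  have S: "S > 0" using T \<tau> by (simp add: S_def)
  have "growth_bound U \<eta> (\<eta> * \<tau> / S) (\<eta> * \<tau>)"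
    unfolding growth_bound_def
  proof (intro allI impI, elim conjE)
    fix w \<phi> \<phi>' and a b :: real
    assume ab: "a \<le> b"
      and all: "\<forall>t\<in>{a..b}. (\<phi> has_real_derivative \<phi>' t) (at t) \<and> 0 \<le> \<phi>' t \<and> (\<sigma> t w \<in> U \<longrightarrow> \<eta> \<le> \<phi>' t)"
    have der: "(\<phi> has_real_derivative \<phi>' t) (at t)" and nonneg: "0 \<le> \<phi>' t"
      and pos: "\<sigma> t w \<in> U \<Longrightarrow> \<eta> \<le> \<phi>' t" if "a \<le> t" "t \<le> b" for t
      using all that by auto
    have mono: "\<phi> c \<le> \<phi> d" if "a \<le> c" "c \<le> d" "d \<le> b" for c d
      using deriv_ge_imp_diff_ge[of c d \<phi> \<phi>' 0] that der nonneg by simp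
    have step: "\<eta> * \<tau> \<le> \<phi> (c + S) - \<phi> c" if c: "a \<le> c" "c + S \<le> b" for c
    proof -
      obtain t where t: "0 \<le> t" "t \<le> T" "\<sigma> t (\<sigma> c w) \<in> V" using T by blast
      have "\<eta> * ((c + t + \<tau>) - (c + t)) \<le> \<phi> (c + t + \<tau>) - \<phi> (c + t)"
      proof (rule deriv_ge_imp_diff_ge)
        fix s assume s: "c + t \<le> s" "s \<le> c + t + \<tau>"
        have "\<sigma> (s - (c + t)) (\<sigma> t (\<sigma> c w)) \<in> U"
          using s t by (intro stay) auto
        then have "\<sigma> s w \<in> U" by (simp add: flow_add add.commute)
        then show "\<eta> \<le> \<phi>' s" using s t c by (intro pos) (auto simp: S_def)
        show "(\<phi> has_real_derivative \<phi>' s) (at s)" using s t c by (intro der) (auto simp: S_def)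
      qed (use \<tau> in simp)
      moreover have "\<phi> c \<le> \<phi> (c + t)" "\<phi> (c + t + \<tau>) \<le> \<phi> (c + S)"
        using t c \<tau> by (auto intro!: mono simp: S_def)
      ultimately show ?thesis by simp
    qed
    have steps: "real n * (\<eta> * \<tau>) \<le> \<phi> (a + real n * S) - \<phi> a" if "a + real n * S \<le> b" for n
      using that
    proof (induction n)
      case (Suc n)
      have eq: "a + real (Suc n) * S = (a + real n * S) + S" by (simp add: algebra_simps)
      have "real n * (\<eta> * \<tau>) \<le> \<phi> (a + real n * S) - \<phi> a"
        using Suc S by (intro Suc.IH) (simp add: algebra_simps)
      moreover have "\<eta> * \<tau> \<le> \<phi> ((a + real n * S) + S) - \<phi> (a + real n * S)"
        using Suc.prems S unfolding eq by (intro step) auto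
      ultimately show ?case unfolding eq by (simp add: algebra_simps)
    qed simp
    define n where "n = nat \<lfloor>(b - a) / S\<rfloor>"
    have "0 \<le> (b - a) / S" using ab S by simp
    then have n: "real n \<le> (b - a) / S" "(b - a) / S - 1 \<le> real n"
      unfolding n_def by linarith+
    have *: "a + real n * S \<le> b" using n(1) S by (simp add: field_simps)
    have "((b - a) / S - 1) * (\<eta> * \<tau>) \<le> real n * (\<eta> * \<tau>)"
      using n \<eta> \<tau> by (intro mult_right_mono) auto
    also have "\<dots> \<le> \<phi> (a + real n * S) - \<phi> a" by (rule steps[OF *])
    also have "\<dots> \<le> \<phi> b - \<phi> a" using * S by (simp add: mono)
    finally show "\<eta> * \<tau> / S * (b - a) - \<eta> * \<tau> \<le> \<phi> b - \<phi> a"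
      by (simp add: algebra_simps)
  qed
  moreover have "0 < \<eta> * \<tau> / S" using \<eta> \<tau> S by simp
  ultimately show ?thesis by blast
qed

end

text \<open>Gronwall's inequality in quadratic form: it avoids dividing by \<open>L\<close> and the kinks of the
  absolute value, at the price of the constant \<open>2 * L + 1\<close>.\<close>

lemma gronwall_forward:
  fixes w :: "real \<Rightarrow> real"
  assumes t: "0 \<le> t" and L: "0 \<le> L"
    and der: "\<And>s. 0 \<le> s \<Longrightarrow> s \<le> t \<Longrightarrow> (w has_real_derivative w' s) (at s)"
    and bound: "\<And>s. 0 \<le> s \<Longrightarrow> s \<le> t \<Longrightarrow> \<bar>w' s\<bar> \<le> L * \<bar>w s\<bar> + e"
  shows "(w t)\<^sup>2 \<le> ((w 0)\<^sup>2 + e\<^sup>2) * exp ((2 * L + 1) * t)"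
proof -
  let ?M = "2 * L + 1"
  let ?\<phi> = "\<lambda>s. - (((w s)\<^sup>2 + e\<^sup>2) * exp (- ?M * s))"
  have "0 * (t - 0) \<le> ?\<phi> t - ?\<phi> 0"
  proof (rule deriv_ge_imp_diff_ge[OF t])
    fix s assume s: "0 \<le> s" "s \<le> t"
    show "(?\<phi> has_real_derivative - ((2 * w s * w' s) * exp (- ?M * s) + ((w s)\<^sup>2 + e\<^sup>2) * (- ?M * exp (- ?M * s)))) (at s)"
      by (rule derivative_eq_intros der[OF s] refl | simp)+
    have "2 * w s * w' s \<le> 2 * \<bar>w s\<bar> * \<bar>w' s\<bar>"
      using abs_ge_self[of "w s * w' s"] by (simp add: abs_mult)
    also have "\<dots> \<le> 2 * \<bar>w s\<bar> * (L * \<bar>w s\<bar> + e)"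
      using bound[OF s] by (intro mult_left_mono) auto
    also have "\<dots> = 2 * L * (w s)\<^sup>2 + 2 * \<bar>w s\<bar> * e"
      by (simp add: algebra_simps power2_eq_square)
    also have "2 * \<bar>w s\<bar> * e \<le> (w s)\<^sup>2 + e\<^sup>2"
      using sum_squares_bound[of "\<bar>w s\<bar>" e] by simp
    also have "2 * L * (w s)\<^sup>2 + ((w s)\<^sup>2 + e\<^sup>2) \<le> ?M * ((w s)\<^sup>2 + e\<^sup>2)"
      using L by (simp add: algebra_simps)
    finally have "2 * w s * w' s \<le> ?M * ((w s)\<^sup>2 + e\<^sup>2)" by simp
    then have "0 \<le> (?M * ((w s)\<^sup>2 + e\<^sup>2) - 2 * w s * w' s) * exp (- ?M * s)"
      by (intro mult_nonneg_nonneg) auto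
    then show "0 \<le> - ((2 * w s * w' s) * exp (- ?M * s) + ((w s)\<^sup>2 + e\<^sup>2) * (- ?M * exp (- ?M * s)))"
      by (simp add: algebra_simps)
  qed
  moreover have e1: "exp (- ?M * t) * exp (?M * t) = 1"
    unfolding mult_exp_exp by (simp add: algebra_simps)
  ultimately have "((w t)\<^sup>2 + e\<^sup>2) * exp (- ?M * t) \<le> (w 0)\<^sup>2 + e\<^sup>2" by simp
  then have "((w t)\<^sup>2 + e\<^sup>2) * exp (- ?M * t) * exp (?M * t) \<le> ((w 0)\<^sup>2 + e\<^sup>2) * exp (?M * t)"
    by (intro mult_right_mono) auto
  then have "(w t)\<^sup>2 + e\<^sup>2 \<le> ((w 0)\<^sup>2 + e\<^sup>2) * exp (?M * t)"
    using e1 by (simp only: mult.assoc mult_1_right)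
  then show ?thesis using zero_le_power2[of e] by linarith
qed

lemma gronwall:
  fixes w :: "real \<Rightarrow> real"
  assumes L: "0 \<le> L"
    and der: "\<And>s. s \<in> closed_segment 0 t \<Longrightarrow> (w has_real_derivative w' s) (at s)"
    and bound: "\<And>s. s \<in> closed_segment 0 t \<Longrightarrow> \<bar>w' s\<bar> \<le> L * \<bar>w s\<bar> + e"
  shows "(w t)\<^sup>2 \<le> ((w 0)\<^sup>2 + e\<^sup>2) * exp ((2 * L + 1) * \<bar>t\<bar>)"
proof (cases "0 \<le> t")
  case True
  then show ?thesis
    using gronwall_forward[OF True L, of w w' e] der bound by (simp add: closed_segment_eq_real_ivl)
next
  case False
  have "(w (- (- t)))\<^sup>2 \<le> ((w (- 0))\<^sup>2 + e\<^sup>2) * exp ((2 * L + 1) * (- t))"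
  proof (rule gronwall_forward[OF _ L, of "- t" "\<lambda>s. w (- s)" "\<lambda>s. - w' (- s)" e])
    fix s assume "0 \<le> s" "s \<le> - t"
    then have s: "- s \<in> closed_segment 0 t" using False by (simp add: closed_segment_eq_real_ivl)
    show "((\<lambda>s. w (- s)) has_real_derivative - w' (- s)) (at s)"
      using der[OF s] by (simp add: DERIV_mirror)
    show "\<bar>- w' (- s)\<bar> \<le> L * \<bar>w (- s)\<bar> + e" using bound[OF s] by simp
  qed (use False in simp)
  then show ?thesis using False by simp
qed

section \<open>Solutions of the family of equations\<close>

locale ode_family = minimal_compact_flow \<sigma>
  for \<sigma> :: "real \<Rightarrow> 'w::metric_space \<Rightarrow> 'w" +
  fixes f fx :: "'w \<Rightarrow> real \<Rightarrow> real"
  assumes cont_f: "continuous_on UNIV (\<lambda>(w, x). f w x)"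
    and cont_fx: "continuous_on UNIV (\<lambda>(w, x). fx w x)"
    and deriv_f: "(f w has_real_derivative fx w x) (at x)"
    and f_zero [simp]: "f w 0 = 0"
begin

lemma continuous_f_comp [continuous_intros]:
  "continuous_on S a \<Longrightarrow> continuous_on S b \<Longrightarrow> continuous_on S (\<lambda>x. f (a x) (b x))"
  using continuous_on_compose2[OF cont_f continuous_on_Pair[of S a b]] by simp

lemma continuous_fx_comp [continuous_intros]:
  "continuous_on S a \<Longrightarrow> continuous_on S b \<Longrightarrow> continuous_on S (\<lambda>x. fx (a x) (b x))"
  using continuous_on_compose2[OF cont_fx continuous_on_Pair[of S a b]] by simp

text \<open>The derivatives are two-sided also at the end points of \<open>S\<close>.\<close>

definition is_sol :: "real \<Rightarrow> 'w \<Rightarrow> (real \<Rightarrow> real) \<Rightarrow> real set \<Rightarrow> bool" where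
  "is_sol l w u S \<longleftrightarrow> (\<forall>t\<in>S. (u has_real_derivative f (\<sigma> t w) (u t) + l * u t) (at t))"

lemma is_solD: "is_sol l w u S \<Longrightarrow> t \<in> S \<Longrightarrow> (u has_real_derivative f (\<sigma> t w) (u t) + l * u t) (at t)"
  by (simp add: is_sol_def)

lemma is_sol_subset: "is_sol l w u S \<Longrightarrow> T \<subseteq> S \<Longrightarrow> is_sol l w u T"
  by (auto simp: is_sol_def)

lemma is_sol_continuous: "is_sol l w u S \<Longrightarrow> continuous_on S u"
  by (meson DERIV_isCont continuous_at_imp_continuous_on is_solD)

lemma is_sol_shift:
  assumes "is_sol l w u ((\<lambda>t. t + s) ` S)"
  shows "is_sol l (\<sigma> s w) (\<lambda>t. u (t + s)) S"
  unfolding is_sol_def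
proof
  fix t assume "t \<in> S"
  then have "(u has_real_derivative f (\<sigma> (t + s) w) (u (t + s)) + l * u (t + s)) (at (t + s))"
    using assms by (auto intro: is_solD)
  then show "((\<lambda>t. u (t + s)) has_real_derivative f (\<sigma> t (\<sigma> s w)) (u (t + s)) + l * u (t + s)) (at t)"
    by (simp add: DERIV_shift flow_add)
qed

lemma is_sol_shift_UNIV: "is_sol l w u UNIV \<Longrightarrow> is_sol l (\<sigma> s w) (\<lambda>t. u (t + s)) UNIV"
  by (rule is_sol_shift) (auto intro: is_sol_subset)

lemma is_sol_zero: "is_sol l w (\<lambda>_. 0) S"
  by (simp add: is_sol_def)

lemma slope_bound:
  obtains L where "L \<ge> 0" "\<And>w x. \<bar>x\<bar> \<le> B \<Longrightarrow> \<bar>fx w x\<bar> \<le> L"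
proof -
  have "compact ((UNIV :: 'w set) \<times> {-B..B})" by (intro compact_Times compact_base) simp
  then have "compact ((\<lambda>(w, x). fx w x) ` (UNIV \<times> {-B..B}))"
    by (rule compact_continuous_image[rotated]) (rule continuous_on_subset[OF cont_fx], simp)
  then obtain L where L: "L > 0" "\<forall>y\<in>(\<lambda>(w, x). fx w x) ` (UNIV \<times> {-B..B}). norm y \<le> L"
    using compact_imp_bounded bounded_pos by blast
  show ?thesis
  proof (rule that)
    show "\<bar>fx w x\<bar> \<le> L" if "\<bar>x\<bar> \<le> B" for w x
      using L(2) that by (auto simp: abs_le_iff minus_le_iff)
  qed (use L in simp)
qed

lemma f_lipschitz:
  assumes L: "\<And>w x. \<bar>x\<bar> \<le> B \<Longrightarrow> \<bar>fx w x\<bar> \<le> L" and "\<bar>x\<bar> \<le> B" "\<bar>y\<bar> \<le> B"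
  shows "\<bar>f w x - f w y\<bar> \<le> L * \<bar>x - y\<bar>"
proof -
  have "norm (f w x - f w y) \<le> L * norm (x - y)"
    by (rule field_differentiable_bound[of "{-B..B}" "f w" "fx w"])
      (use assms in \<open>auto intro: has_field_derivative_at_within deriv_f simp: abs_le_iff minus_le_iff\<close>)
  then show ?thesis by simp
qed

text \<open>Continuous dependence on the base point, the parameter and the initial value.\<close>

lemma sol_gap:
  assumes u: "is_sol l w u (closed_segment 0 t)" and v: "is_sol l' w' v (closed_segment 0 t)"
    and B: "\<And>s. s \<in> closed_segment 0 t \<Longrightarrow> \<bar>u s\<bar> \<le> B" "\<And>s. s \<in> closed_segment 0 t \<Longrightarrow> \<bar>v s\<bar> \<le> B"
    and L: "L \<ge> 0" "\<And>w x. \<bar>x\<bar> \<le> B \<Longrightarrow> \<bar>fx w x\<bar> \<le> L"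
    and e: "\<And>s x. s \<in> closed_segment 0 t \<Longrightarrow> \<bar>x\<bar> \<le> B \<Longrightarrow> \<bar>f (\<sigma> s w) x - f (\<sigma> s w') x\<bar> \<le> e"
  shows "(u t - v t)\<^sup>2 \<le> ((u 0 - v 0)\<^sup>2 + (e + \<bar>l - l'\<bar> * B)\<^sup>2) * exp ((2 * (L + \<bar>l'\<bar>) + 1) * \<bar>t\<bar>)"
proof (rule gronwall[where w = "\<lambda>t. u t - v t" and
      w' = "\<lambda>s. (f (\<sigma> s w) (u s) + l * u s) - (f (\<sigma> s w') (v s) + l' * v s)"])
  show "0 \<le> L + \<bar>l'\<bar>" using L by simp
  fix s assume s: "s \<in> closed_segment 0 t"
  show "((\<lambda>t. u t - v t) has_real_derivative (f (\<sigma> s w) (u s) + l * u s) - (f (\<sigma> s w') (v s) + l' * v s)) (at s)"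
    by (intro DERIV_diff is_solD[OF u s] is_solD[OF v s])
  have tri: "\<bar>a + b + c + d\<bar> \<le> \<bar>a\<bar> + \<bar>b\<bar> + \<bar>c\<bar> + \<bar>d\<bar>" for a b c d :: real
    by linarith
  have eq: "(f (\<sigma> s w) (u s) + l * u s) - (f (\<sigma> s w') (v s) + l' * v s)
      = (f (\<sigma> s w) (u s) - f (\<sigma> s w') (u s)) + (f (\<sigma> s w') (u s) - f (\<sigma> s w') (v s))
        + (l - l') * u s + l' * (u s - v s)"
    by (simp add: algebra_simps)
  have "\<bar>(f (\<sigma> s w) (u s) + l * u s) - (f (\<sigma> s w') (v s) + l' * v s)\<bar> \<le> \<bar>f (\<sigma> s w) (u s) - f (\<sigma> s w') (u s)\<bar> + \<bar>f (\<sigma> s w') (u s) - f (\<sigma> s w') (v s)\<bar>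
        + \<bar>l - l'\<bar> * \<bar>u s\<bar> + \<bar>l'\<bar> * \<bar>u s - v s\<bar>"
    unfolding eq abs_mult[symmetric] by (rule tri)
  also have "\<dots> \<le> e + L * \<bar>u s - v s\<bar> + \<bar>l - l'\<bar> * B + \<bar>l'\<bar> * \<bar>u s - v s\<bar>"
  proof -
    have "\<bar>f (\<sigma> s w) (u s) - f (\<sigma> s w') (u s)\<bar> \<le> e" by (rule e[OF s B(1)[OF s]])
    moreover have "\<bar>f (\<sigma> s w') (u s) - f (\<sigma> s w') (v s)\<bar> \<le> L * \<bar>u s - v s\<bar>"
      by (rule f_lipschitz[OF L(2) B(1)[OF s] B(2)[OF s]])
    moreover have "\<bar>l - l'\<bar> * \<bar>u s\<bar> \<le> \<bar>l - l'\<bar> * B"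
      by (rule mult_left_mono[OF B(1)[OF s]]) simp
    ultimately show ?thesis by linarith
  qed
  also have "\<dots> = (L + \<bar>l'\<bar>) * \<bar>u s - v s\<bar> + (e + \<bar>l - l'\<bar> * B)"
    by (simp add: algebra_simps)
  finally show "\<bar>(f (\<sigma> s w) (u s) + l * u s) - (f (\<sigma> s w') (v s) + l' * v s)\<bar>
      \<le> (L + \<bar>l'\<bar>) * \<bar>u s - v s\<bar> + (e + \<bar>l - l'\<bar> * B)" .
qed

lemma sol_bounded:
  assumes "is_sol l w u (closed_segment 0 t)"
  obtains B where "\<And>s. s \<in> closed_segment 0 t \<Longrightarrow> \<bar>u s\<bar> \<le> B"
proof -
  have "compact (u ` closed_segment 0 t)"
    by (intro compact_continuous_image is_sol_continuous[OF assms]) simp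
  then obtain B where "\<forall>y\<in>u ` closed_segment 0 t. norm y \<le> B"
    using compact_imp_bounded bounded_iff by blast
  then show ?thesis using that[of B] by auto
qed

lemma sol_unique:
  assumes u: "is_sol l w u (closed_segment 0 t)" and v: "is_sol l w v (closed_segment 0 t)"
    and "u 0 = v 0"
  shows "u t = v t"
proof -
  obtain B1 where B1: "\<And>s. s \<in> closed_segment 0 t \<Longrightarrow> \<bar>u s\<bar> \<le> B1" using sol_bounded[OF u] by blast
  obtain B2 where B2: "\<And>s. s \<in> closed_segment 0 t \<Longrightarrow> \<bar>v s\<bar> \<le> B2" using sol_bounded[OF v] by blast
  define B where "B = max B1 B2"
  obtain L where L: "L \<ge> 0" "\<And>w x. \<bar>x\<bar> \<le> B \<Longrightarrow> \<bar>fx w x\<bar> \<le> L" using slope_bound[of B] by blast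
  have "(u t - v t)\<^sup>2 \<le> ((u 0 - v 0)\<^sup>2 + (0 + \<bar>l - l\<bar> * B)\<^sup>2) * exp ((2 * (L + \<bar>l\<bar>) + 1) * \<bar>t\<bar>)"
  proof (rule sol_gap[OF u v])
    show "\<bar>u s\<bar> \<le> B" "\<bar>v s\<bar> \<le> B" if "s \<in> closed_segment 0 t" for s
      using B1[OF that] B2[OF that] by (simp_all add: B_def)
  qed (use L in simp_all)
  then show ?thesis using assms(3) by simp
qed

lemma sol_unique_UNIV:
  assumes u: "is_sol l w u UNIV" and v: "is_sol l w v UNIV" and eq: "u s = v s"
  shows "u = v"
proof
  fix t
  have "is_sol l (\<sigma> s w) (\<lambda>t. u (t + s)) (closed_segment 0 (t - s))"
      "is_sol l (\<sigma> s w) (\<lambda>t. v (t + s)) (closed_segment 0 (t - s))"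
    using is_sol_subset[OF is_sol_shift_UNIV[OF u]] is_sol_subset[OF is_sol_shift_UNIV[OF v]] by auto
  from sol_unique[OF this] show "u t = v t" using eq by simp
qed

lemma sol_limit:
  assumes u: "\<And>n::nat. is_sol (l n) (w n) (u n) (closed_segment 0 t)"
    and v: "is_sol l0 w0 v (closed_segment 0 t)"
    and B: "\<And>n s. s \<in> closed_segment 0 t \<Longrightarrow> \<bar>u n s\<bar> \<le> B"
    and lim: "l \<longlonglongrightarrow> l0" "w \<longlonglongrightarrow> w0" "(\<lambda>n. u n 0) \<longlonglongrightarrow> v 0"
  shows "(\<lambda>n. u n t) \<longlonglongrightarrow> v t"
proof -
  obtain B' where B': "\<And>s. s \<in> closed_segment 0 t \<Longrightarrow> \<bar>v s\<bar> \<le> B'" using sol_bounded[OF v] by blast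
  define C where "C = max B B'"
  obtain L where L: "L \<ge> 0" "\<And>w x. \<bar>x\<bar> \<le> C \<Longrightarrow> \<bar>fx w x\<bar> \<le> L" using slope_bound[of C] by blast
  define K where "K = exp ((2 * (L + \<bar>l0\<bar>) + 1) * \<bar>t\<bar>)"
  have K: "K > 0" by (simp add: K_def)
  have cpt: "compact ((UNIV :: 'w set) \<times> closed_segment 0 t \<times> {-C..C})"
    by (intro compact_Times compact_base) auto
  have uc: "uniformly_continuous_on (UNIV \<times> closed_segment 0 t \<times> {-C..C})
      (\<lambda>p. f (\<sigma> (fst (snd p)) (fst p)) (snd (snd p)))"
    by (rule compact_uniformly_continuous[OF _ cpt]) (intro continuous_intros)
  show ?thesis
  proof (rule LIMSEQ_I)
    fix r :: real assume r: "r > 0"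
    \<comment> \<open>so that \<open>2 * K * e\<^sup>2 \<le> r\<^sup>2\<close>\<close>
    define e where "e = r / (2 * sqrt K)"
    have e: "e > 0" using r K by (simp add: e_def)
    obtain d where d: "d > 0" and dd: "\<And>p q. p \<in> UNIV \<times> closed_segment 0 t \<times> {-C..C} \<Longrightarrow>
        q \<in> UNIV \<times> closed_segment 0 t \<times> {-C..C} \<Longrightarrow> dist q p < d \<Longrightarrow>
        dist (f (\<sigma> (fst (snd q)) (fst q)) (snd (snd q))) (f (\<sigma> (fst (snd p)) (fst p)) (snd (snd p))) < e / 2"
      using uc e unfolding uniformly_continuous_on_def by (metis half_gt_zero)
    have "eventually (\<lambda>n. dist (w n) w0 < d) sequentially" using tendstoD[OF lim(2) d] .
    moreover have "(\<lambda>n. \<bar>l n - l0\<bar> * C) \<longlonglongrightarrow> \<bar>l0 - l0\<bar> * C"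
      by (intro tendsto_intros lim)
    then have "eventually (\<lambda>n. \<bar>l n - l0\<bar> * C < e / 2) sequentially"
      using e by (intro order_tendstoD(2)[where y = "\<bar>l0 - l0\<bar> * C"]) auto
    moreover have "eventually (\<lambda>n. dist (u n 0) (v 0) < e) sequentially" using tendstoD[OF lim(3) e] .
    ultimately have "eventually (\<lambda>n. norm (u n t - v t) < r) sequentially"
    proof eventually_elim
      case (elim n)
      have eb: "\<bar>f (\<sigma> s (w n)) x - f (\<sigma> s w0) x\<bar> \<le> e / 2" if "s \<in> closed_segment 0 t" "\<bar>x\<bar> \<le> C" for s x
        using dd[of "(w0, s, x)" "(w n, s, x)"] that elim(1)
        by (auto simp: dist_Pair_Pair dist_real_def abs_le_iff minus_le_iff)
      have "(u n t - v t)\<^sup>2 \<le> ((u n 0 - v 0)\<^sup>2 + (e / 2 + \<bar>l n - l0\<bar> * C)\<^sup>2) * K"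
        unfolding K_def
      proof (rule sol_gap[OF u v])
        show "\<bar>u n s\<bar> \<le> C" "\<bar>v s\<bar> \<le> C" if "s \<in> closed_segment 0 t" for s
          using B[OF that, of n] B'[OF that] by (simp_all add: C_def)
      qed (use L eb in simp_all)
      also have "\<dots> < (e\<^sup>2 + e\<^sup>2) * K"
      proof (intro mult_strict_right_mono add_strict_mono K)
        show "(u n 0 - v 0)\<^sup>2 < e\<^sup>2"
          using power_strict_mono[of "\<bar>u n 0 - v 0\<bar>" e 2] elim(3) by (simp add: dist_real_def)
        have "0 \<le> \<bar>v 0\<bar>" by simp
        also have "\<bar>v 0\<bar> \<le> C" using B'[of 0] by (simp add: C_def)
        finally have "0 \<le> C" .
        then show "(e / 2 + \<bar>l n - l0\<bar> * C)\<^sup>2 < e\<^sup>2"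
          using elim(2) e by (intro power_strict_mono) auto
      qed
      also have "\<dots> = 2 * K * e\<^sup>2" by simp
      also have "\<dots> \<le> r\<^sup>2"
        using K r by (simp add: e_def power_divide power_mult_distrib field_simps)
      finally have "\<bar>u n t - v t\<bar>\<^sup>2 < r\<^sup>2" by simp
      then show ?case using r by (simp add: power2_less_imp_less)
    qed
    then show "\<exists>no. \<forall>n\<ge>no. norm (u n t - v t) < r"
      by (simp add: eventually_sequentially)
  qed
qed

text \<open>Solutions cannot cross, because they agree everywhere if they agree once.\<close>

lemma sol_less:
  assumes u: "is_sol l w u (closed_segment 0 t)" and v: "is_sol l w v (closed_segment 0 t)"
    and less: "u 0 < v 0"
  shows "u t < v t"
proof (rule ccontr)
  assume "\<not> u t < v t"
  define d where "d s = v s - u s" for s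
  have conn: "connected (d ` closed_segment 0 t)"
    unfolding d_def by (intro connected_continuous_image continuous_intros is_sol_continuous[OF u]
      is_sol_continuous[OF v]) simp
  have "d 0 \<in> d ` closed_segment 0 t" "d t \<in> d ` closed_segment 0 t" by auto
  then have "0 \<in> d ` closed_segment 0 t"
    using conn \<open>\<not> u t < v t\<close> less connectedD_interval[of "d ` closed_segment 0 t" "d t" "d 0" 0]
    by (auto simp: d_def)
  then obtain s where s: "s \<in> closed_segment 0 t" "u s = v s" by (auto simp: d_def)
  have sub: "(\<lambda>t. t + s) ` closed_segment 0 (- s) \<subseteq> closed_segment 0 t"
    using s(1) by (auto simp: closed_segment_eq_real_ivl split: if_splits)
  have "u (- s + s) = v (- s + s)"
    by (rule sol_unique[of l "\<sigma> s w" "\<lambda>r. u (r + s)" "- s" "\<lambda>r. v (r + s)"])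
      (use s(2) in \<open>simp_all add: is_sol_shift is_sol_subset[OF u sub] is_sol_subset[OF v sub]\<close>)
  then show False using less by simp
qed

lemma sol_positive:
  assumes "is_sol l w u (closed_segment 0 t)" "0 < u 0"
  shows "0 < u t"
  using sol_less[OF is_sol_zero assms(1)] assms(2) by simp

subsection \<open>The maximal solution\<close>

abbreviation F :: "real \<Rightarrow> 'w \<Rightarrow> real \<Rightarrow> real" where "F l \<equiv> shifted f l"

lemma solves_on_iff:
  "solves_on \<sigma> (F l) w x I u \<longleftrightarrow> open I \<and> is_interval I \<and> 0 \<in> I \<and> u 0 = x \<and> is_sol l w u I"
  by (simp add: solves_on_def is_sol_def shifted_def)

lemma sol_eq:
  assumes "solves_on \<sigma> (F l) w x I u" "t \<in> I"
  shows "sol \<sigma> (F l) t w x = u t"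
  unfolding sol_def
proof (rule the_equality)
  show "\<exists>I v. solves_on \<sigma> (F l) w x I v \<and> t \<in> I \<and> v t = u t" using assms by blast
  fix y assume "\<exists>I v. solves_on \<sigma> (F l) w x I v \<and> t \<in> I \<and> v t = y"
  then obtain J v where J: "solves_on \<sigma> (F l) w x J v" "t \<in> J" "v t = y" by blast
  have seg: "closed_segment 0 t \<subseteq> K" if "is_interval K" "0 \<in> K" "t \<in> K" for K :: "real set"
    using that by (intro closed_segment_subset) (auto simp: is_interval_convex_1)
  have "u t = v t"
  proof (rule sol_unique[of l w u t v])
    show "is_sol l w u (closed_segment 0 t)" "is_sol l w v (closed_segment 0 t)"
      using assms J seg by (auto simp: solves_on_iff intro: is_sol_subset)
  qed (use assms J in \<open>auto simp: solves_on_iff\<close>)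
  then show "y = u t" using J by simp
qed

lemma sol_dom_iff: "t \<in> sol_dom \<sigma> (F l) w x \<longleftrightarrow> (\<exists>I u. solves_on \<sigma> (F l) w x I u \<and> t \<in> I)"
  by (auto simp: sol_dom_def)

lemma sol_is_sol: "is_sol l w (\<lambda>t. sol \<sigma> (F l) t w x) (sol_dom \<sigma> (F l) w x)"
  unfolding is_sol_def
proof
  fix t assume "t \<in> sol_dom \<sigma> (F l) w x"
  then obtain I u where I: "solves_on \<sigma> (F l) w x I u" "t \<in> I" by (auto simp: sol_dom_iff)
  then have "open I" by (simp add: solves_on_iff)
  have "(u has_real_derivative f (\<sigma> t w) (u t) + l * u t) (at t)"
    using I by (auto simp: solves_on_iff intro: is_solD)
  then have "((\<lambda>t. sol \<sigma> (F l) t w x) has_real_derivative f (\<sigma> t w) (u t) + l * u t) (at t)"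
    by (rule has_field_derivative_transform_within_open[OF _ \<open>open I\<close> I(2)]) (simp add: sol_eq[OF I(1)])
  then show "((\<lambda>t. sol \<sigma> (F l) t w x) has_real_derivative
      f (\<sigma> t w) (sol \<sigma> (F l) t w x) + l * sol \<sigma> (F l) t w x) (at t)"
    by (simp add: sol_eq[OF I])
qed

lemma sol_zero: "0 \<in> sol_dom \<sigma> (F l) w x \<Longrightarrow> sol \<sigma> (F l) 0 w x = x"
  using sol_eq by (auto simp: sol_dom_iff solves_on_iff)

lemma complete_sol:
  assumes "is_sol l w u UNIV" "u 0 = x"
  shows "sol_dom \<sigma> (F l) w x = UNIV" "sol \<sigma> (F l) t w x = u t"
proof -
  have "solves_on \<sigma> (F l) w x UNIV u" using assms by (simp add: solves_on_iff)
  then show "sol_dom \<sigma> (F l) w x = UNIV" "sol \<sigma> (F l) t w x = u t"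
    using sol_eq by (auto simp: sol_dom_def)
qed

lemma complete_solE:
  assumes "sol_dom \<sigma> (F l) w x = UNIV"
  obtains u where "is_sol l w u UNIV" "u 0 = x" "\<And>t. sol \<sigma> (F l) t w x = u t"
  using sol_is_sol[of l w x] sol_zero[of l w x] assms by auto

lemma skew_invariantE:
  assumes "skew_invariant \<sigma> (F l) K" "(w, x) \<in> K"
  obtains u where "is_sol l w u UNIV" "u 0 = x" "\<And>t. (\<sigma> t w, u t) \<in> K"
proof -
  have "sol_dom \<sigma> (F l) w x = UNIV" using assms by (auto simp: skew_invariant_def)
  then obtain u where u: "is_sol l w u UNIV" "u 0 = x" "\<And>t. sol \<sigma> (F l) t w x = u t"
    using complete_solE by blast
  have "(\<sigma> t w, u t) \<in> K" for t
  proof -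
    have "skew \<sigma> (F l) t (w, x) \<in> skew \<sigma> (F l) t ` K" using assms(2) by (rule imageI)
    then have "skew \<sigma> (F l) t (w, x) \<in> K" using assms(1) by (simp add: skew_invariant_def)
    then show ?thesis by (simp add: skew_def u)
  qed
  with u show ?thesis using that by blast
qed

lemma skew_invariantI:
  assumes "\<And>w x. (w, x) \<in> K \<Longrightarrow> \<exists>u. is_sol l w u UNIV \<and> u 0 = x \<and> (\<forall>t. (\<sigma> t w, u t) \<in> K)"
  shows "skew_invariant \<sigma> (F l) K"
  unfolding skew_invariant_def
proof (intro conjI allI)
  show "\<forall>(w, x)\<in>K. sol_dom \<sigma> (F l) w x = UNIV"
    using assms complete_sol(1) by blast
  fix t
  show "skew \<sigma> (F l) t ` K = K"
  proof safe
    fix w x assume "(w, x) \<in> K"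
    then obtain u where u: "is_sol l w u UNIV" "u 0 = x" "\<forall>t. (\<sigma> t w, u t) \<in> K" using assms by blast
    { fix w' x' assume "(w', x') = skew \<sigma> (F l) t (w, x)"
      then show "(w', x') \<in> K" using u complete_sol(2)[OF u(1,2)] by (simp add: skew_def) }
    have "(\<sigma> (- t) w, u (- t)) \<in> K" using u by blast
    moreover have "skew \<sigma> (F l) t (\<sigma> (- t) w, u (- t)) = (w, x)"
      using complete_sol(2)[OF is_sol_shift_UNIV[OF u(1), of "- t"], of "u (- t)" t] u(2)
      by (simp add: skew_def flow_add)
    ultimately show "(w, x) \<in> skew \<sigma> (F l) t ` K" by (metis image_eqI)
  qed
qed

end

section \<open>The global attractor\<close>

locale ode_attractor = ode_family \<sigma> f fx
  for \<sigma> :: "real \<Rightarrow> 'w::metric_space \<Rightarrow> 'w" and f fx :: "'w \<Rightarrow> real \<Rightarrow> real" +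
  fixes A :: "real \<Rightarrow> ('w \<times> real) set" and \<alpha> \<beta> :: "real \<Rightarrow> 'w \<Rightarrow> real"
  assumes attractor: "global_attractor \<sigma> (shifted f l) (A l)"
    and A_eq: "A l = (\<Union>w. {w} \<times> {\<alpha> l w .. \<beta> l w})"
begin

lemma in_A_iff: "(w, x) \<in> A l \<longleftrightarrow> \<alpha> l w \<le> x \<and> x \<le> \<beta> l w"
  by (simp add: A_eq)

lemma compact_A: "compact (A l)" and invariant_A: "skew_invariant \<sigma> (F l) (A l)"
  using attractor[of l] by (auto simp: global_attractor_def)

lemma A_bound: obtains B where "B > 0" "\<And>w x. (w, x) \<in> A l \<Longrightarrow> \<bar>x\<bar> \<le> B"
proof -
  have "bounded (snd ` A l)"
    by (intro compact_imp_bounded compact_continuous_image continuous_intros compact_A)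
  then obtain B where B: "B > 0" "\<forall>x\<in>snd ` A l. norm x \<le> B" using bounded_pos by blast
  have "\<bar>x\<bar> \<le> B" if "(w, x) \<in> A l" for w x
    using B(2) imageI[OF that, of snd] by auto
  then show ?thesis using that[OF B(1)] by blast
qed

lemma forward_dom: "{0..} \<subseteq> sol_dom \<sigma> (F l) w x"
proof -
  have "bounded {(w, x)}" by simp
  then have "\<forall>(w, x)\<in>{(w, x)}. {0..} \<subseteq> sol_dom \<sigma> (F l) w x"
    using attractor[of l] unfolding global_attractor_def by blast
  then show ?thesis by simp
qed

lemma forward_sol: "is_sol l w (\<lambda>t. sol \<sigma> (F l) t w x) {0..}" "sol \<sigma> (F l) 0 w x = x"
proof -
  show "is_sol l w (\<lambda>t. sol \<sigma> (F l) t w x) {0..}"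
    by (rule is_sol_subset[OF sol_is_sol forward_dom])
  show "sol \<sigma> (F l) 0 w x = x"
    by (rule sol_zero, rule subsetD[OF forward_dom]) simp
qed

lemma attract:
  assumes C: "bounded C" and e: "e > 0"
  obtains T where "\<And>t p. T \<le> t \<Longrightarrow> p \<in> C \<Longrightarrow> \<exists>a\<in>A l. dist (skew \<sigma> (F l) t p) a < e"
proof -
  have "((\<lambda>t. semidist (skew \<sigma> (F l) t ` C) (A l)) \<longlongrightarrow> 0) at_top"
    using attractor[of l] C unfolding global_attractor_def by blast
  then have "eventually (\<lambda>t. semidist (skew \<sigma> (F l) t ` C) (A l) < ennreal e) at_top"
    by (rule order_tendstoD) (use e in simp)
  then obtain T where T: "\<And>t. T \<le> t \<Longrightarrow> semidist (skew \<sigma> (F l) t ` C) (A l) < ennreal e"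
    by (auto simp: eventually_at_top_linorder)
  show ?thesis
  proof (rule that)
    fix t p assume "T \<le> t" "p \<in> C"
    have "(INF a\<in>A l. ennreal (dist (skew \<sigma> (F l) t p) a)) \<le> semidist (skew \<sigma> (F l) t ` C) (A l)"
      unfolding semidist_def using \<open>p \<in> C\<close> by (intro SUP_upper2[of "skew \<sigma> (F l) t p"]) auto
    also have "\<dots> < ennreal e" by (rule T[OF \<open>T \<le> t\<close>])
    finally have "\<exists>a\<in>A l. ennreal (dist (skew \<sigma> (F l) t p) a) < ennreal e"
      by (simp only: INF_less_iff)
    then show "\<exists>a\<in>A l. dist (skew \<sigma> (F l) t p) a < e"
      by (auto simp: ennreal_less_iff)
  qed
qed

text \<open>The attractor consists exactly of the bounded complete orbits: such an orbit is mapped onto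
  itself, hence is at distance zero from the attractor.\<close>

lemma complete_in_A:
  assumes u: "is_sol l w u UNIV" and bd: "bounded (range u)"
  shows "(w, u 0) \<in> A l"
proof -
  let ?C = "(UNIV :: 'w set) \<times> range u"
  have C: "bounded ?C" by (intro bounded_Times bd compact_imp_bounded compact_base)
  have "\<exists>a\<in>A l. dist a (w, u 0) < e" if e: "e > 0" for e
  proof -
    obtain T where T: "\<And>t p. T \<le> t \<Longrightarrow> p \<in> ?C \<Longrightarrow> \<exists>a\<in>A l. dist (skew \<sigma> (F l) t p) a < e"
      using attract[OF C e] by blast
    have "skew \<sigma> (F l) T (\<sigma> (- T) w, u (- T)) = (w, u 0)"
      using complete_sol(2)[OF is_sol_shift_UNIV[OF u, of "- T"], of "u (- T)" T]
      by (simp add: skew_def flow_add)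
    then show ?thesis using T[of T "(\<sigma> (- T) w, u (- T))"] by (auto simp: dist_commute)
  qed
  then have "(w, u 0) \<in> closure (A l)" by (simp add: closure_approachable)
  then show ?thesis using compact_imp_closed[OF compact_A] by (simp add: closure_closed)
qed

lemma A_sol:
  assumes "(w, x) \<in> A l"
  obtains u where "is_sol l w u UNIV" "u 0 = x" "\<And>t. (\<sigma> t w, u t) \<in> A l"
  using skew_invariantE[OF invariant_A assms] by blast

lemma \<alpha>_le_0: "\<alpha> l w \<le> 0" and \<beta>_ge_0: "0 \<le> \<beta> l w"
proof -
  have "(w, 0) \<in> A l"
    using complete_in_A[OF is_sol_zero[of l w UNIV]] by simp
  then show "\<alpha> l w \<le> 0" "0 \<le> \<beta> l w" by (auto simp: in_A_iff)
qed

lemma \<beta>_in_A: "(w, \<beta> l w) \<in> A l"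
  using \<alpha>_le_0[of l w] \<beta>_ge_0[of l w] by (simp add: in_A_iff)

lemma \<beta>_bound: obtains R where "R > 0" "\<And>w. \<beta> l w \<le> R"
proof -
  obtain B where B: "B > 0" "\<And>w x. (w, x) \<in> A l \<Longrightarrow> \<bar>x\<bar> \<le> B" using A_bound by blast
  have "\<beta> l w \<le> B" for w using B(2)[OF \<beta>_in_A[of w l]] by simp
  then show ?thesis using that[OF B(1)] by blast
qed

text \<open>Orbits that start at bounded height in the remote past accumulate on the attractor: this
  turns forward estimates into lower bounds for \<open>\<beta>\<close>.\<close>

lemma pullback_limit:
  assumes S: "closed S"
    and v: "\<And>n. is_sol l (\<sigma> (- real n) w) (v n) {0..}" "\<And>n. \<bar>v n 0\<bar> \<le> B" "\<And>n. v n (real n) \<in> S"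
  shows "\<exists>y\<in>S. (w, y) \<in> A l"
proof (rule ccontr)
  assume contra: "\<not> ?thesis"
  let ?N = "{w} \<times> S"
  have N: "closed ?N" "?N \<noteq> {}" using v(3) by (auto intro: closed_Times S)
  have "A l \<noteq> {}" using \<beta>_in_A by blast
  moreover have "continuous_on (A l) (\<lambda>a. infdist a ?N)" by (intro continuous_intros)
  ultimately have "\<exists>a0\<in>A l. \<forall>a\<in>A l. infdist a0 ?N \<le> infdist a ?N"
    by (rule continuous_attains_inf[OF compact_A])
  then obtain a0 where a0: "a0 \<in> A l" "\<forall>a\<in>A l. infdist a0 ?N \<le> infdist a ?N" ..
  define d where "d = infdist a0 ?N"
  have "a0 \<notin> ?N" using a0(1) contra by auto
  then have d0: "d > 0"
    using in_closed_iff_infdist_zero[OF N] infdist_nonneg[of a0 ?N] by (auto simp: d_def less_le)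
  have d: "d > 0" "\<forall>a\<in>A l. \<forall>y\<in>?N. d \<le> dist a y"
    using d0 a0(2) infdist_le[of _ ?N] unfolding d_def by (blast intro: order_trans)+
  let ?C = "(UNIV :: 'w set) \<times> {-B..B}"
  have C: "bounded ?C" by (intro bounded_Times compact_imp_bounded compact_base) simp
  obtain T where T: "\<And>t p. T \<le> t \<Longrightarrow> p \<in> ?C \<Longrightarrow> \<exists>a\<in>A l. dist (skew \<sigma> (F l) t p) a < d"
    using attract[OF C d(1)] by blast
  obtain n :: nat where n: "T \<le> real n" using real_arch_simple by blast
  let ?w = "\<sigma> (- real n) w"
  have seg: "closed_segment 0 (real n) \<subseteq> {0..}" by (auto simp: closed_segment_eq_real_ivl)
  have "sol \<sigma> (F l) (real n) ?w (v n 0) = v n (real n)"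
    by (rule sol_unique[of l ?w "\<lambda>t. sol \<sigma> (F l) t ?w (v n 0)" "real n" "v n"])
      (simp_all add: forward_sol is_sol_subset[OF forward_sol(1) seg] is_sol_subset[OF v(1) seg])
  then have "skew \<sigma> (F l) (real n) (?w, v n 0) = (w, v n (real n))"
    by (simp add: skew_def flow_add)
  moreover have "(?w, v n 0) \<in> ?C" using v(2)[of n] by (simp add: abs_le_iff minus_le_iff)
  ultimately obtain a where "a \<in> A l" "dist (w, v n (real n)) a < d" using T[OF n] by metis
  moreover have "d \<le> dist a (w, v n (real n))" using d(2) \<open>a \<in> A l\<close> v(3) by simp
  ultimately show False by (simp add: dist_commute)
qed

text \<open>The upper boundary of the attractor is invariant, since a complete orbit in the attractor that
  starts on the boundary and later lies strictly below it would be crossed by the one that is on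
  the boundary then.\<close>

lemma \<beta>_sol: "is_sol l w (\<lambda>t. \<beta> l (\<sigma> t w)) UNIV"
proof -
  obtain u where u: "is_sol l w u UNIV" "u 0 = \<beta> l w" "\<And>t. (\<sigma> t w, u t) \<in> A l"
    using A_sol[OF \<beta>_in_A] by blast
  have "u t = \<beta> l (\<sigma> t w)" for t
  proof (rule ccontr)
    assume "u t \<noteq> \<beta> l (\<sigma> t w)"
    then have less: "u t < \<beta> l (\<sigma> t w)" using u(3)[of t] by (simp add: in_A_iff)
    obtain v where v: "is_sol l (\<sigma> t w) v UNIV" "v 0 = \<beta> l (\<sigma> t w)" "\<And>s. (\<sigma> s (\<sigma> t w), v s) \<in> A l"
      using A_sol[OF \<beta>_in_A] by blast
    have "u (- t + t) < v (- t)"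
      by (rule sol_less[of l "\<sigma> t w" "\<lambda>s. u (s + t)" "- t" v])
        (use less v u in \<open>auto intro: is_sol_subset[OF is_sol_shift_UNIV] is_sol_subset\<close>)
    moreover have "(w, v (- t)) \<in> A l" using v(3)[of "- t"] by (simp add: flow_add)
    ultimately show False using u(2) by (simp add: in_A_iff)
  qed
  then have "u = (\<lambda>t. \<beta> l (\<sigma> t w))" by blast
  then show ?thesis using u(1) by simp
qed

end

section \<open>Exponential dichotomies of the linearisation at zero\<close>

text \<open>The linearisation at zero has the exponent \<open>I w t + l * t\<close>, so the parameter \<open>l\<close> corresponds
  to the spectral value \<open>- l\<close>, and there is no dichotomy exactly for \<open>l\<close> between \<open>lm\<close> and \<open>lp\<close>.\<close>

locale dichotomy_family = ode_attractor \<sigma> f fx A \<alpha> \<beta>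
  for \<sigma> :: "real \<Rightarrow> 'w::metric_space \<Rightarrow> 'w" and f fx A \<alpha> \<beta> +
  fixes lm lp :: real
  assumes lm_le_lp: "lm \<le> lp"
    and spectrum: "sacker_sell_spectrum \<sigma> (\<lambda>w. fx w 0) = {- lp .. - lm}"
begin

abbreviation I :: "'w \<Rightarrow> real \<Rightarrow> real" where "I \<equiv> cocycle (\<lambda>w. fx w 0)"

lemma cont_slope0: "continuous_on UNIV (\<lambda>w. fx w 0)"
  by (intro continuous_intros)

lemmas I_deriv = cocycle_deriv[OF cont_slope0]

lemma dichotomy_iff:
  "exp_dichotomy \<sigma> (\<lambda>w. fx w 0 - (- l)) \<longleftrightarrow>
    (\<exists>k\<ge>1. \<exists>\<delta>>0. (\<forall>w. \<forall>t\<ge>0. exp (I w t + l * t) \<le> k * exp (- \<delta> * t)) \<or>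
      (\<forall>w. \<forall>t\<le>0. exp (I w t + l * t) \<le> k * exp (\<delta> * t)))"
proof -
  have "(LBINT s=ereal 0..ereal t. fx (\<sigma> s w) 0 - (- l)) = I w t + l * t" for w t
  proof -
    have "cocycle (\<lambda>w. fx w 0 - (- l)) w t = I w t + l * t"
    proof (rule cocycle_eqI)
      show "continuous_on UNIV (\<lambda>w. fx w 0 - (- l))" by (intro continuous_intros)
      show "((\<lambda>t. I w t + l * t) has_real_derivative fx (\<sigma> s w) 0 - (- l)) (at s)" for s
        using I_deriv[of w s] by (auto intro!: derivative_eq_intros)
    qed simp
    then show ?thesis by (simp add: cocycle_def)
  qed
  then show ?thesis unfolding exp_dichotomy_def by simp
qed

lemma dichotomy_outside: "l < lm \<or> lp < l \<Longrightarrow> exp_dichotomy \<sigma> (\<lambda>w. fx w 0 - (- l))"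
  and no_dichotomy: "lm \<le> l \<Longrightarrow> l \<le> lp \<Longrightarrow> \<not> exp_dichotomy \<sigma> (\<lambda>w. fx w 0 - (- l))"
proof -
  have "- l \<in> sacker_sell_spectrum \<sigma> (\<lambda>w. fx w 0) \<longleftrightarrow> - l \<in> {- lp .. - lm}"
    by (simp only: spectrum)
  then have "\<not> exp_dichotomy \<sigma> (\<lambda>w. fx w 0 - (- l)) \<longleftrightarrow> lm \<le> l \<and> l \<le> lp"
    unfolding sacker_sell_spectrum_def mem_Collect_eq by auto
  then show "l < lm \<or> lp < l \<Longrightarrow> exp_dichotomy \<sigma> (\<lambda>w. fx w 0 - (- l))"
    and "lm \<le> l \<Longrightarrow> l \<le> lp \<Longrightarrow> \<not> exp_dichotomy \<sigma> (\<lambda>w. fx w 0 - (- l))"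
    by linarith+
qed

text \<open>A backward contraction at the end point \<open>lp\<close> would be a dichotomy.\<close>

lemma no_unstable_bound:
  assumes "\<gamma> > 0" "\<And>w t. t \<le> 0 \<Longrightarrow> I w t + lp * t \<le> C + \<gamma> * t"
  shows False
proof -
  have "exp (I w t + lp * t) \<le> exp \<bar>C\<bar> * exp (\<gamma> * t)" if "t \<le> 0" for w t
  proof -
    have "I w t + lp * t \<le> \<bar>C\<bar> + \<gamma> * t" using assms(2)[OF that, of w] by linarith
    then show ?thesis by (simp flip: exp_add)
  qed
  then have "exp_dichotomy \<sigma> (\<lambda>w. fx w 0 - (- lp))"
    unfolding dichotomy_iff using assms(1)
    by (intro exI[of _ "exp \<bar>C\<bar>"] exI[of _ \<gamma>] conjI disjI2) auto
  then show False using no_dichotomy[of lp] lm_le_lp by simp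
qed

lemma no_stable_bound:
  assumes "\<gamma> > 0" "\<And>w t. 0 \<le> t \<Longrightarrow> I w t + lm * t \<le> C - \<gamma> * t"
  shows False
proof -
  have "exp (I w t + lm * t) \<le> exp \<bar>C\<bar> * exp (- \<gamma> * t)" if "0 \<le> t" for w t
  proof -
    have "I w t + lm * t \<le> \<bar>C\<bar> + - \<gamma> * t" using assms(2)[OF that, of w] by linarith
    then show ?thesis by (simp flip: exp_add)
  qed
  then have "exp_dichotomy \<sigma> (\<lambda>w. fx w 0 - (- lm))"
    unfolding dichotomy_iff using assms(1)
    by (intro exI[of _ "exp \<bar>C\<bar>"] exI[of _ \<gamma>] conjI disjI1) auto
  then show False using no_dichotomy[of lm] lm_le_lp by simp
qed

lemma exp_le_iff_ln: "k > 0 \<Longrightarrow> exp x \<le> k * exp y \<longleftrightarrow> x \<le> ln k + y" for k x y :: real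
proof -
  assume "k > 0"
  then have "k * exp y = exp (ln k + y)" by (simp add: exp_add)
  then show ?thesis by simp
qed

text \<open>The type of the dichotomy is constant on each side of the spectrum: a forward
  contraction at some \<open>l > lp\<close> would persist at the smaller parameter \<open>lm\<close>.\<close>

lemma unstable:
  assumes "lp < l"
  obtains K \<delta> where "\<delta> > 0" "\<And>w t. t \<le> 0 \<Longrightarrow> I w t + l * t \<le> K + \<delta> * t"
proof -
  obtain k \<delta> where k: "k \<ge> 1" "\<delta> > 0" and
    alt: "(\<forall>w. \<forall>t\<ge>0. exp (I w t + l * t) \<le> k * exp (- \<delta> * t)) \<or>
      (\<forall>w. \<forall>t\<le>0. exp (I w t + l * t) \<le> k * exp (\<delta> * t))"
    using dichotomy_outside[of l] assms unfolding dichotomy_iff by blast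
  from alt show ?thesis
  proof
    assume *: "\<forall>w. \<forall>t\<ge>0. exp (I w t + l * t) \<le> k * exp (- \<delta> * t)"
    have "I w t + lm * t \<le> ln k - \<delta> * t" if "0 \<le> t" for w t
    proof -
      have "I w t + l * t \<le> ln k - \<delta> * t" using * k that by (simp add: exp_le_iff_ln)
      moreover have "lm * t \<le> l * t" using assms lm_le_lp that by (intro mult_right_mono) auto
      ultimately show ?thesis by simp
    qed
    then show ?thesis using no_stable_bound[OF k(2)] by blast
  next
    assume *: "\<forall>w. \<forall>t\<le>0. exp (I w t + l * t) \<le> k * exp (\<delta> * t)"
    show ?thesis by (rule that[OF k(2), of "ln k"]) (use * k in \<open>simp add: exp_le_iff_ln\<close>)
  qed
qed

lemma stable:
  assumes "l < lm"
  obtains K \<delta> where "\<delta> > 0" "\<And>w t. 0 \<le> t \<Longrightarrow> I w t + l * t \<le> K - \<delta> * t"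
proof -
  obtain k \<delta> where k: "k \<ge> 1" "\<delta> > 0" and
    alt: "(\<forall>w. \<forall>t\<ge>0. exp (I w t + l * t) \<le> k * exp (- \<delta> * t)) \<or>
      (\<forall>w. \<forall>t\<le>0. exp (I w t + l * t) \<le> k * exp (\<delta> * t))"
    using dichotomy_outside[of l] assms unfolding dichotomy_iff by blast
  from alt show ?thesis
  proof
    assume *: "\<forall>w. \<forall>t\<ge>0. exp (I w t + l * t) \<le> k * exp (- \<delta> * t)"
    show ?thesis by (rule that[OF k(2), of "ln k"]) (use * k in \<open>simp add: exp_le_iff_ln\<close>)
  next
    assume *: "\<forall>w. \<forall>t\<le>0. exp (I w t + l * t) \<le> k * exp (\<delta> * t)"
    have "I w t + lp * t \<le> ln k + \<delta> * t" if "t \<le> 0" for w t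
    proof -
      have "I w t + l * t \<le> ln k + \<delta> * t" using * k that by (simp add: exp_le_iff_ln)
      moreover have "lp * t \<le> l * t" using assms lm_le_lp that by (intro mult_right_mono_neg) auto
      ultimately show ?thesis by simp
    qed
    then show ?thesis using no_unstable_bound[OF k(2)] by blast
  qed
qed

end

section \<open>Concavity on the positive half-line\<close>

text \<open>Under concavity of the slope \<open>fx w\<close>, the assumption says that the second derivative at zero is
  not positive. It confines all arguments to positive solutions; the negative ones are reached
  by reflection.\<close>

locale half_line = dichotomy_family \<sigma> f fx A \<alpha> \<beta> lm lp
  for \<sigma> :: "real \<Rightarrow> 'w::metric_space \<Rightarrow> 'w" and f fx A \<alpha> \<beta> lm lp +
  assumes antitone: "0 \<le> x \<Longrightarrow> x \<le> y \<Longrightarrow> fx w y \<le> fx w x"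
begin

lemma f_le_tangent: "0 \<le> x \<Longrightarrow> f w x \<le> fx w 0 * x"
proof -
  assume x: "0 \<le> x"
  have "0 * (x - 0) \<le> (fx w 0 * x - f w x) - (fx w 0 * 0 - f w 0)"
    by (rule deriv_ge_imp_diff_ge[OF x, of _ "\<lambda>s. fx w 0 - fx w s"])
      (auto intro!: derivative_eq_intros deriv_f simp: antitone)
  then show ?thesis by simp
qed

lemma f_ge_chord: "0 \<le> x \<Longrightarrow> fx w x * x \<le> f w x"
proof -
  assume x: "0 \<le> x"
  have "0 * (x - 0) \<le> (f w x - fx w x * x) - (f w 0 - fx w x * 0)"
    by (rule deriv_ge_imp_diff_ge[OF x, of _ "\<lambda>s. fx w s - fx w x"])
      (auto intro!: derivative_eq_intros deriv_f simp: antitone)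
  then show ?thesis by simp
qed

lemma ln_sol_deriv:
  assumes "is_sol l w u S" "t \<in> S" "0 < u t"
  shows "((\<lambda>t. ln (u t)) has_real_derivative f (\<sigma> t w) (u t) / u t + l) (at t)"
proof -
  have "((\<lambda>t. ln (u t)) has_real_derivative inverse (u t) * (f (\<sigma> t w) (u t) + l * u t)) (at t)"
    by (rule DERIV_ln[THEN DERIV_chain2, OF assms(3) is_solD[OF assms(1,2)]])
  then show ?thesis using assms(3) by (simp add: field_simps)
qed

text \<open>The excess of the linear growth exponent over that of a positive solution.\<close>

lemma excess_deriv:
  assumes "is_sol l w u S" "t \<in> S" "0 < u t"
  shows "((\<lambda>t. I w t + l * t - ln (u t)) has_real_derivative fx (\<sigma> t w) 0 - f (\<sigma> t w) (u t) / u t) (at t)"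
  using DERIV_diff[OF DERIV_add[OF I_deriv[of w t] DERIV_cmult_Id[of l t]] ln_sol_deriv[OF assms]] by simp

lemma excess_nonneg: "0 < x \<Longrightarrow> 0 \<le> fx w 0 - f w x / x"
  using f_le_tangent[of x w] by (simp add: field_simps)

text \<open>The excess is nondecreasing and \<open>ln (u t)\<close> is bounded, so the exponent at \<open>l\<close> is bounded
  above in backward time. If \<open>l < lp\<close>, the margin \<open>lp - l\<close> is a rate of a dichotomy at \<open>lp\<close>.\<close>

lemma separated_imp_ge:
  assumes \<rho>: "0 < \<rho>" and sol: "\<And>w. \<exists>u. is_sol l w u UNIV \<and> (\<forall>t. \<rho> \<le> u t \<and> u t \<le> R)"
  shows "lp \<le> l"
proof (rule ccontr)
  assume "\<not> lp \<le> l"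
  then have "0 < lp - l" by simp
  have "I w t + lp * t \<le> (ln R - ln \<rho>) + (lp - l) * t" if t: "t \<le> 0" for w t
  proof -
    obtain u where u: "is_sol l w u UNIV" "\<And>t. \<rho> \<le> u t" "\<And>t. u t \<le> R" using sol by blast
    have pos: "0 < u t" for t using u(2)[of t] \<rho> by linarith
    have "0 * (0 - t) \<le> (I w 0 + l * 0 - ln (u 0)) - (I w t + l * t - ln (u t))"
      by (rule deriv_ge_imp_diff_ge[OF t excess_deriv[OF u(1) UNIV_I pos]]) (rule excess_nonneg[OF pos])
    moreover have "ln (u t) \<le> ln R" "ln \<rho> \<le> ln (u 0)"
      using u pos \<rho> by (auto simp: ln_le_cancel_iff order_less_le_trans[OF pos])
    ultimately show ?thesis by (simp add: algebra_simps)
  qed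
  then show False by (rule no_unstable_bound[OF \<open>0 < lp - l\<close>])
qed

text \<open>Every orbit meets \<open>U\<close> within a bounded time, and by Gronwall's inequality the equilibrium
  cannot have been much smaller before.\<close>

lemma equilibrium_lower_bound:
  assumes U: "open U" "U \<noteq> {}" and e: "0 < e"
    and sol: "\<And>w. is_sol l w (\<lambda>t. b (\<sigma> t w)) UNIV"
    and R: "\<And>w. 0 \<le> b w" "\<And>w. b w \<le> R" and low: "\<And>w. w \<in> U \<Longrightarrow> e \<le> b w"
  obtains \<rho> where "\<rho> > 0" "\<And>w. \<rho> \<le> b w"
proof -
  obtain T where T: "T > 0" "\<And>w. \<exists>t. 0 \<le> t \<and> t \<le> T \<and> \<sigma> t w \<in> U"
    using uniform_visit[OF U] by blast
  obtain L where L: "L \<ge> 0" "\<And>w x. \<bar>x\<bar> \<le> R \<Longrightarrow> \<bar>fx w x\<bar> \<le> L" using slope_bound[of R] by blast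
  define M where "M = 2 * (L + \<bar>l\<bar>) + 1"
  have M: "M > 0" using L by (simp add: M_def)
  have "e / sqrt (exp (M * T)) \<le> b w" for w
  proof -
    obtain t where t: "0 \<le> t" "t \<le> T" "\<sigma> t w \<in> U" using T by blast
    have bd: "\<bar>b v\<bar> \<le> R" for v using R[of v] by simp
    have "0 \<le> R" using bd[of w] by linarith
    have gap: "(b (\<sigma> t w) - 0)\<^sup>2 \<le> ((b (\<sigma> 0 w) - 0)\<^sup>2 + (0 + \<bar>l - l\<bar> * R)\<^sup>2) * exp ((2 * (L + \<bar>l\<bar>) + 1) * \<bar>t\<bar>)"
      by (rule sol_gap[OF is_sol_subset[OF sol subset_UNIV] is_sol_zero]) (use bd L \<open>0 \<le> R\<close> in simp_all)
    have "e\<^sup>2 \<le> (b (\<sigma> t w))\<^sup>2" using low[OF t(3)] e by (intro power_mono) auto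
    also have "\<dots> \<le> (b w)\<^sup>2 * exp (M * t)" using gap t by (simp add: M_def)
    also have "\<dots> \<le> (b w)\<^sup>2 * exp (M * T)" using t M by (intro mult_left_mono) auto
    finally have "sqrt (e\<^sup>2) \<le> sqrt ((b w)\<^sup>2 * exp (M * T))" by (rule real_sqrt_le_mono)
    then have "e \<le> b w * sqrt (exp (M * T))" using e R(1)[of w] by (simp add: real_sqrt_mult)
    then show ?thesis by (simp add: divide_le_eq)
  qed
  then show ?thesis using that[of "e / sqrt (exp (M * T))"] e by simp
qed

text \<open>Otherwise \<open>\<beta> l\<close> would be bounded away from zero near \<open>w0\<close>, hence everywhere.\<close>

theorem \<beta>_zero_at_continuity:
  assumes l: "l < lp" and c: "isCont (\<beta> l) w0"
  shows "\<beta> l w0 = 0"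
proof (rule ccontr)
  assume "\<beta> l w0 \<noteq> 0"
  then have pos: "0 < \<beta> l w0" using \<beta>_ge_0[of l w0] by simp
  define e where "e = \<beta> l w0 / 2"
  have "open {e<..} \<and> \<beta> l w0 \<in> {e<..}" using pos by (simp add: e_def)
  then have "\<exists>U. open U \<and> w0 \<in> U \<and> (\<forall>w\<in>U. \<beta> l w \<in> {e<..})"
    using c[unfolded continuous_at_open] by blast
  then obtain U where U: "open U" "w0 \<in> U" "\<And>w. w \<in> U \<Longrightarrow> e < \<beta> l w" by auto
  obtain R where "R > 0" and R: "\<And>w. \<beta> l w \<le> R" by (rule \<beta>_bound[of l]) (rule that)
  obtain \<rho> where \<rho>: "\<rho> > 0" "\<And>w. \<rho> \<le> \<beta> l w"
  proof (rule equilibrium_lower_bound[of U e l "\<beta> l" R])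
    show "e \<le> \<beta> l w" if "w \<in> U" for w using U(3)[OF that] by simp
  qed (use U pos in \<open>auto simp: e_def \<beta>_sol \<beta>_ge_0 R\<close>)
  have "lp \<le> l"
    by (rule separated_imp_ge[OF \<rho>(1), of l R]) (use \<beta>_sol \<rho>(2) R in blast)
  then show False using l by simp
qed

text \<open>A positive solution grows at most like the linearisation, which contracts; pulled back to the
  remote past, where it is bounded by \<open>R\<close>, a solution in the attractor must vanish.\<close>

lemma \<beta>_zero_below:
  assumes l: "l < lm" shows "\<beta> l w = 0"
proof (rule ccontr)
  assume "\<beta> l w \<noteq> 0"
  then have pos: "0 < \<beta> l w" using \<beta>_ge_0[of l w] by simp
  obtain K \<delta> where K: "\<delta> > 0" "\<And>w t. 0 \<le> t \<Longrightarrow> I w t + l * t \<le> K - \<delta> * t"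
    by (rule stable[OF l]) (rule that)
  obtain R where R: "R > 0" "\<And>w. \<beta> l w \<le> R" by (rule \<beta>_bound[of l]) (rule that)
  have le: "ln (\<beta> l w) \<le> ln R + K - \<delta> * s" if s: "0 \<le> s" for s
  proof -
    define w' where "w' = \<sigma> (- s) w"
    have w: "\<sigma> s w' = w" by (simp add: w'_def flow_add)
    have pos': "0 < \<beta> l (\<sigma> t w')" for t
    proof -
      have "is_sol l w (\<lambda>t. \<beta> l (\<sigma> t w)) (closed_segment 0 (t - s))"
        by (rule is_sol_subset[OF \<beta>_sol subset_UNIV])
      then have "0 < \<beta> l (\<sigma> (t - s) w)" by (rule sol_positive) (use pos in simp)
      then show ?thesis by (simp add: w'_def flow_add)
    qed
    have "0 * (s - 0) \<le> (I w' s + l * s - ln (\<beta> l (\<sigma> s w'))) - (I w' 0 + l * 0 - ln (\<beta> l (\<sigma> 0 w')))"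
      by (rule deriv_ge_imp_diff_ge[OF s excess_deriv[OF \<beta>_sol UNIV_I pos']]) (rule excess_nonneg[OF pos'])
    moreover have "ln (\<beta> l w') \<le> ln R" using R pos'[of 0] by simp
    ultimately show ?thesis using K(2)[OF s, of w'] by (simp add: w)
  qed
  define s where "s = \<bar>ln R + K - ln (\<beta> l w)\<bar> / \<delta> + 1"
  have "0 \<le> s" using K by (simp add: s_def)
  moreover have "\<delta> * s = \<bar>ln R + K - ln (\<beta> l w)\<bar> + \<delta>" using K by (simp add: s_def field_simps)
  ultimately show False using le[of s] K by linarith
qed

text \<open>Repulsion of zero in logarithmic coordinates, restricted to heights up to \<open>r\<close>, where the
  linearisation dominates.\<close>

definition repels :: "real \<Rightarrow> real \<Rightarrow> real \<Rightarrow> real \<Rightarrow> bool" where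
  "repels l r K \<delta> \<longleftrightarrow> (\<forall>w u s t. s \<le> t \<and> is_sol l w u {s..t} \<and>
     (\<forall>q\<in>{s..t}. 0 < u q \<and> u q \<le> r) \<longrightarrow> ln (u s) + \<delta> * (t - s) - K \<le> ln (u t))"

lemma repelsD:
  assumes "repels l r K \<delta>" "s \<le> t" "is_sol l w u {s..t}"
    "\<And>q. s \<le> q \<Longrightarrow> q \<le> t \<Longrightarrow> 0 < u q" "\<And>q. s \<le> q \<Longrightarrow> q \<le> t \<Longrightarrow> u q \<le> r"
  shows "ln (u s) + \<delta> * (t - s) - K \<le> ln (u t)"
  using assms unfolding repels_def by auto

text \<open>Up to the height \<open>r\<close> the slope differs from the slope at zero by at most half of the rate of
  the linearisation; the other half remains.\<close>

lemma repelling: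
  assumes l: "lp < l"
  shows "\<exists>r>0. \<exists>K\<ge>0. \<exists>\<delta>>0. repels l r K \<delta>"
proof -
  obtain K \<delta> where K: "\<delta> > 0" "\<And>w t. t \<le> 0 \<Longrightarrow> I w t + l * t \<le> K + \<delta> * t"
    by (rule unstable[OF l]) (rule that)
  have "K \<ge> 0" using K(2)[of 0 undefined] by simp
  have cpt: "compact ((UNIV :: 'w set) \<times> {0..1::real})" by (intro compact_Times compact_base) simp
  have "uniformly_continuous_on ((UNIV :: 'w set) \<times> {0..1::real}) (\<lambda>(w, x). fx w x)"
    by (rule compact_uniformly_continuous[OF continuous_on_subset[OF cont_fx] cpt]) simp
  then obtain d where d: "d > 0" "\<And>p q. p \<in> (UNIV :: 'w set) \<times> {0..1} \<Longrightarrow> q \<in> UNIV \<times> {0..1} \<Longrightarrow>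
      dist q p < d \<Longrightarrow> dist (case q of (w, x) \<Rightarrow> fx w x) (case p of (w, x) \<Rightarrow> fx w x) < \<delta> / 2"
    unfolding uniformly_continuous_on_def using K(1) by (metis half_gt_zero)
  define r where "r = min 1 (d / 2)"
  have r: "0 < r" "r \<le> 1" "r < d" using d by (auto simp: r_def)
  have near: "fx w 0 - \<delta> / 2 \<le> fx w r" for w
  proof -
    have "\<bar>fx w r - fx w 0\<bar> < \<delta> / 2"
      using d(2)[of "(w, 0)" "(w, r)"] r by (simp add: dist_Pair_Pair dist_real_def)
    then show ?thesis by linarith
  qed
  have "repels l r K (\<delta> / 2)"
    unfolding repels_def
  proof (intro allI impI, elim conjE)
    fix w u and s t :: real
    assume st: "s \<le> t" and u: "is_sol l w u {s..t}" and small: "\<forall>q\<in>{s..t}. 0 < u q \<and> u q \<le> r"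
    have "- (\<delta> / 2) * (t - s) \<le> - (I w t + l * t - ln (u t)) - - (I w s + l * s - ln (u s))"
    proof (rule deriv_ge_imp_diff_ge[OF st])
      fix q assume q: "s \<le> q" "q \<le> t"
      have pos: "0 < u q" and le: "u q \<le> r" using small q by auto
      show "((\<lambda>t. - (I w t + l * t - ln (u t))) has_real_derivative
          - (fx (\<sigma> q w) 0 - f (\<sigma> q w) (u q) / u q)) (at q)"
        by (rule DERIV_minus[OF excess_deriv[OF u _ pos]]) (use q in simp)
      have "fx (\<sigma> q w) 0 - \<delta> / 2 \<le> fx (\<sigma> q w) (u q)"
        using near[of "\<sigma> q w"] antitone[of "u q" r "\<sigma> q w"] pos le by linarith
      also have "\<dots> \<le> f (\<sigma> q w) (u q) / u q"
        using f_ge_chord[of "u q" "\<sigma> q w"] pos by (simp add: field_simps)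
      finally show "- (\<delta> / 2) \<le> - (fx (\<sigma> q w) 0 - f (\<sigma> q w) (u q) / u q)" by simp
    qed
    moreover have "I w s - I w t + l * (s - t) \<le> K + \<delta> * (s - t)"
      using K(2)[of "s - t" "\<sigma> t w"] st by (simp add: cocycle_shift[OF cont_slope0])
    ultimately show "ln (u s) + \<delta> / 2 * (t - s) - K \<le> ln (u t)"
      by (simp add: algebra_simps diff_divide_distrib)
  qed
  then show ?thesis using r(1) K(1) \<open>K \<ge> 0\<close> half_gt_zero by blast
qed

text \<open>After the last time at which the solution has the height \<open>r\<close> it is below \<open>r\<close>, so that the
  repulsion estimate applies from that time on and costs at most the factor \<open>exp (- K)\<close>.\<close>

lemma stays_above:
  assumes r: "r > 0" and K: "K \<ge> 0" and \<delta>: "\<delta> > 0"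
    and rep: "repels l r K \<delta>"
    and st: "s \<le> t" and u: "is_sol l w u {s..t}" and pos: "\<And>q. s \<le> q \<Longrightarrow> q \<le> t \<Longrightarrow> 0 < u q"
    and start: "r \<le> u s"
  shows "r * exp (- K) \<le> u t"
proof (cases "r \<le> u t")
  case True
  have "r * exp (- K) \<le> r * 1" using r K by (intro mult_left_mono) auto
  then show ?thesis using True by simp
next
  case False
  have cu: "continuous_on {s..t} u" by (rule is_sol_continuous[OF u])
  define E where "E = {q \<in> {s..t}. u q = r}"
  have "compact E"
  proof -
    have "closed E" unfolding E_def
      by (rule continuous_closed_preimage_constant[OF cu]) simp
    then have "compact ({s..t} \<inter> E)" by (intro compact_Int_closed) auto
    moreover have "{s..t} \<inter> E = E" by (auto simp: E_def)
    ultimately show ?thesis by simp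
  qed
  moreover have "E \<noteq> {}"
    using IVT2'[of u t r s] start False st cu by (auto simp: E_def)
  ultimately obtain q where q: "q \<in> E" "\<forall>p\<in>E. p \<le> q" using compact_attains_sup by blast
  have q': "s \<le> q" "q \<le> t" "u q = r" using q by (auto simp: E_def)
  have below: "u p \<le> r" if p: "q \<le> p" "p \<le> t" for p
  proof (rule ccontr)
    assume "\<not> u p \<le> r"
    moreover have "continuous_on {p..t} u" using p q' by (intro continuous_on_subset[OF cu]) auto
    ultimately obtain p' where "p \<le> p'" "p' \<le> t" "u p' = r"
      using IVT2'[of u t r p] False p by auto
    then have "p' \<in> E" "p' \<noteq> q \<or> p = q" using p q' by (auto simp: E_def)
    then have "p = q" using q(2) p \<open>p \<le> p'\<close> by fastforce
    then show False using \<open>\<not> u p \<le> r\<close> q' by simp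
  qed
  have "ln (u q) + \<delta> * (t - q) - K \<le> ln (u t)"
    by (rule repelsD[OF rep q'(2) is_sol_subset[OF u]]) (use q' pos below in auto)
  moreover have "0 \<le> \<delta> * (t - q)" using \<delta> q' by simp
  ultimately have "ln r - K \<le> ln (u t)" using q' by simp
  then have "exp (ln r - K) \<le> exp (ln (u t))" by simp
  then show ?thesis using r pos[of t] st by (simp add: exp_diff exp_minus field_simps)
qed

text \<open>The threshold is the height that solutions started at \<open>r\<close> never fall below. Pulling such
  solutions back bounds \<open>\<beta> l\<close> from below, and a complete solution that is below the threshold at
  time \<open>0\<close> was below \<open>r\<close> at all earlier times, which gives its exponential decay backwards.\<close>

lemma above_threshold:
  assumes l: "lp < l"
  obtains c k \<gamma> where "c > 0" "k \<ge> 1" "\<gamma> > 0" "\<And>w. c \<le> \<beta> l w"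
    "\<And>w u t. is_sol l w u UNIV \<Longrightarrow> 0 < u 0 \<Longrightarrow> u 0 < c \<Longrightarrow> t \<le> 0 \<Longrightarrow> 0 < u t \<and> u t \<le> k * exp (\<gamma> * t) * u 0"
proof -
  obtain r K \<delta> where r: "r > 0" "\<delta> > 0" "K \<ge> 0" and rep: "repels l r K \<delta>"
    using repelling[OF l] by blast
  note above = stays_above[OF r(1,3,2) rep]
  show ?thesis
  proof (rule that[of "r * exp (- K)" "exp K" \<delta>])
    fix w
    define v where "v n t = sol \<sigma> (F l) t (\<sigma> (- real n) w) r" for n :: nat and t
    have v: "is_sol l (\<sigma> (- real n) w) (v n) {0..}" "v n 0 = r" for n
      unfolding v_def by (rule forward_sol)+
    have pos: "0 < v n t" if "0 \<le> t" for n t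
    proof (rule sol_positive[of l "\<sigma> (- real n) w" "v n" t])
      show "is_sol l (\<sigma> (- real n) w) (v n) (closed_segment 0 t)"
        by (rule is_sol_subset[OF v(1)]) (use that in \<open>auto simp: closed_segment_eq_real_ivl\<close>)
    qed (use v r in simp)
    have "r * exp (- K) \<le> v n (real n)" for n
    proof (rule above[of 0 "real n" "\<sigma> (- real n) w" "v n"])
      show "is_sol l (\<sigma> (- real n) w) (v n) {0..real n}"
        by (rule is_sol_subset[OF v(1)]) auto
    qed (use pos v in auto)
    then have "\<exists>y\<in>{r * exp (- K)..}. (w, y) \<in> A l"
      using v r by (intro pullback_limit[where v = v and B = r]) auto
    then show "r * exp (- K) \<le> \<beta> l w" by (auto simp: in_A_iff)
  next
    fix w u and t :: real
    assume u: "is_sol l w u UNIV" and u0: "0 < u 0" "u 0 < r * exp (- K)" and t: "t \<le> 0"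
    have pos: "0 < u q" for q
      by (rule sol_positive[OF is_sol_subset[OF u subset_UNIV] u0(1)])
    have small: "u q \<le> r" if "q \<le> 0" for q
    proof (rule ccontr)
      assume "\<not> u q \<le> r"
      then have "r * exp (- K) \<le> u 0"
        by (intro above[OF that is_sol_subset[OF u subset_UNIV]]) (use pos in auto)
      then show False using u0 by simp
    qed
    have "ln (u t) + \<delta> * (0 - t) - K \<le> ln (u 0)"
      by (rule repelsD[OF rep t is_sol_subset[OF u subset_UNIV]]) (use pos small in auto)
    then have "ln (u t) \<le> K + \<delta> * t + ln (u 0)" by simp
    then have "exp (ln (u t)) \<le> exp (K + \<delta> * t + ln (u 0))" by simp
    then show "0 < u t \<and> u t \<le> exp K * exp (\<delta> * t) * u 0"
      using pos[of t] u0 by (simp add: exp_add)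
  qed (use r in auto)
qed

end

section \<open>Strict concavity: contraction, stability and collision\<close>

text \<open>The tube lemma: the points of the base over which \<open>G\<close> takes a value at most \<open>\<eta>\<close> form the
  projection of a compact set.\<close>

lemma positive_on_tube:
  fixes G :: "'w::metric_space \<Rightarrow> real \<Rightarrow> real"
  assumes cpt: "compact (UNIV :: 'w set)" and pQ: "p \<le> Q"
    and cont: "continuous_on (UNIV \<times> {p..Q}) (\<lambda>q. G (fst q) (snd q))"
    and pos: "\<And>x. p \<le> x \<Longrightarrow> x \<le> Q \<Longrightarrow> 0 < G w0 x"
  shows "\<exists>\<eta>>0. \<exists>U. open U \<and> w0 \<in> U \<and> (\<forall>w\<in>U. \<forall>x\<in>{p..Q}. \<eta> \<le> G w x)"
proof -
  have K: "compact ((UNIV :: 'w set) \<times> {p..Q})" by (intro compact_Times cpt) simp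
  have "continuous_on {p..Q} (\<lambda>x. G (fst (w0, x)) (snd (w0, x)))"
    by (rule continuous_on_compose2[OF cont]) (auto intro!: continuous_on_Pair continuous_on_const continuous_on_id)
  then have "continuous_on {p..Q} (G w0)" by simp
  moreover have "{p..Q} \<noteq> {}" using pQ by simp
  ultimately have "\<exists>x0\<in>{p..Q}. \<forall>x\<in>{p..Q}. G w0 x0 \<le> G w0 x"
    by (intro continuous_attains_inf) auto
  then obtain x0 where x0: "x0 \<in> {p..Q}" "\<forall>x\<in>{p..Q}. G w0 x0 \<le> G w0 x" by blast
  define \<eta> where "\<eta> = G w0 x0 / 2"
  have \<eta>: "\<eta> > 0" using pos[of x0] x0(1) by (simp add: \<eta>_def)
  define B where "B = (UNIV \<times> {p..Q}) \<inter> (\<lambda>q. G (fst q) (snd q)) -` {..\<eta>}"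
  have "closed B"
    unfolding B_def by (rule continuous_closed_preimage[OF cont compact_imp_closed[OF K]]) simp
  then have "compact B"
    using compact_Int_closed[OF K, of B] by (simp add: B_def Int_assoc)
  then have "closed (fst ` B)"
    by (intro compact_imp_closed compact_continuous_image continuous_intros)
  moreover have "w0 \<notin> fst ` B"
  proof
    assume "w0 \<in> fst ` B"
    then obtain x where "x \<in> {p..Q}" "G w0 x \<le> \<eta>" by (auto simp: B_def)
    then show False using x0(2) \<eta> by (fastforce simp: \<eta>_def)
  qed
  moreover have "\<eta> \<le> G w x" if "w \<in> - fst ` B" "x \<in> {p..Q}" for w x
  proof (rule ccontr)
    assume "\<not> \<eta> \<le> G w x"
    then have "(w, x) \<in> B" using that(2) by (simp add: B_def)
    then have "w \<in> fst ` B" by (rule rev_image_eqI) simp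
    then show False using that(1) by simp
  qed
  ultimately show ?thesis using \<eta> by (intro exI[of _ \<eta>] exI[of _ "- fst ` B"] conjI) auto
qed

lemma ln_diff_le:
  fixes x y m :: real
  assumes "0 < m" "m \<le> x" "m \<le> y"
  shows "\<bar>ln x - ln y\<bar> \<le> \<bar>x - y\<bar> / m"
proof -
  have main: "ln b - ln a \<le> (b - a) / m" if "m \<le> a" "a \<le> b" for a b :: real
  proof -
    have "ln b - ln a = ln (b / a)" using that assms by (simp add: ln_div)
    also have "\<dots> \<le> b / a - 1" using that assms by (intro ln_le_minus_one) simp
    also have "\<dots> = (b - a) / a" using that assms by (simp add: field_simps)
    also have "\<dots> \<le> (b - a) / m" using that assms by (intro divide_left_mono) auto
    finally show ?thesis .
  qed
  show ?thesis
  proof (cases "x \<le> y")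
    case True
    then have "ln x \<le> ln y" using assms by simp
    then show ?thesis using main[of x y] True assms by simp
  next
    case False
    then have "ln y \<le> ln x" using assms by simp
    then show ?thesis using main[of y x] False assms by simp
  qed
qed

lemma diff_le_ln_diff:
  fixes x y M :: real
  assumes "0 < x" "0 < y" "x \<le> M" "y \<le> M"
  shows "\<bar>x - y\<bar> \<le> M * \<bar>ln x - ln y\<bar>"
proof -
  have main: "b - a \<le> M * (ln b - ln a)" if "0 < a" "a \<le> b" "b \<le> M" for a b :: real
  proof -
    have "ln a - ln b = ln (a / b)" using that by (simp add: ln_div)
    also have "\<dots> \<le> a / b - 1" using that by (intro ln_le_minus_one) simp
    finally have "(b - a) / b \<le> ln b - ln a" using that by (simp add: field_simps)
    then have "b - a \<le> b * (ln b - ln a)" using that by (simp add: field_simps)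
    also have "\<dots> \<le> M * (ln b - ln a)" using that by (intro mult_right_mono) auto
    finally show ?thesis .
  qed
  show ?thesis
  proof (cases "x \<le> y")
    case True
    then have "ln x \<le> ln y" using assms by simp
    then show ?thesis using main[of x y] True assms by simp
  next
    case False
    then have "ln y \<le> ln x" using assms by simp
    then show ?thesis using main[of y x] False assms by simp
  qed
qed

text \<open>The preimage of a closed set is the projection of a compact part of the graph.\<close>

lemma continuous_on_closed_graphI:
  fixes b :: "'w::metric_space \<Rightarrow> real"
  assumes cpt: "compact (UNIV :: 'w set)" "compact T" and rng: "\<And>w. b w \<in> T"
    and graph: "\<And>W w x. W \<longlonglongrightarrow> w \<Longrightarrow> (\<lambda>n. b (W n)) \<longlonglongrightarrow> x \<Longrightarrow> x = b w"
  shows "continuous_on UNIV b"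
proof -
  let ?G = "range (\<lambda>w. (w, b w))"
  have "closed ?G"
    unfolding closed_sequential_limits
  proof (intro allI impI, elim conjE)
    fix s :: "nat \<Rightarrow> 'w \<times> real" and p
    assume s: "\<forall>n. s n \<in> ?G" "s \<longlonglongrightarrow> p"
    have "snd (s n) = b (fst (s n))" for n using s(1) by (auto dest: spec[of _ n])
    then have "(\<lambda>n. b (fst (s n))) \<longlonglongrightarrow> snd p" using tendsto_snd[OF s(2)] by simp
    then have "snd p = b (fst p)" by (rule graph[OF tendsto_fst[OF s(2)]])
    then show "p \<in> ?G" by (metis prod.collapse rangeI)
  qed
  moreover have "?G \<subseteq> UNIV \<times> T" using rng by auto
  ultimately have G: "compact ?G"
    using compact_Int_closed[OF compact_Times[OF cpt], of ?G] by (simp add: Int_absorb1)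
  have "closed (b -` C)" if "closed C" for C
  proof -
    have "compact (?G \<inter> (UNIV \<times> C))" by (intro compact_Int_closed G closed_Times that) simp
    then have "closed (fst ` (?G \<inter> (UNIV \<times> C)))"
      by (intro compact_imp_closed compact_continuous_image continuous_intros)
    moreover have "fst ` (?G \<inter> (UNIV \<times> C)) = b -` C" by force
    ultimately show ?thesis by simp
  qed
  then show ?thesis by (simp add: continuous_on_closed_vimage)
qed

context half_line
begin

text \<open>In logarithmic coordinates the equation has the right-hand side \<open>f w x / x + l\<close>, which
  decreases at the rate \<open>f w x / x - fx w x\<close>.\<close>

lemma chord_slope_decreasing:
  assumes x: "0 < x" "x \<le> y" and m: "\<And>z. x \<le> z \<Longrightarrow> z \<le> y \<Longrightarrow> m \<le> f w z / z - fx w z"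
  shows "f w y / y + m * (ln y - ln x) \<le> f w x / x"
proof -
  have "m * (ln y - ln x) \<le> - (f w (exp (ln y)) / exp (ln y)) - - (f w (exp (ln x)) / exp (ln x))"
  proof (rule deriv_ge_imp_diff_ge)
    show "ln x \<le> ln y" using x by simp
    fix s assume s: "ln x \<le> s" "s \<le> ln y"
    have "exp (ln x) \<le> exp s" "exp s \<le> exp (ln y)" using s by simp_all
    then have z: "x \<le> exp s" "exp s \<le> y" using x by simp_all
    have "((\<lambda>s. f w (exp s)) has_real_derivative fx w (exp s) * exp s) (at s)"
      by (rule DERIV_chain2[OF deriv_f DERIV_exp])
    then have "((\<lambda>s. - (f w (exp s) / exp s)) has_real_derivative
        - ((fx w (exp s) * exp s * exp s - f w (exp s) * exp s) / (exp s * exp s))) (at s)"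
      by (intro DERIV_minus DERIV_divide DERIV_exp) auto
    moreover have "- ((a * E * E - b * E) / (E * E)) = b / E - a" if "E > 0" for a b E :: real
      using that by (simp add: field_simps)
    ultimately show "((\<lambda>s. - (f w (exp s) / exp s)) has_real_derivative f w (exp s) / exp s - fx w (exp s)) (at s)"
      by (simp only: exp_gt_zero)
    show "m \<le> f w (exp s) / exp s - fx w (exp s)" by (rule m[OF z])
  qed
  then show ?thesis using x by simp
qed

lemma chord_gap_nonneg: "0 < x \<Longrightarrow> 0 \<le> f w x / x - fx w x"
  using f_ge_chord[of x w] by (simp add: field_simps)

lemma ln_gap_deriv:
  assumes "is_sol l w u S" "is_sol l w v S" "q \<in> S" "0 < u q" "0 < v q"
  shows "((\<lambda>t. ln (v t) - ln (u t)) has_real_derivative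
    f (\<sigma> q w) (v q) / v q - f (\<sigma> q w) (u q) / u q) (at q)"
  using DERIV_diff[OF ln_sol_deriv[OF assms(2,3,5)] ln_sol_deriv[OF assms(1,3,4)]] by simp

lemma sub_segment:
  assumes "is_sol l w u {0..t}" "0 \<le> q" "q \<le> t"
  shows "is_sol l w u (closed_segment 0 q)"
  using assms by (intro is_sol_subset[OF assms(1)]) (auto simp: closed_segment_eq_real_ivl)

text \<open>This holds for all positive solutions; it keeps a solution that starts close to \<open>\<beta> l\<close> in the
  region where the contraction below is uniform.\<close>

lemma ln_gap_nonincreasing:
  assumes t: "0 \<le> t" and u: "is_sol l w u {0..t}" and v: "is_sol l w v {0..t}"
    and pos: "0 < u 0" "0 < v 0"
  shows "\<bar>ln (v t) - ln (u t)\<bar> \<le> \<bar>ln (v 0) - ln (u 0)\<bar>"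
proof -
  have main: "\<bar>ln (b t) - ln (a t)\<bar> \<le> \<bar>ln (b 0) - ln (a 0)\<bar>"
    if a: "is_sol l w a {0..t}" and b: "is_sol l w b {0..t}" and less: "a 0 < b 0" and p: "0 < a 0" for a b
  proof -
    have pa: "0 < a q" and ab: "a q < b q" if q: "0 \<le> q" "q \<le> t" for q
      by (rule sol_positive[OF sub_segment[OF a q] p])
        (rule sol_less[OF sub_segment[OF a q] sub_segment[OF b q] less])
    have "0 * (t - 0) \<le> - (ln (b t) - ln (a t)) - - (ln (b 0) - ln (a 0))"
    proof (rule deriv_ge_imp_diff_ge[OF t])
      fix q assume q: "0 \<le> q" "q \<le> t"
      have pq: "0 < a q" "a q < b q" using pa[OF q] ab[OF q] .
      show "((\<lambda>t. - (ln (b t) - ln (a t))) has_real_derivative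
          - (f (\<sigma> q w) (b q) / b q - f (\<sigma> q w) (a q) / a q)) (at q)"
        by (rule DERIV_minus[OF ln_gap_deriv[OF a b]]) (use q pq in auto)
      have "f (\<sigma> q w) (b q) / b q + 0 * (ln (b q) - ln (a q)) \<le> f (\<sigma> q w) (a q) / a q"
      proof (rule chord_slope_decreasing)
        show "0 \<le> f (\<sigma> q w) z / z - fx (\<sigma> q w) z" if "a q \<le> z" for z
          by (rule chord_gap_nonneg) (use that pq in linarith)
      qed (use pq in auto)
      then show "0 \<le> - (f (\<sigma> q w) (b q) / b q - f (\<sigma> q w) (a q) / a q)" by simp
    qed
    moreover have "ln (a t) \<le> ln (b t)" "ln (a 0) \<le> ln (b 0)"
      using pa[of t] ab[of t] t p less by auto
    ultimately show ?thesis by simp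
  qed
  consider "u 0 < v 0" | "v 0 < u 0" | "u 0 = v 0" by linarith
  then show ?thesis
  proof cases
    case 1 then show ?thesis by (rule main[OF u v _ pos(1)])
  next
    case 2 then show ?thesis using main[OF v u _ pos(2)] by (simp add: abs_minus_commute)
  next
    case 3
    then have "u t = v t"
      using sol_unique[OF sub_segment[OF u t] sub_segment[OF v t]] by simp
    then show ?thesis by simp
  qed
qed

end

text \<open>The additional assumption is a consequence of strict concavity: arbitrarily close to zero the
  slope is not constant over some base point.\<close>

locale strict_half_line = half_line \<sigma> f fx A \<alpha> \<beta> lm lp
  for \<sigma> :: "real \<Rightarrow> 'w::metric_space \<Rightarrow> 'w" and f fx A \<alpha> \<beta> lm lp +
  assumes nonflat: "0 < p \<Longrightarrow> \<exists>w. fx w p < fx w 0"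
begin

text \<open>Both inequalities are strict versions of \<open>f_ge_chord\<close> and \<open>f_le_tangent\<close>: the auxiliary
  functions are nondecreasing, and strictly increasing to the right of \<open>0\<close> or to the left of
  \<open>p\<close>, respectively.\<close>

lemma strict_chords:
  assumes p: "0 < p" and w: "fx w p < fx w 0" and x: "p \<le> x"
  shows "0 < f w x / x - fx w x" "0 < fx w 0 - f w x / x"
proof -
  have x0: "0 < x" using p x by simp
  have mono: "c s \<le> c t" if "0 \<le> s" "s \<le> t" "t \<le> x"
    and "\<And>q. (c has_real_derivative c' q) (at q)" "\<And>q. 0 \<le> q \<Longrightarrow> q \<le> x \<Longrightarrow> 0 \<le> c' q" for c c' :: "real \<Rightarrow> real" and s t
    using deriv_ge_imp_diff_ge[of s t c c' 0] that by simp
  define c where "c s = f w s - fx w x * s" for s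
  have dc: "(c has_real_derivative fx w s - fx w x) (at s)" for s
    unfolding c_def by (auto intro!: derivative_eq_intros deriv_f)
  have "fx w x \<le> fx w p" using p x by (intro antitone) auto
  then have "0 < fx w 0 - fx w x" using w by simp
  then obtain d where d: "d > 0" "\<forall>h>0. h < d \<longrightarrow> c 0 < c (0 + h)"
    using DERIV_pos_inc_right[OF dc[of 0]] by blast
  define h where "h = min (d / 2) x"
  have h: "0 < h" "h < d" "h \<le> x" using d x0 by (auto simp: h_def)
  have "0 < c h" using d(2) h by (auto simp: c_def)
  also have "c h \<le> c x"
    by (rule mono[OF _ _ _ dc]) (use h x0 in \<open>auto intro: antitone\<close>)
  finally show "0 < f w x / x - fx w x" using x0 by (simp add: c_def field_simps)
  define e where "e s = fx w 0 * s - f w s" for s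
  have de: "(e has_real_derivative fx w 0 - fx w s) (at s)" for s
    unfolding e_def by (auto intro!: derivative_eq_intros deriv_f)
  obtain d where d: "d > 0" "\<forall>h>0. h < d \<longrightarrow> e (p - h) < e p"
    using DERIV_pos_inc_left[OF de[of p]] w by auto
  define h where "h = min (d / 2) p"
  have h: "0 < h" "h < d" "h \<le> p" using d p by (auto simp: h_def)
  have "0 \<le> e (p - h)" using f_le_tangent[of "p - h" w] h by (simp add: e_def)
  also have "\<dots> < e p" using d(2) h by blast
  also have "e p \<le> e x"
    by (rule mono[OF _ _ _ de]) (use p x in \<open>auto intro: antitone\<close>)
  finally show "0 < fx w 0 - f w x / x" using x0 by (simp add: e_def field_simps)
qed

lemma continuous_chord: "0 < p \<Longrightarrow> continuous_on (UNIV \<times> {p..Q}) (\<lambda>q. f (fst q) (snd q) / snd q)"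
  by (intro continuous_intros) auto

lemma strict_rates:
  assumes p: "0 < p" "p \<le> Q"
  shows "\<exists>\<eta>>0. \<exists>U. open U \<and> U \<noteq> {} \<and>
    (\<forall>w\<in>U. \<forall>x\<in>{p..Q}. \<eta> \<le> f w x / x - fx w x)"
    and "\<exists>\<eta>>0. \<exists>U. open U \<and> U \<noteq> {} \<and>
    (\<forall>w\<in>U. \<forall>x\<in>{p..Q}. \<eta> \<le> fx w 0 - f w x / x)"
proof -
  obtain w0 where w0: "fx w0 p < fx w0 0" using nonflat[OF p(1)] by blast
  have "\<exists>\<eta>>0. \<exists>U. open U \<and> w0 \<in> U \<and> (\<forall>w\<in>U. \<forall>x\<in>{p..Q}. \<eta> \<le> f w x / x - fx w x)"
    by (rule positive_on_tube[OF compact_base p(2)])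
      (intro continuous_intros continuous_chord p(1), rule strict_chords(1)[OF p(1) w0])
  then show "\<exists>\<eta>>0. \<exists>U. open U \<and> U \<noteq> {} \<and> (\<forall>w\<in>U. \<forall>x\<in>{p..Q}. \<eta> \<le> f w x / x - fx w x)"
    by blast
  have "\<exists>\<eta>>0. \<exists>U. open U \<and> w0 \<in> U \<and> (\<forall>w\<in>U. \<forall>x\<in>{p..Q}. \<eta> \<le> fx w 0 - f w x / x)"
    by (rule positive_on_tube[OF compact_base p(2)])
      (intro continuous_intros continuous_chord p(1), rule strict_chords(2)[OF p(1) w0])
  then show "\<exists>\<eta>>0. \<exists>U. open U \<and> U \<noteq> {} \<and> (\<forall>w\<in>U. \<forall>x\<in>{p..Q}. \<eta> \<le> fx w 0 - f w x / x)"
    by blast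
qed

text \<open>The strict form of \<open>separated_imp_ge\<close>: the excess now grows linearly, so that the
  linearisation would have a dichotomy already at the parameter \<open>l\<close> itself.\<close>

lemma separated_imp_gt:
  assumes \<rho>: "0 < \<rho>" and sol: "\<And>w. \<exists>u. is_sol l w u UNIV \<and> (\<forall>t. \<rho> \<le> u t \<and> u t \<le> R)"
  shows "lp < l"
proof (rule ccontr)
  assume "\<not> lp < l"
  have "\<rho> \<le> R" using sol[of undefined] by (meson order_trans)
  obtain \<eta> U where U: "\<eta> > 0" "open U" "U \<noteq> {}" "\<forall>w\<in>U. \<forall>x\<in>{\<rho>..R}. \<eta> \<le> fx w 0 - f w x / x"
    using strict_rates(2)[OF \<rho> \<open>\<rho> \<le> R\<close>] by blast
  obtain u0 where "u0 \<in> U" using U(3) by blast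
  obtain \<gamma> C where g: "\<gamma> > 0" "growth_bound U \<eta> \<gamma> C"
    using linear_growth[OF U(2) \<open>u0 \<in> U\<close> U(1)] by blast
  have "I w t + lp * t \<le> (ln R - ln \<rho> + C) + \<gamma> * t" if t: "t \<le> 0" for w t
  proof -
    obtain u where u: "is_sol l w u UNIV" "\<And>t. \<rho> \<le> u t" "\<And>t. u t \<le> R" using sol by blast
    have pos: "0 < u t" for t using u(2)[of t] \<rho> by linarith
    have "\<gamma> * (0 - t) - C \<le> (I w 0 + l * 0 - ln (u 0)) - (I w t + l * t - ln (u t))"
    proof (rule growth_boundD[OF g(2) t excess_deriv[OF u(1) UNIV_I pos]])
      show "0 \<le> fx (\<sigma> q w) 0 - f (\<sigma> q w) (u q) / u q" for q by (rule excess_nonneg[OF pos])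
      show "\<eta> \<le> fx (\<sigma> q w) 0 - f (\<sigma> q w) (u q) / u q" if "\<sigma> q w \<in> U" for q
        using U(4) that u(2,3) by simp
    qed
    moreover have "ln (u t) \<le> ln R" "ln \<rho> \<le> ln (u 0)"
      using u pos \<rho> by (auto simp: ln_le_cancel_iff order_less_le_trans[OF pos])
    moreover have "lp * t \<le> l * t" using \<open>\<not> lp < l\<close> t by (intro mult_right_mono_neg) auto
    ultimately show ?thesis by (simp add: algebra_simps)
  qed
  then show False by (rule no_unstable_bound[OF g(1)])
qed

definition contracts :: "real \<Rightarrow> real \<Rightarrow> real \<Rightarrow> real \<Rightarrow> real \<Rightarrow> bool" where
  "contracts l p Q k \<gamma> \<longleftrightarrow> (\<forall>w u v t. 0 \<le> t \<and> is_sol l w u {0..t} \<and> is_sol l w v {0..t} \<and>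
     (\<forall>q\<in>{0..t}. p \<le> u q \<and> u q \<le> Q \<and> p \<le> v q \<and> v q \<le> Q) \<longrightarrow>
     \<bar>ln (v t) - ln (u t)\<bar> \<le> k * exp (- \<gamma> * t) * \<bar>ln (v 0) - ln (u 0)\<bar>)"

text \<open>The logarithmic gap \<open>D\<close> of two solutions satisfies \<open>D' \<le> - h D\<close> with \<open>h \<ge> 0\<close>, and \<open>h\<close> is
  bounded below while the base point is in the set where concavity is strict; so \<open>- ln D\<close> grows
  linearly.\<close>

lemma contraction:
  assumes p: "0 < p" "p \<le> Q"
  shows "\<exists>k\<ge>1. \<exists>\<gamma>>0. contracts l p Q k \<gamma>"
proof -
  obtain \<eta> U where U: "\<eta> > 0" "open U" "U \<noteq> {}" "\<forall>w\<in>U. \<forall>x\<in>{p..Q}. \<eta> \<le> f w x / x - fx w x"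
    using strict_rates(1)[OF p] by blast
  obtain u0 where "u0 \<in> U" using U(3) by blast
  obtain \<gamma> C where g: "\<gamma> > 0" "growth_bound U \<eta> \<gamma> C"
    using linear_growth[OF U(2) \<open>u0 \<in> U\<close> U(1)] by blast
  have main: "\<bar>ln (v t) - ln (u t)\<bar> \<le> exp \<bar>C\<bar> * exp (- \<gamma> * t) * \<bar>ln (v 0) - ln (u 0)\<bar>"
    if t: "0 \<le> t" and u: "is_sol l w u {0..t}" and v: "is_sol l w v {0..t}"
      and rng: "\<forall>q\<in>{0..t}. p \<le> u q \<and> u q \<le> Q \<and> p \<le> v q \<and> v q \<le> Q" and less: "u 0 < v 0" for w u v t
  proof -
    have uv: "0 < u q" "u q < v q" if q: "0 \<le> q" "q \<le> t" for q
      using rng q p(1) sol_less[OF sub_segment[OF u q] sub_segment[OF v q] less] by force+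
    define D where "D q = ln (v q) - ln (u q)" for q
    have D: "0 < D q" if "0 \<le> q" "q \<le> t" for q
      using uv[OF that] by (simp add: D_def)
    have "\<gamma> * (t - 0) - C \<le> - ln (D t) - - ln (D 0)"
    proof (rule growth_boundD[OF g(2) t])
      fix q assume q: "0 \<le> q" "q \<le> t"
      note uvq = uv[OF q]
      let ?d = "f (\<sigma> q w) (v q) / v q - f (\<sigma> q w) (u q) / u q"
      have "(D has_real_derivative ?d) (at q)"
        unfolding D_def by (rule ln_gap_deriv[OF u v]) (use q uvq in auto)
      then have "((\<lambda>q. ln (D q)) has_real_derivative inverse (D q) * ?d) (at q)"
        by (rule DERIV_ln[THEN DERIV_chain2, where g = D, OF D[OF q]])
      then show "((\<lambda>q. - ln (D q)) has_real_derivative - (inverse (D q) * ?d)) (at q)"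
        by (rule DERIV_minus)
      have rate: "m \<le> - (inverse (D q) * ?d)" if "\<And>z. u q \<le> z \<Longrightarrow> z \<le> v q \<Longrightarrow> m \<le> f (\<sigma> q w) z / z - fx (\<sigma> q w) z" for m
      proof -
        have "f (\<sigma> q w) (v q) / v q + m * (ln (v q) - ln (u q)) \<le> f (\<sigma> q w) (u q) / u q"
          by (rule chord_slope_decreasing) (use uvq that in auto)
        then have "m * D q \<le> - ?d" by (simp add: D_def)
        then have "m \<le> - ?d / D q" using D[OF q] by (simp only: pos_le_divide_eq)
        moreover have "- x / y = - (inverse y * x)" for x y :: real by (simp add: divide_inverse)
        ultimately show ?thesis by (simp only:)
      qed
      show "0 \<le> - (inverse (D q) * ?d)"
      proof (rule rate)
        show "0 \<le> f (\<sigma> q w) z / z - fx (\<sigma> q w) z" if "u q \<le> z" for z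
          by (rule chord_gap_nonneg) (use that uvq in linarith)
      qed
      show "\<eta> \<le> - (inverse (D q) * ?d)" if "\<sigma> q w \<in> U"
      proof (rule rate)
        fix z assume "u q \<le> z" "z \<le> v q"
        moreover have "p \<le> u q" "v q \<le> Q" using rng q by auto
        ultimately have "z \<in> {p..Q}" by simp
        then show "\<eta> \<le> f (\<sigma> q w) z / z - fx (\<sigma> q w) z" using U(4) that by blast
      qed
    qed
    then have "ln (D t) \<le> \<bar>C\<bar> + - \<gamma> * t + ln (D 0)" by simp
    then have "exp (ln (D t)) \<le> exp (\<bar>C\<bar> + - \<gamma> * t + ln (D 0))" by (simp only: exp_le_cancel_iff)
    then have "D t \<le> exp \<bar>C\<bar> * exp (- \<gamma> * t) * D 0"
      using D[of t] D[of 0] t by (simp only: exp_add exp_ln order_refl)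
    then show ?thesis using D[of t] D[of 0] t by (simp add: D_def)
  qed
  have "contracts l p Q (exp \<bar>C\<bar>) \<gamma>"
    unfolding contracts_def
  proof (intro allI impI, elim conjE)
    fix w u v and t :: real
    assume t: "0 \<le> t" and u: "is_sol l w u {0..t}" and v: "is_sol l w v {0..t}"
      and rng: "\<forall>q\<in>{0..t}. p \<le> u q \<and> u q \<le> Q \<and> p \<le> v q \<and> v q \<le> Q"
    consider "u 0 < v 0" | "v 0 < u 0" | "u 0 = v 0" by linarith
    then show "\<bar>ln (v t) - ln (u t)\<bar> \<le> exp \<bar>C\<bar> * exp (- \<gamma> * t) * \<bar>ln (v 0) - ln (u 0)\<bar>"
    proof cases
      case 1 then show ?thesis by (rule main[OF t u v rng])
    next
      case 2
      have "\<forall>q\<in>{0..t}. p \<le> v q \<and> v q \<le> Q \<and> p \<le> u q \<and> u q \<le> Q" using rng by blast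
      from main[OF t v u this 2] show ?thesis by (simp only: abs_minus_commute[of "ln (v _)"])
    next
      case 3
      then have "u t = v t"
        using sol_unique[OF sub_segment[OF u t] sub_segment[OF v t]] by simp
      then show ?thesis using 3 by simp
    qed
  qed
  then show ?thesis using g(1) by (intro exI[of _ "exp \<bar>C\<bar>"] exI[of _ \<gamma>] conjI) auto
qed

lemma contractsD:
  assumes "contracts l p Q k \<gamma>" "0 \<le> t" "is_sol l w u {0..t}" "is_sol l w v {0..t}"
    "\<And>q. 0 \<le> q \<Longrightarrow> q \<le> t \<Longrightarrow> p \<le> u q \<and> u q \<le> Q" "\<And>q. 0 \<le> q \<Longrightarrow> q \<le> t \<Longrightarrow> p \<le> v q \<and> v q \<le> Q"
  shows "\<bar>ln (v t) - ln (u t)\<bar> \<le> k * exp (- \<gamma> * t) * \<bar>ln (v 0) - ln (u 0)\<bar>"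
proof -
  have "\<forall>q\<in>{0..t}. p \<le> u q \<and> u q \<le> Q \<and> p \<le> v q \<and> v q \<le> Q" using assms(5,6) by simp
  then show ?thesis using assms(1-4) unfolding contracts_def by blast
qed

text \<open>Contraction from time \<open>- n\<close> to time \<open>0\<close>, where the initial gap is at most \<open>H\<close> for every
  \<open>n\<close>.\<close>

lemma separated_unique:
  assumes p: "0 < p" and u: "is_sol l w u UNIV" and v: "is_sol l w v UNIV"
    and ru: "\<And>t. p \<le> u t \<and> u t \<le> Q" and rv: "\<And>t. p \<le> v t \<and> v t \<le> Q"
  shows "u 0 = v 0"
proof -
  have pQ: "p \<le> Q" using ru[of 0] by linarith
  obtain k \<gamma> where k: "k \<ge> 1" "\<gamma> > 0" "contracts l p Q k \<gamma>" using contraction[OF p pQ] by blast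
  define H where "H = ln Q - ln p"
  have *: "\<bar>ln (v 0) - ln (u 0)\<bar> \<le> k * exp (- \<gamma> * real n) * H" for n
  proof -
    let ?s = "real n"
    have "\<bar>ln (v (?s + - ?s)) - ln (u (?s + - ?s))\<bar> \<le> k * exp (- \<gamma> * ?s) * \<bar>ln (v (0 + - ?s)) - ln (u (0 + - ?s))\<bar>"
      by (rule contractsD[OF k(3), of ?s "\<sigma> (- ?s) w" "\<lambda>t. u (t + - ?s)" "\<lambda>t. v (t + - ?s)"])
        (simp_all only: of_nat_0_le_iff ru rv is_sol_subset[OF is_sol_shift_UNIV[OF u] subset_UNIV]
           is_sol_subset[OF is_sol_shift_UNIV[OF v] subset_UNIV] simp_thms)
    also have "\<dots> \<le> k * exp (- \<gamma> * ?s) * H"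
    proof (rule mult_left_mono)
      have b: "ln p \<le> ln (u (- ?s))" "ln (u (- ?s)) \<le> ln Q" "ln p \<le> ln (v (- ?s))" "ln (v (- ?s)) \<le> ln Q"
        using ru[of "- ?s"] rv[of "- ?s"] p by (simp_all add: ln_mono)
      then show "\<bar>ln (v (0 + - ?s)) - ln (u (0 + - ?s))\<bar> \<le> H"
        unfolding H_def by (simp add: abs_le_iff)
    qed (use k in simp)
    finally show ?thesis by simp
  qed
  have "(\<lambda>n. exp (- \<gamma> * real n)) \<longlonglongrightarrow> 0"
  proof -
    have "(\<lambda>n. exp (- \<gamma>) ^ n) \<longlonglongrightarrow> 0" using k(2) by (intro LIMSEQ_realpow_zero) auto
    then show ?thesis by (simp add: exp_of_nat_mult[symmetric] mult.commute)
  qed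
  then have "(\<lambda>n. k * exp (- \<gamma> * real n) * H) \<longlonglongrightarrow> k * 0 * H" by (intro tendsto_intros)
  then have "\<bar>ln (v 0) - ln (u 0)\<bar> \<le> k * 0 * H"
    by (rule LIMSEQ_le_const) (use * in blast)
  then have "ln (v 0) = ln (u 0)" by simp
  then show ?thesis using ru[of 0] rv[of 0] p by simp
qed

lemma \<beta>_separated:
  assumes l: "lp < l"
  shows "\<exists>\<rho>>0. \<exists>R. \<forall>w. \<rho> \<le> \<beta> l w \<and> \<beta> l w \<le> R"
proof -
  obtain c k \<gamma> where c: "c > 0" "k \<ge> (1::real)" "\<gamma> > (0::real)" "\<And>w. c \<le> \<beta> l w"
    by (rule above_threshold[OF l]) (erule that)
  obtain R where R: "R > 0" "\<And>w. \<beta> l w \<le> R" by (rule \<beta>_bound[of l]) (rule that)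
  show ?thesis using c(1,4) R(2) by blast
qed

text \<open>A limit of points on the graph lies in the attractor, and its complete orbit is again separated
  from zero by continuous dependence; uniqueness puts it on the graph.\<close>

lemma \<beta>_continuous:
  assumes l: "lp < l" shows "continuous_on UNIV (\<beta> l)"
proof -
  obtain \<rho> R where \<rho>: "\<rho> > 0" and rng: "\<And>w. \<rho> \<le> \<beta> l w \<and> \<beta> l w \<le> R"
    using \<beta>_separated[OF l] by blast
  obtain B where B: "B > 0" "\<And>w x. (w, x) \<in> A l \<Longrightarrow> \<bar>x\<bar> \<le> B" by (rule A_bound[of l]) (rule that)
  have closed_graph: "x = \<beta> l w"
    if lim: "W \<longlonglongrightarrow> w" "(\<lambda>n. \<beta> l (W n)) \<longlonglongrightarrow> x" for W w x
  proof -
    have "(\<lambda>n. (W n, \<beta> l (W n))) \<longlonglongrightarrow> (w, x)" using lim by (intro tendsto_Pair)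
    then have "(w, x) \<in> A l"
      by (rule closed_sequentially[OF compact_imp_closed[OF compact_A] \<beta>_in_A])
    then obtain u where u: "is_sol l w u UNIV" "u 0 = x" "\<And>t. (\<sigma> t w, u t) \<in> A l"
      by (rule A_sol) (rule that)
    have "\<rho> \<le> u t \<and> u t \<le> R" for t
    proof -
      have "(\<lambda>n. \<beta> l (\<sigma> t (W n))) \<longlonglongrightarrow> u t"
      proof (rule sol_limit[of "\<lambda>_. l" W "\<lambda>n t. \<beta> l (\<sigma> t (W n))" t l w u R])
        show "is_sol l (W n) (\<lambda>t. \<beta> l (\<sigma> t (W n))) (closed_segment 0 t)" for n
          by (rule is_sol_subset[OF \<beta>_sol subset_UNIV])
        show "is_sol l w u (closed_segment 0 t)" by (rule is_sol_subset[OF u(1) subset_UNIV])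
        show "\<bar>\<beta> l (\<sigma> s (W n))\<bar> \<le> R" for n s
          using rng[of "\<sigma> s (W n)"] \<rho> by simp
      qed (use lim u in simp_all)
      note lim_t = this
      have "\<rho> \<le> u t" by (rule LIMSEQ_le_const[OF lim_t]) (use rng in blast)
      moreover have "u t \<le> R" by (rule LIMSEQ_le_const2[OF lim_t]) (use rng in blast)
      ultimately show ?thesis ..
    qed
    then have "u 0 = \<beta> l (\<sigma> 0 w)"
      by (intro separated_unique[OF \<rho> u(1) \<beta>_sol]) (use rng in auto)
    then show ?thesis using u(2) by simp
  qed
  show ?thesis
    by (rule continuous_on_closed_graphI[OF compact_base compact_Icc[of \<rho> R] _ closed_graph])
      (use rng in simp)
qed

end

context strict_half_line
begin

text \<open>A solution within \<open>\<rho> / 2\<close> of \<open>\<beta> l\<close> starts at logarithmic distance at most \<open>1\<close>, and this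
  distance does not increase, so the solution stays between \<open>\<rho> / 3\<close> and \<open>3 * R\<close> because
  \<open>exp 1 \<le> 3\<close>. There the logarithmic contraction is uniform and logarithmic distances are
  comparable with distances.\<close>

theorem \<beta>_exponentially_stable:
  assumes l: "lp < l"
  shows "\<exists>\<delta>>0. \<exists>k\<ge>1. \<exists>\<gamma>>0. \<forall>w y. \<bar>y - \<beta> l w\<bar> < \<delta> \<longrightarrow>
    (\<forall>t\<ge>0. \<bar>sol \<sigma> (F l) t w y - \<beta> l (\<sigma> t w)\<bar> \<le> k * exp (- \<gamma> * t) * \<bar>y - \<beta> l w\<bar>)"
proof -
  obtain \<rho> R where \<rho>: "\<rho> > 0" and rng: "\<And>w. \<rho> \<le> \<beta> l w \<and> \<beta> l w \<le> R"
    using \<beta>_separated[OF l] by blast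
  have R: "\<rho> \<le> R" using rng[of undefined] by linarith
  have pQ: "0 < \<rho> / 3" "\<rho> / 3 \<le> 3 * R" using \<rho> R by auto
  obtain k \<gamma> where k: "k \<ge> 1" "\<gamma> > 0" "contracts l (\<rho> / 3) (3 * R) k \<gamma>"
    using contraction[OF pQ] by blast
  \<comment> \<open>\<open>2 / \<rho>\<close> and \<open>3 * R\<close> convert distances into logarithmic ones and back\<close>
  define k' where "k' = 6 * R / \<rho> * k"
  have "1 \<le> k'"
  proof -
    have "1 * 1 \<le> 6 * R / \<rho> * k" using k R \<rho> by (intro mult_mono) auto
    then show ?thesis by (simp add: k'_def)
  qed
  have main: "\<bar>sol \<sigma> (F l) t w y - \<beta> l (\<sigma> t w)\<bar> \<le> k' * exp (- \<gamma> * t) * \<bar>y - \<beta> l w\<bar>"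
    if y: "\<bar>y - \<beta> l w\<bar> < \<rho> / 2" and t: "0 \<le> t" for w y t
  proof -
    define u where "u t = \<beta> l (\<sigma> t w)" for t
    define v where "v t = sol \<sigma> (F l) t w y" for t
    have u: "is_sol l w u {0..q}" for q
      unfolding u_def by (rule is_sol_subset[OF \<beta>_sol subset_UNIV])
    have v: "is_sol l w v {0..q}" for q
      unfolding v_def by (rule is_sol_subset[OF forward_sol(1)]) auto
    have u0: "u 0 = \<beta> l w" and v0: "v 0 = y" by (simp_all add: u_def v_def forward_sol)
    have ru: "\<rho> \<le> u q" "u q \<le> R" for q using rng[of "\<sigma> q w"] by (auto simp: u_def)
    have y': "\<rho> / 2 \<le> v 0" using y ru(1)[of 0] unfolding v0 u0 by linarith
    have pos: "0 < u 0" "0 < v 0" using y' ru[of 0] \<rho> by linarith+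
    have start: "\<bar>ln (v 0) - ln (u 0)\<bar> \<le> 2 / \<rho> * \<bar>y - \<beta> l w\<bar>"
    proof -
      have "\<bar>ln (v 0) - ln (u 0)\<bar> \<le> \<bar>v 0 - u 0\<bar> / (\<rho> / 2)"
        using y' ru[of 0] \<rho> by (intro ln_diff_le) auto
      then show ?thesis by (simp add: v0 u0 mult.commute)
    qed
    also have start1: "\<dots> \<le> 1" using y \<rho> by (simp add: field_simps)
    finally have le1: "\<bar>ln (v 0) - ln (u 0)\<bar> \<le> 1" .
    have rv: "0 < v q \<and> \<rho> / 3 \<le> v q \<and> v q \<le> 3 * R" if q: "0 \<le> q" for q
    proof -
      have vq: "0 < v q" by (rule sol_positive[OF sub_segment[OF v q order_refl] pos(2)])
      have uq: "0 < u q" using ru[of q] \<rho> by linarith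
      have "\<bar>ln (v q) - ln (u q)\<bar> \<le> 1"
        using ln_gap_nonincreasing[OF q u v pos] le1 by linarith
      then have "ln (v q) \<le> 1 + ln (u q)" "ln (u q) \<le> 1 + ln (v q)" by linarith+
      then have "exp (ln (v q)) \<le> exp (1 + ln (u q))" "exp (ln (u q)) \<le> exp (1 + ln (v q))"
        by (simp_all only: exp_le_cancel_iff)
      then have *: "v q \<le> exp 1 * u q" "u q \<le> exp 1 * v q" using vq uq by (simp_all add: exp_add)
      have e3: "exp 1 * z \<le> 3 * z" if "0 < z" for z :: real
        using exp_le that by (intro mult_right_mono) auto
      show ?thesis using * e3[OF vq] e3[OF uq] ru[of q] vq by linarith
    qed
    have rq: "\<rho> / 3 \<le> u q \<and> u q \<le> 3 * R" for q using ru[of q] \<rho> R by linarith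
    have "\<bar>ln (v t) - ln (u t)\<bar> \<le> k * exp (- \<gamma> * t) * \<bar>ln (v 0) - ln (u 0)\<bar>"
      by (rule contractsD[OF k(3) t u v]) (use rq rv in auto)
    also have "\<dots> \<le> k * exp (- \<gamma> * t) * (2 / \<rho> * \<bar>y - \<beta> l w\<bar>)"
      using start k by (intro mult_left_mono) auto
    finally have gap: "\<bar>ln (v t) - ln (u t)\<bar> \<le> k * exp (- \<gamma> * t) * (2 / \<rho> * \<bar>y - \<beta> l w\<bar>)" .
    have "\<bar>v t - u t\<bar> \<le> 3 * R * \<bar>ln (v t) - ln (u t)\<bar>"
    proof (rule diff_le_ln_diff)
      show "0 < u t" using ru[of t] \<rho> by linarith
    qed (use rv[OF t] rq[of t] in auto)
    also have "\<dots> \<le> 3 * R * (k * exp (- \<gamma> * t) * (2 / \<rho> * \<bar>y - \<beta> l w\<bar>))"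
      using gap \<rho> R by (intro mult_left_mono) auto
    also have "\<dots> = k' * exp (- \<gamma> * t) * \<bar>y - \<beta> l w\<bar>" by (simp add: k'_def)
    finally show ?thesis by (simp add: u_def v_def)
  qed
  show ?thesis
    by (intro exI[of _ "\<rho> / 2"] exI[of _ k'] exI[of _ \<gamma>] conjI allI impI main)
      (use \<rho> \<open>1 \<le> k'\<close> k in auto)
qed

text \<open>At a maximum of \<open>ln (\<beta> l w) - ln (\<beta> l' w)\<close> over the base the derivative along the flow
  vanishes, which is impossible where the maximum is positive and \<open>l < l'\<close>.\<close>

lemma \<beta>_mono:
  assumes l: "lp < l" "l \<le> l'"
  shows "\<beta> l w \<le> \<beta> l' w"
proof (rule ccontr)
  assume contra: "\<not> \<beta> l w \<le> \<beta> l' w"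
  then have ll: "l < l'" using l by (cases "l = l'") auto
  have l': "lp < l'" using l by simp
  have pos: "0 < \<beta> l v" "0 < \<beta> l' v" for v
    using \<beta>_separated[OF l(1)] \<beta>_separated[OF l'] by (meson order_less_le_trans)+
  define D where "D v = ln (\<beta> l v) - ln (\<beta> l' v)" for v
  have "continuous_on UNIV D"
    unfolding D_def using pos
    by (intro continuous_intros \<beta>_continuous l l') (auto simp: less_imp_neq[symmetric])
  then have "\<exists>v0\<in>UNIV. \<forall>v\<in>UNIV. D v \<le> D v0"
    by (intro continuous_attains_sup compact_base) auto
  then obtain v0 where v0: "\<And>v. D v \<le> D v0" by blast
  have "D w > 0" using contra pos by (simp add: D_def)
  then have "D v0 > 0" using v0[of w] by linarith
  then have less: "\<beta> l' v0 < \<beta> l v0" using pos by (simp add: D_def)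
  have "((\<lambda>t. D (\<sigma> t v0)) has_real_derivative
      (f (\<sigma> 0 v0) (\<beta> l (\<sigma> 0 v0)) / \<beta> l (\<sigma> 0 v0) + l) - (f (\<sigma> 0 v0) (\<beta> l' (\<sigma> 0 v0)) / \<beta> l' (\<sigma> 0 v0) + l')) (at 0)"
    unfolding D_def
    by (intro DERIV_diff ln_sol_deriv[OF \<beta>_sol UNIV_I] pos)
  then have "(f (\<sigma> 0 v0) (\<beta> l (\<sigma> 0 v0)) / \<beta> l (\<sigma> 0 v0) + l) - (f (\<sigma> 0 v0) (\<beta> l' (\<sigma> 0 v0)) / \<beta> l' (\<sigma> 0 v0) + l') = 0"
    by (rule DERIV_local_max[of _ _ _ 1]) (use v0 in auto)
  moreover have "f v0 (\<beta> l v0) / \<beta> l v0 + 0 * (ln (\<beta> l v0) - ln (\<beta> l' v0)) \<le> f v0 (\<beta> l' v0) / \<beta> l' v0"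
  proof (rule chord_slope_decreasing)
    show "0 \<le> f v0 z / z - fx v0 z" if "\<beta> l' v0 \<le> z" for z
      by (rule chord_gap_nonneg) (use that pos(2)[of v0] in linarith)
  qed (use pos less in auto)
  ultimately show False using ll by simp
qed

definition \<beta>_limit :: "'w \<Rightarrow> real" where
  "\<beta>_limit w = (INF l\<in>{lp<..}. \<beta> l w)"

lemma \<beta>_bdd_below: "bdd_below ((\<lambda>l. \<beta> l w) ` {lp<..})"
  using \<beta>_ge_0 by (intro bdd_belowI2[of _ 0]) auto

lemma \<beta>_limit_le: "lp < l \<Longrightarrow> \<beta>_limit w \<le> \<beta> l w"
  unfolding \<beta>_limit_def by (intro cINF_lower \<beta>_bdd_below) simp

lemma \<beta>_limit_nonneg: "0 \<le> \<beta>_limit w"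
  unfolding \<beta>_limit_def by (intro cINF_greatest) (auto simp: \<beta>_ge_0)

lemma \<beta>_limit_less_iff: "\<beta>_limit w < c \<longleftrightarrow> (\<exists>l>lp. \<beta> l w < c)"
proof -
  have "{lp<..} \<noteq> {}" by simp
  then show ?thesis
    unfolding \<beta>_limit_def by (subst cINF_less_iff[OF _ \<beta>_bdd_below]) auto
qed

lemma \<beta>_tendsto_limit: "((\<lambda>l. \<beta> l w) \<longlongrightarrow> \<beta>_limit w) (at_right lp)"
proof (rule order_tendstoI)
  fix c assume "c < \<beta>_limit w"
  then have "c < \<beta> l w" if "lp < l" for l using \<beta>_limit_le[OF that, of w] by linarith
  then show "eventually (\<lambda>l. c < \<beta> l w) (at_right lp)"
    by (auto simp: eventually_at_right_field intro: exI[of _ "lp + 1"])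
next
  fix c assume "\<beta>_limit w < c"
  then obtain l0 where l0: "lp < l0" "\<beta> l0 w < c" by (auto simp: \<beta>_limit_less_iff)
  have "\<beta> l w < c" if "lp < l" "l < l0" for l
    using \<beta>_mono[of l l0 w] that l0 by linarith
  then show "eventually (\<lambda>l. \<beta> l w < c) (at_right lp)"
    using l0(1) by (auto simp: eventually_at_right_field)
qed

text \<open>By continuous dependence on the parameter the limit agrees, from any starting time on, with the
  solution at \<open>lp\<close>. Starting one unit of time earlier gives the two-sided derivative.\<close>

lemma \<beta>_limit_sol: "is_sol lp w (\<lambda>t. \<beta>_limit (\<sigma> t w)) UNIV"
proof -
  define l where "l n = lp + inverse (real (Suc n))" for n
  have l: "lp < l n" "l n \<le> lp + 1" for n by (auto simp: l_def inverse_le_1_iff)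
  have l_lim: "l \<longlonglongrightarrow> lp"
    unfolding l_def using tendsto_add[OF tendsto_const LIMSEQ_inverse_real_of_nat, of lp] by simp
  have \<beta>_lim: "(\<lambda>n. \<beta> (l n) v) \<longlonglongrightarrow> \<beta>_limit v" for v
  proof (rule filterlim_compose[OF \<beta>_tendsto_limit])
    have "l n \<noteq> lp" for n using l(1)[of n] by simp
    then show "filterlim l (at_right lp) sequentially"
      using l_lim l(1) by (simp add: filterlim_at)
  qed
  obtain R where R: "R > 0" "\<And>v. \<beta> (lp + 1) v \<le> R" by (rule \<beta>_bound[of "lp + 1"]) (rule that)
  have bd: "\<bar>\<beta> (l n) v\<bar> \<le> R" for n v
    using \<beta>_mono[OF l, of n v] R(2)[of v] \<beta>_ge_0[of "l n" v] by linarith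
  have forward: "\<beta>_limit (\<sigma> t v) = sol \<sigma> (F lp) t v (\<beta>_limit v)" if t: "0 \<le> t" for t v
  proof -
    let ?s = "\<lambda>t. sol \<sigma> (F lp) t v (\<beta>_limit v)"
    have "(\<lambda>n. \<beta> (l n) (\<sigma> t v)) \<longlonglongrightarrow> ?s t"
    proof (rule sol_limit[of l "\<lambda>_. v" "\<lambda>n t. \<beta> (l n) (\<sigma> t v)" t lp v ?s R])
      show "is_sol (l n) v (\<lambda>t. \<beta> (l n) (\<sigma> t v)) (closed_segment 0 t)" for n
        by (rule is_sol_subset[OF \<beta>_sol subset_UNIV])
      show "is_sol lp v ?s (closed_segment 0 t)"
        by (rule is_sol_subset[OF forward_sol(1)]) (use t in \<open>auto simp: closed_segment_eq_real_ivl\<close>)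
      show "(\<lambda>n. \<beta> (l n) (\<sigma> 0 v)) \<longlonglongrightarrow> ?s 0"
        using \<beta>_lim[of v] by (simp add: forward_sol)
    qed (use bd l_lim in simp_all)
    then show ?thesis using \<beta>_lim[of "\<sigma> t v"] LIMSEQ_unique by blast
  qed
  show ?thesis
    unfolding is_sol_def
  proof
    fix t
    define v where "v = \<sigma> (t - 1) w"
    let ?s = "\<lambda>t. sol \<sigma> (F lp) t v (\<beta>_limit v)"
    have at1: "\<sigma> 1 v = \<sigma> t w" by (simp add: v_def flow_add)
    have "(?s has_real_derivative f (\<sigma> 1 v) (?s 1) + lp * ?s 1) (at 1)"
      by (rule is_solD[OF forward_sol(1)]) simp
    then have "((\<lambda>t. \<beta>_limit (\<sigma> t v)) has_real_derivative f (\<sigma> 1 v) (?s 1) + lp * ?s 1) (at 1)"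
      by (rule has_field_derivative_transform_within_open[of _ _ _ "{0<..}"]) (auto simp: forward)
    then have "((\<lambda>t. \<beta>_limit (\<sigma> t v)) has_real_derivative f (\<sigma> t w) (\<beta>_limit (\<sigma> t w)) + lp * \<beta>_limit (\<sigma> t w)) (at (t + (1 - t)))"
      using forward[of 1 v] at1 by simp
    then have "((\<lambda>s. \<beta>_limit (\<sigma> (s + (1 - t)) v)) has_real_derivative f (\<sigma> t w) (\<beta>_limit (\<sigma> t w)) + lp * \<beta>_limit (\<sigma> t w)) (at t)"
      by (simp only: DERIV_shift)
    then show "((\<lambda>t. \<beta>_limit (\<sigma> t w)) has_real_derivative f (\<sigma> t w) (\<beta>_limit (\<sigma> t w)) + lp * \<beta>_limit (\<sigma> t w)) (at t)"
      by (simp add: v_def flow_add)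
  qed
qed

lemma \<beta>_limit_bounded: obtains R where "\<And>w. \<beta>_limit w \<le> R"
proof -
  obtain R where R: "R > 0" "\<And>v. \<beta> (lp + 1) v \<le> R" by (rule \<beta>_bound[of "lp + 1"]) (rule that)
  have "\<beta>_limit w \<le> R" for w using \<beta>_limit_le[of "lp + 1" w] R(2)[of w] by simp
  then show ?thesis by (rule that)
qed

text \<open>The limit is an infimum of continuous functions, so the sets \<open>G n\<close> where it is small are open.
  They are dense: on an open set avoiding \<open>G n\<close> the limit would be bounded away from zero, hence
  it would be so everywhere, which is impossible at the parameter \<open>lp\<close>.\<close>

theorem \<beta>_collides: "collides_with_zero \<sigma> \<beta> (at_right lp)"
proof -
  define Z where "Z = {w. \<beta>_limit w = 0}"
  define G where "G n = {w. \<beta>_limit w < inverse (real (Suc n))}" for n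
  obtain R where R: "\<And>w. \<beta>_limit w \<le> R" by (rule \<beta>_limit_bounded) (rule that)
  have "open (G n)" for n
  proof -
    have "G n = (\<Union>l\<in>{lp<..}. {w. \<beta> l w < inverse (real (Suc n))})"
      by (auto simp: G_def \<beta>_limit_less_iff)
    moreover have "open {w. \<beta> l w < inverse (real (Suc n))}" if "lp < l" for l
      by (intro open_Collect_less continuous_on_const \<beta>_continuous[OF that])
    ultimately show ?thesis by auto
  qed
  moreover have "closure (G n) = UNIV" for n
  proof (rule ccontr)
    assume "closure (G n) \<noteq> UNIV"
    then have U: "open (- closure (G n))" "- closure (G n) \<noteq> {}" by auto
    have "inverse (real (Suc n)) \<le> \<beta>_limit w" if "w \<in> - closure (G n)" for w
    proof -
      have "w \<notin> G n" using that closure_subset[of "G n"] by blast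
      then show ?thesis by (simp add: G_def)
    qed
    then obtain \<rho> where \<rho>: "\<rho> > 0" "\<And>w. \<rho> \<le> \<beta>_limit w"
      using equilibrium_lower_bound[OF U _ \<beta>_limit_sol \<beta>_limit_nonneg R, of "inverse (real (Suc n))"] by auto
    have "lp < lp"
      by (rule separated_imp_gt[OF \<rho>(1), of lp R]) (use \<beta>_limit_sol \<rho>(2) R in blast)
    then show False by simp
  qed
  moreover have "(\<Inter>n. G n) \<subseteq> Z"
  proof
    fix w assume w: "w \<in> (\<Inter>n. G n)"
    have "\<beta>_limit w \<le> 0"
    proof (rule LIMSEQ_le_const[OF LIMSEQ_inverse_real_of_nat])
      show "\<exists>N. \<forall>n\<ge>N. \<beta>_limit w \<le> inverse (real (Suc n))"
        using w by (auto simp: G_def intro: less_imp_le)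
    qed
    then show "w \<in> Z" using \<beta>_limit_nonneg[of w] by (simp add: Z_def)
  qed
  ultimately have "residual_set Z" unfolding residual_set_def by blast
  moreover have "flow_invariant \<sigma> Z"
  proof -
    have inv: "\<sigma> t w \<in> Z" if "w \<in> Z" for t w
    proof -
      have "(\<lambda>t. \<beta>_limit (\<sigma> t w)) = (\<lambda>_. 0)"
        by (rule sol_unique_UNIV[OF \<beta>_limit_sol is_sol_zero, where s = 0])
          (use that in \<open>simp add: Z_def\<close>)
      then show ?thesis by (simp add: Z_def fun_eq_iff)
    qed
    have "w \<in> \<sigma> t ` Z" if "w \<in> Z" for t w
      by (rule image_eqI[of _ _ "\<sigma> (- t) w"]) (use inv[OF that] in \<open>simp_all add: flow_add\<close>)
    then show ?thesis unfolding flow_invariant_def using inv by blast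
  qed
  moreover have "\<forall>w\<in>Z. \<beta>_limit w = 0" by (simp add: Z_def)
  ultimately show ?thesis
    unfolding collides_with_zero_def using \<beta>_tendsto_limit by blast
qed

end

section \<open>Minimal sets and hyperbolicity\<close>

context ode_family
begin

text \<open>The complement of the projection is open and would be visited by every orbit.\<close>

lemma invariant_projection:
  assumes K: "K \<noteq> {}" "compact K" "skew_invariant \<sigma> (F l) K"
  shows "fst ` K = UNIV"
proof (rule ccontr)
  assume "fst ` K \<noteq> UNIV"
  then have "- (fst ` K) \<noteq> {}" by blast
  moreover have "open (- (fst ` K))"
    by (intro open_Compl compact_imp_closed compact_continuous_image continuous_intros K)
  moreover obtain w x where p: "(w, x) \<in> K" using K(1) by auto
  ultimately obtain t where t: "\<sigma> t w \<in> - (fst ` K)" using visit by blast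
  obtain u where "\<And>t. (\<sigma> t w, u t) \<in> K" using skew_invariantE[OF K(3) p] by metis
  then have "\<sigma> t w \<in> fst ` K" by (metis fst_conv imageI)
  then show False using t by simp
qed

text \<open>The graph of a continuous equilibrium is minimal because it projects homeomorphically onto
  the minimal base.\<close>

lemma minimal_graph:
  assumes cont: "continuous_on UNIV e" and sol: "\<And>w. is_sol l w (\<lambda>t. e (\<sigma> t w)) UNIV"
  shows "minimal_set \<sigma> (F l) (graph_of e)"
  unfolding minimal_set_def
proof (intro conjI allI impI)
  show "graph_of e \<noteq> {}" by (simp add: graph_of_def)
  show "compact (graph_of e)"
    unfolding graph_of_def by (intro compact_continuous_image continuous_intros cont compact_base)
  show "skew_invariant \<sigma> (F l) (graph_of e)"
  proof (rule skew_invariantI)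
    fix w x assume "(w, x) \<in> graph_of e"
    then show "\<exists>u. is_sol l w u UNIV \<and> u 0 = x \<and> (\<forall>t. (\<sigma> t w, u t) \<in> graph_of e)"
      using sol[of w] by (intro exI[of _ "\<lambda>t. e (\<sigma> t w)"]) (auto simp: graph_of_def)
  qed
next
  fix K assume K: "K \<noteq> {} \<and> compact K \<and> skew_invariant \<sigma> (F l) K"
  show "\<not> K \<subset> graph_of e"
  proof
    assume sub: "K \<subset> graph_of e"
    have "fst ` K = UNIV" using K by (intro invariant_projection) auto
    have "graph_of e \<subseteq> K"
    proof
      fix p assume "p \<in> graph_of e"
      then obtain w where p: "p = (w, e w)" by (auto simp: graph_of_def)
      obtain x where "(w, x) \<in> K" using \<open>fst ` K = UNIV\<close> by (metis UNIV_I imageE prod.collapse)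
      then show "p \<in> K" using sub p by (auto simp: graph_of_def)
    qed
    then show False using sub by blast
  qed
qed

lemma zero_section_graph: "zero_section = graph_of (\<lambda>_. 0)"
  by (auto simp: zero_section_def graph_of_def)

lemma minimal_zero: "minimal_set \<sigma> (F l) zero_section"
  unfolding zero_section_graph by (rule minimal_graph) (auto simp: is_sol_zero)

text \<open>The points with nonnegative second coordinate form a compact invariant set because solutions
  keep their sign; by compactness it lies between two positive heights, and it projects onto the
  whole base.\<close>

lemma positive_part_separated:
  assumes M: "compact M" "skew_invariant \<sigma> (F l) M" and p: "(w0, x0) \<in> M" "0 < x0"
    and nz: "\<And>w. (w, 0) \<notin> M"
  shows "\<exists>\<rho>>0. \<exists>R. \<forall>w. \<exists>u. is_sol l w u UNIV \<and> (\<forall>t. \<rho> \<le> u t \<and> u t \<le> R)"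
proof -
  define K where "K = M \<inter> (UNIV \<times> {0..})"
  have K: "compact K" unfolding K_def by (intro compact_Int_closed M closed_Times) auto
  have "(w0, x0) \<in> K" using p by (simp add: K_def)
  then have ne: "K \<noteq> {}" by blast
  have pos: "0 < x" if "(w, x) \<in> K" for w x
    using that nz[of w] by (cases "x = 0") (auto simp: K_def)
  have inv: "\<exists>u. is_sol l w u UNIV \<and> u 0 = x \<and> (\<forall>t. (\<sigma> t w, u t) \<in> K)" if "(w, x) \<in> K" for w x
  proof -
    have "(w, x) \<in> M" using that by (simp add: K_def)
    then obtain u where u: "is_sol l w u UNIV" "u 0 = x" "\<And>t. (\<sigma> t w, u t) \<in> M"
      using skew_invariantE[OF M(2)] by metis
    have "0 < u t" for t
      using sol_positive[OF is_sol_subset[OF u(1) subset_UNIV]] u(2) pos[OF that] by simp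
    then show ?thesis using u by (auto simp: K_def less_imp_le)
  qed
  have "fst ` K = UNIV"
    by (rule invariant_projection[OF ne K skew_invariantI[OF inv]])
  have cK: "compact (snd ` K)" by (intro compact_continuous_image continuous_intros K)
  moreover have "snd ` K \<noteq> {}" using ne by simp
  ultimately obtain \<rho> where \<rho>: "\<rho> \<in> snd ` K" "\<forall>x\<in>snd ` K. \<rho> \<le> x"
    using compact_attains_inf by metis
  obtain R where R: "\<forall>x\<in>snd ` K. x \<le> R"
    using compact_attains_sup[OF cK \<open>snd ` K \<noteq> {}\<close>] by blast
  have "\<rho> > 0" using \<rho>(1) pos by auto
  moreover have "\<exists>u. is_sol l w u UNIV \<and> (\<forall>t. \<rho> \<le> u t \<and> u t \<le> R)" for w
  proof -
    obtain x where "(w, x) \<in> K" using \<open>fst ` K = UNIV\<close> by (metis UNIV_I imageE prod.collapse)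
    then obtain u where u: "is_sol l w u UNIV" "\<And>t. (\<sigma> t w, u t) \<in> K" using inv by blast
    have "u t \<in> snd ` K" for t using u(2)[of t] by force
    then show ?thesis using u(1) \<rho>(2) R by blast
  qed
  ultimately show ?thesis by blast
qed

text \<open>Otherwise the intersection with the zero section would be a smaller compact invariant set.\<close>

lemma minimal_without_zero:
  assumes M: "minimal_set \<sigma> (F l) M" and ne: "M \<noteq> zero_section"
  shows "(w, 0) \<notin> M"
proof
  assume p: "(w, 0) \<in> M"
  have Mc: "compact M" "skew_invariant \<sigma> (F l) M"
    and Mm: "\<And>K. K \<noteq> {} \<Longrightarrow> compact K \<Longrightarrow> skew_invariant \<sigma> (F l) K \<Longrightarrow> \<not> K \<subset> M"
    using M by (auto simp: minimal_set_def)
  have "compact (M \<inter> zero_section)"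
    unfolding zero_section_def by (intro compact_Int_closed Mc closed_Times) auto
  moreover have "skew_invariant \<sigma> (F l) (M \<inter> zero_section)"
  proof (rule skew_invariantI)
    fix v x assume v: "(v, x) \<in> M \<inter> zero_section"
    then obtain u where u: "is_sol l v u UNIV" "u 0 = x" "\<And>t. (\<sigma> t v, u t) \<in> M"
      using skew_invariantE[OF Mc(2)] by (metis IntD1)
    have "u = (\<lambda>_. 0)"
      by (rule sol_unique_UNIV[OF u(1) is_sol_zero, where s = 0]) (use u v in \<open>simp add: zero_section_def\<close>)
    then show "\<exists>u. is_sol l v u UNIV \<and> u 0 = x \<and> (\<forall>t. (\<sigma> t v, u t) \<in> M \<inter> zero_section)"
      using u by (intro exI[of _ u]) (auto simp: zero_section_def)
  qed
  moreover have "M \<inter> zero_section \<noteq> {}" using p by (auto simp: zero_section_def)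
  ultimately have "\<not> M \<inter> zero_section \<subset> M" by (intro Mm)
  then have "M \<subseteq> zero_section" by blast
  moreover have "\<not> M \<subset> zero_section"
    using minimal_zero[of l] M by (auto simp: minimal_set_def)
  ultimately show False using ne by blast
qed

end

section \<open>Reflection in the zero section\<close>

text \<open>The equation satisfied by \<open>- u\<close> when \<open>u\<close> solves the one of \<open>f\<close>; it exchanges \<open>\<alpha>\<close> and
  \<open>- \<beta>\<close>.\<close>

definition reflect :: "('w \<Rightarrow> real \<Rightarrow> real) \<Rightarrow> 'w \<Rightarrow> real \<Rightarrow> real" where
  "reflect f w x = - f w (- x)"

definition mirror :: "'w \<times> real \<Rightarrow> 'w \<times> real" where
  "mirror p = (fst p, - snd p)"

lemma mirror_mirror [simp]: "mirror (mirror p) = p"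
  by (simp add: mirror_def)

lemma mirror_Pair [simp]: "mirror (w, x) = (w, - x)"
  by (simp add: mirror_def)

lemma in_mirror_image: "(w, x) \<in> mirror ` K \<longleftrightarrow> (w, - x) \<in> K"
  by (force simp: mirror_def image_iff)

lemma dist_mirror: "dist (mirror p) (mirror q) = dist p (q :: 'w::metric_space \<times> real)"
  by (simp add: mirror_def dist_prod_def dist_real_def abs_minus_commute)

lemma continuous_mirror: "continuous_on S (mirror :: 'w::metric_space \<times> real \<Rightarrow> _)"
  unfolding mirror_def by (intro continuous_intros)

lemma semidist_mirror: "semidist (mirror ` C) (mirror ` K) = semidist C K"
  by (simp add: semidist_def image_image dist_mirror)

context ode_family
begin

lemma reflect_family: "ode_family \<sigma> (reflect f) (\<lambda>w x. fx w (- x))"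
proof
  show "continuous_on UNIV (\<lambda>(w, x). reflect f w x)" "continuous_on UNIV (\<lambda>(w, x). fx w (- x))"
    unfolding reflect_def split_beta by (intro continuous_intros)+
  show "(reflect f w has_real_derivative fx w (- x)) (at x)" for w x
    unfolding reflect_def[abs_def] using deriv_f[of w "- x"]
    by (auto intro!: derivative_eq_intros DERIV_chain2[OF deriv_f])
qed (simp add: reflect_def)

lemma reflect_is_sol:
  "ode_family.is_sol \<sigma> (reflect f) l w u S \<longleftrightarrow> is_sol l w (\<lambda>t. - u t) S"
proof -
  interpret R: ode_family \<sigma> "reflect f" "\<lambda>w x. fx w (- x)" by (rule reflect_family)
  have "(u has_real_derivative reflect f v (u t) + l * u t) (at t) \<longleftrightarrow>
      ((\<lambda>t. - u t) has_real_derivative f v (- u t) + l * - u t) (at t)" for v t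
  proof
    assume "(u has_real_derivative reflect f v (u t) + l * u t) (at t)"
    from DERIV_minus[OF this] show "((\<lambda>t. - u t) has_real_derivative f v (- u t) + l * - u t) (at t)"
      by (simp add: reflect_def)
  next
    assume "((\<lambda>t. - u t) has_real_derivative f v (- u t) + l * - u t) (at t)"
    from DERIV_minus[OF this] show "(u has_real_derivative reflect f v (u t) + l * u t) (at t)"
      by (simp add: reflect_def)
  qed
  then show ?thesis by (simp only: R.is_sol_def is_sol_def)
qed

lemma reflect_solves_on:
  "solves_on \<sigma> (shifted (reflect f) l) w x I u \<longleftrightarrow> solves_on \<sigma> (F l) w (- x) I (\<lambda>t. - u t)"
proof -
  interpret R: ode_family \<sigma> "reflect f" "\<lambda>w x. fx w (- x)" by (rule reflect_family)
  show ?thesis unfolding R.solves_on_iff solves_on_iff reflect_is_sol by auto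
qed

lemma reflect_dom: "sol_dom \<sigma> (shifted (reflect f) l) w x = sol_dom \<sigma> (F l) w (- x)"
proof -
  have "(\<exists>u. solves_on \<sigma> (shifted (reflect f) l) w x I u) \<longleftrightarrow> (\<exists>u. solves_on \<sigma> (F l) w (- x) I u)" for I
  proof
    assume "\<exists>u. solves_on \<sigma> (F l) w (- x) I u"
    then obtain u where "solves_on \<sigma> (F l) w (- x) I (\<lambda>t. - (- u t))" by auto
    then have "solves_on \<sigma> (shifted (reflect f) l) w x I (\<lambda>t. - u t)"
      unfolding reflect_solves_on .
    then show "\<exists>u. solves_on \<sigma> (shifted (reflect f) l) w x I u" by blast
  qed (auto simp: reflect_solves_on)
  then show ?thesis by (simp add: sol_dom_def)
qed

lemma reflect_sol:
  assumes "t \<in> sol_dom \<sigma> (F l) w (- x)"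
  shows "sol \<sigma> (shifted (reflect f) l) t w x = - sol \<sigma> (F l) t w (- x)"
proof -
  interpret R: ode_family \<sigma> "reflect f" "\<lambda>w x. fx w (- x)" by (rule reflect_family)
  have "t \<in> sol_dom \<sigma> (shifted (reflect f) l) w x" using assms by (simp add: reflect_dom)
  then obtain I u where I: "solves_on \<sigma> (shifted (reflect f) l) w x I u" "t \<in> I"
    by (auto simp: sol_dom_def)
  then have "sol \<sigma> (shifted (reflect f) l) t w x = u t" by (rule R.sol_eq)
  moreover have "sol \<sigma> (F l) t w (- x) = - u t"
    using I sol_eq[of l w "- x" I "\<lambda>t. - u t" t] by (simp add: reflect_solves_on)
  ultimately show ?thesis by simp
qed

lemma reflect_invariant:
  assumes "skew_invariant \<sigma> (F l) K"
  shows "skew_invariant \<sigma> (shifted (reflect f) l) (mirror ` K)"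
proof -
  interpret R: ode_family \<sigma> "reflect f" "\<lambda>w x. fx w (- x)" by (rule reflect_family)
  show ?thesis
  proof (rule R.skew_invariantI)
    fix w x assume "(w, x) \<in> mirror ` K"
    then have "(w, - x) \<in> K" by (simp add: in_mirror_image)
    then obtain u where u: "is_sol l w u UNIV" "u 0 = - x" "\<And>t. (\<sigma> t w, u t) \<in> K"
      using skew_invariantE[OF assms] by metis
    then show "\<exists>u. R.is_sol l w u UNIV \<and> u 0 = x \<and> (\<forall>t. (\<sigma> t w, u t) \<in> mirror ` K)"
      by (intro exI[of _ "\<lambda>t. - u t"]) (simp add: reflect_is_sol in_mirror_image)
  qed
qed

end

lemma (in ode_attractor) reflect_attractor:
  "ode_attractor \<sigma> (reflect f) (\<lambda>w x. fx w (- x)) (\<lambda>l. mirror ` A l) (\<lambda>l w. - \<beta> l w) (\<lambda>l w. - \<alpha> l w)"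
proof -
  interpret R: ode_family \<sigma> "reflect f" "\<lambda>w x. fx w (- x)" by (rule reflect_family)
  show ?thesis
  proof
    fix l
    show "mirror ` A l = (\<Union>w. {w} \<times> {- \<beta> l w..- \<alpha> l w})"
    proof (intro set_eqI, clarify)
      fix w x
      show "(w, x) \<in> mirror ` A l \<longleftrightarrow> (w, x) \<in> (\<Union>w. {w} \<times> {- \<beta> l w..- \<alpha> l w})"
        by (auto simp: in_mirror_image in_A_iff)
    qed
    show "global_attractor \<sigma> (shifted (reflect f) l) (mirror ` A l)"
      unfolding global_attractor_def
    proof (intro conjI allI impI)
      show "compact (mirror ` A l)"
        by (intro compact_continuous_image continuous_mirror compact_A)
      show "skew_invariant \<sigma> (shifted (reflect f) l) (mirror ` A l)"
        by (rule reflect_invariant[OF invariant_A])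
      fix C :: "('w \<times> real) set" assume C: "bounded C"
      show "\<forall>(w, x)\<in>C. {0..} \<subseteq> sol_dom \<sigma> (shifted (reflect f) l) w x"
        using forward_dom by (simp add: reflect_dom)
      have "bounded (mirror ` C)"
      proof -
        obtain a r where "\<forall>p\<in>C. dist a p \<le> r" using C by (auto simp: bounded_def)
        then have "\<forall>p\<in>mirror ` C. dist (mirror a) p \<le> r" by (auto simp: dist_mirror)
        then show ?thesis unfolding bounded_def by blast
      qed
      then have lim: "((\<lambda>t. semidist (skew \<sigma> (F l) t ` mirror ` C) (A l)) \<longlongrightarrow> 0) at_top"
        using attractor[of l] unfolding global_attractor_def by blast
      have "semidist (skew \<sigma> (F l) t ` mirror ` C) (A l)
          = semidist (skew \<sigma> (shifted (reflect f) l) t ` C) (mirror ` A l)" if t: "0 \<le> t" for t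
      proof -
        have "skew \<sigma> (shifted (reflect f) l) t p = mirror (skew \<sigma> (F l) t (mirror p))" for p
        proof (cases p)
          case (Pair w x)
          have "t \<in> sol_dom \<sigma> (F l) w (- x)" using forward_dom t by (intro subsetD[OF forward_dom]) simp
          then show ?thesis by (simp add: Pair skew_def reflect_sol)
        qed
        then have "skew \<sigma> (shifted (reflect f) l) t ` C = mirror ` skew \<sigma> (F l) t ` mirror ` C"
          by (simp add: image_image)
        then show ?thesis by (simp only: semidist_mirror)
      qed
      then have "eventually (\<lambda>t. semidist (skew \<sigma> (F l) t ` mirror ` C) (A l)
          = semidist (skew \<sigma> (shifted (reflect f) l) t ` C) (mirror ` A l)) at_top"
        by (auto intro: eventually_at_top_linorderI[of 0])
      then show "((\<lambda>t. semidist (skew \<sigma> (shifted (reflect f) l) t ` C) (mirror ` A l)) \<longlongrightarrow> 0) at_top"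
        by (rule Lim_transform_eventually[OF lim])
    qed
  qed
qed

lemma (in dichotomy_family) reflect_dichotomy:
  "dichotomy_family \<sigma> (reflect f) (\<lambda>w x. fx w (- x)) (\<lambda>l. mirror ` A l) (\<lambda>l w. - \<beta> l w) (\<lambda>l w. - \<alpha> l w) lm lp"
proof -
  interpret R: ode_attractor \<sigma> "reflect f" "\<lambda>w x. fx w (- x)" "\<lambda>l. mirror ` A l" "\<lambda>l w. - \<beta> l w" "\<lambda>l w. - \<alpha> l w"
    by (rule reflect_attractor)
  show ?thesis by unfold_locales (simp_all add: lm_le_lp spectrum)
qed

section \<open>The pitchfork bifurcation diagram\<close>

lemma (in ode_attractor) hyperbolic_graph:
  assumes cont: "continuous_on UNIV e" and sol: "\<And>w. is_sol l w (\<lambda>t. e (\<sigma> t w)) UNIV"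
    and stable: "\<exists>\<delta>>0. \<exists>k\<ge>1. \<exists>\<gamma>>0. \<forall>w y. \<bar>y - e w\<bar> < \<delta> \<longrightarrow>
      (\<forall>t\<ge>0. \<bar>sol \<sigma> (F l) t w y - e (\<sigma> t w)\<bar> \<le> k * exp (- \<gamma> * t) * \<bar>y - e w\<bar>)"
  shows "hyperbolic_minimal_set \<sigma> (F l) (graph_of e)"
proof -
  obtain \<delta> k \<gamma> where c: "\<delta> > 0" "k \<ge> 1" "\<gamma> > 0" and st: "\<And>w y t. \<bar>y - e w\<bar> < \<delta> \<Longrightarrow> 0 \<le> t \<Longrightarrow>
      \<bar>sol \<sigma> (F l) t w y - e (\<sigma> t w)\<bar> \<le> k * exp (- \<gamma> * t) * \<bar>y - e w\<bar>"
    using stable by auto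
  have "unif_exp_stable {0..} \<sigma> (F l) (graph_of e)"
    unfolding unif_exp_stable_def
  proof (rule exI[of _ \<delta>], rule conjI[OF c(1)], rule exI[of _ k], rule conjI[OF c(2)],
      rule exI[of _ \<gamma>], rule conjI[OF c(3)], rule ballI)
    fix p assume "p \<in> graph_of e"
    then obtain w where p: "p = (w, e w)" by (auto simp: graph_of_def)
    have "\<forall>y. \<bar>y - e w\<bar> < \<delta> \<longrightarrow> (\<forall>t\<in>{0..}. t \<in> sol_dom \<sigma> (F l) w y \<and>
        \<bar>sol \<sigma> (F l) t w y - sol \<sigma> (F l) t w (e w)\<bar> \<le> k * exp (- \<gamma> * \<bar>t\<bar>) * \<bar>y - e w\<bar>)"
    proof (intro allI impI ballI)
      fix y and t :: real assume y: "\<bar>y - e w\<bar> < \<delta>" and t: "t \<in> {0..}"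
      have "sol \<sigma> (F l) t w (e w) = e (\<sigma> t w)" by (rule complete_sol(2)[OF sol]) simp
      moreover have "t \<in> sol_dom \<sigma> (F l) w y" using t by (rule subsetD[OF forward_dom])
      ultimately show "t \<in> sol_dom \<sigma> (F l) w y \<and>
          \<bar>sol \<sigma> (F l) t w y - sol \<sigma> (F l) t w (e w)\<bar> \<le> k * exp (- \<gamma> * \<bar>t\<bar>) * \<bar>y - e w\<bar>"
        using st[OF y, of t] t by simp
    qed
    then show "case p of (w, x) \<Rightarrow> \<forall>y. \<bar>y - x\<bar> < \<delta> \<longrightarrow> (\<forall>t\<in>{0..}. t \<in> sol_dom \<sigma> (F l) w y \<and>
        \<bar>sol \<sigma> (F l) t w y - sol \<sigma> (F l) t w x\<bar> \<le> k * exp (- \<gamma> * \<bar>t\<bar>) * \<bar>y - x\<bar>)"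
      unfolding p prod.case .
  qed
  then show ?thesis
    unfolding hyperbolic_minimal_set_def using minimal_graph[OF cont sol] by blast
qed

text \<open>Strict concavity on both half-lines, where the negative one is expressed through the reflected
  equation. The spectrum is the same for both because reflection fixes the slope at zero.\<close>

locale pitchfork = strict_half_line \<sigma> f fx A \<alpha> \<beta> lm lp +
  R: strict_half_line \<sigma> "reflect f" "\<lambda>w x. fx w (- x)" "\<lambda>l. mirror ` A l" "\<lambda>l w. - \<beta> l w" "\<lambda>l w. - \<alpha> l w" lm lp
  for \<sigma> :: "real \<Rightarrow> 'w::metric_space \<Rightarrow> 'w" and f fx A \<alpha> \<beta> lm lp
begin

lemma \<alpha>_sol: "is_sol l w (\<lambda>t. \<alpha> l (\<sigma> t w)) UNIV"
  using R.\<beta>_sol[of l w] by (simp add: reflect_is_sol)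

lemma \<alpha>_continuous: "lp < l \<Longrightarrow> continuous_on UNIV (\<alpha> l)"
  using continuous_on_minus[OF R.\<beta>_continuous[of l]] by simp

lemma \<alpha>_exponentially_stable:
  assumes l: "lp < l"
  shows "\<exists>\<delta>>0. \<exists>k\<ge>1. \<exists>\<gamma>>0. \<forall>w y. \<bar>y - \<alpha> l w\<bar> < \<delta> \<longrightarrow>
    (\<forall>t\<ge>0. \<bar>sol \<sigma> (F l) t w y - \<alpha> l (\<sigma> t w)\<bar> \<le> k * exp (- \<gamma> * t) * \<bar>y - \<alpha> l w\<bar>)"
proof -
  obtain \<delta> k \<gamma> where c: "\<delta> > 0" "k \<ge> 1" "\<gamma> > 0" and st: "\<And>w y t. \<bar>y - - \<alpha> l w\<bar> < \<delta> \<Longrightarrow> 0 \<le> t \<Longrightarrow>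
      \<bar>sol \<sigma> (shifted (reflect f) l) t w y - - \<alpha> l (\<sigma> t w)\<bar> \<le> k * exp (- \<gamma> * t) * \<bar>y - - \<alpha> l w\<bar>"
    using R.\<beta>_exponentially_stable[OF l] by auto
  have "\<bar>sol \<sigma> (F l) t w y - \<alpha> l (\<sigma> t w)\<bar> \<le> k * exp (- \<gamma> * t) * \<bar>y - \<alpha> l w\<bar>"
    if y: "\<bar>y - \<alpha> l w\<bar> < \<delta>" and t: "0 \<le> t" for w y t
  proof -
    have "t \<in> sol_dom \<sigma> (F l) w (- (- y))" using t by (intro subsetD[OF forward_dom]) simp
    then have "sol \<sigma> (shifted (reflect f) l) t w (- y) = - sol \<sigma> (F l) t w (- (- y))"
      by (rule reflect_sol)
    moreover have "\<bar>- y - - \<alpha> l w\<bar> = \<bar>y - \<alpha> l w\<bar>" by simp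
    ultimately show ?thesis using st[of "- y" w t] y t by (simp add: abs_minus_commute)
  qed
  then show ?thesis using c by blast
qed

text \<open>Points close to zero lie in the attractor by the two thresholds, so their solutions are
  complete; they decay backwards by \<open>above_threshold\<close>, applied on the side where they are.\<close>

lemma zero_hyperbolic:
  assumes l: "lp < l"
  shows "hyperbolic_minimal_set \<sigma> (F l) zero_section"
proof -
  obtain c1 k1 \<gamma>1 where 1: "c1 > 0" "k1 \<ge> 1" "\<gamma>1 > 0" "\<And>w. c1 \<le> \<beta> l w"
    "\<And>w u t. is_sol l w u UNIV \<Longrightarrow> 0 < u 0 \<Longrightarrow> u 0 < c1 \<Longrightarrow> t \<le> 0 \<Longrightarrow> 0 < u t \<and> u t \<le> k1 * exp (\<gamma>1 * t) * u 0"
    using above_threshold[OF l] by metis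
  obtain c2 k2 \<gamma>2 where 2: "c2 > 0" "k2 \<ge> 1" "\<gamma>2 > 0" "\<And>w. c2 \<le> - \<alpha> l w"
    "\<And>w u t. R.is_sol l w u UNIV \<Longrightarrow> 0 < u 0 \<Longrightarrow> u 0 < c2 \<Longrightarrow> t \<le> 0 \<Longrightarrow> 0 < u t \<and> u t \<le> k2 * exp (\<gamma>2 * t) * u 0"
    using R.above_threshold[OF l] by metis
  define c k \<gamma> where "c = min c1 c2" and "k = max k1 k2" and "\<gamma> = min \<gamma>1 \<gamma>2"
  have cs: "c > 0" "k \<ge> 1" "\<gamma> > 0" using 1 2 by (auto simp: c_def k_def \<gamma>_def)
  \<comment> \<open>the estimates of both sides hold with the larger constant and the smaller rate\<close>
  have weaken: "k' * exp (\<gamma>' * t) * z \<le> k * exp (- \<gamma> * \<bar>t\<bar>) * z"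
    if "0 \<le> k'" "k' \<le> k" "\<gamma> \<le> \<gamma>'" "t \<le> 0" "0 \<le> z" for k' \<gamma>' t z
  proof -
    have "\<gamma>' * t \<le> \<gamma> * t" using that by (intro mult_right_mono_neg)
    then show ?thesis using that by (intro mult_right_mono mult_mono) auto
  qed
  have main: "t \<in> sol_dom \<sigma> (F l) w y \<and> \<bar>sol \<sigma> (F l) t w y\<bar> \<le> k * exp (- \<gamma> * \<bar>t\<bar>) * \<bar>y\<bar>"
    if y: "\<bar>y\<bar> < c" and t: "t \<le> 0" for w y t
  proof -
    have "- c2 < y" "y < c1" using y by (auto simp: c_def)
    then have "(w, y) \<in> A l" using 1(4)[of w] 2(4)[of w] by (simp add: in_A_iff)
    then obtain u where u: "is_sol l w u UNIV" "u 0 = y" by (rule A_sol) (rule that)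
    have "\<bar>u t\<bar> \<le> k * exp (- \<gamma> * \<bar>t\<bar>) * \<bar>y\<bar>"
    proof (cases y "0 :: real" rule: linorder_cases)
      case greater
      have "0 < u t \<and> u t \<le> k1 * exp (\<gamma>1 * t) * u 0"
        by (rule 1(5)[OF u(1)]) (use u greater t \<open>y < c1\<close> in auto)
      moreover have "k1 * exp (\<gamma>1 * t) * y \<le> k * exp (- \<gamma> * \<bar>t\<bar>) * y"
        by (rule weaken) (use 1 t greater in \<open>auto simp: k_def \<gamma>_def\<close>)
      moreover have abs_y: "\<bar>y\<bar> = y" using greater by simp
      ultimately show ?thesis unfolding u(2) abs_y by linarith
    next
      case equal
      then have "u = (\<lambda>_. 0)"
        using u by (intro sol_unique_UNIV[OF u(1) is_sol_zero, where s = 0]) simp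
      then show ?thesis using equal by simp
    next
      case less
      have "R.is_sol l w (\<lambda>t. - u t) UNIV" using u by (simp add: reflect_is_sol)
      then have "0 < - u t \<and> - u t \<le> k2 * exp (\<gamma>2 * t) * - u 0"
        by (rule 2(5)) (use u less t \<open>- c2 < y\<close> in auto)
      moreover have "k2 * exp (\<gamma>2 * t) * - y \<le> k * exp (- \<gamma> * \<bar>t\<bar>) * - y"
        by (rule weaken) (use 2 t less in \<open>auto simp: k_def \<gamma>_def\<close>)
      moreover have abs_y: "\<bar>y\<bar> = - y" using less by simp
      ultimately show ?thesis unfolding u(2) abs_y by linarith
    qed
    then show ?thesis using complete_sol[OF u] by simp
  qed
  have "unif_exp_stable {..0} \<sigma> (F l) zero_section"
    unfolding unif_exp_stable_def
  proof (rule exI[of _ c], rule conjI[OF cs(1)], rule exI[of _ k], rule conjI[OF cs(2)],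
      rule exI[of _ \<gamma>], rule conjI[OF cs(3)], rule ballI)
    fix p :: "'w \<times> real" assume "p \<in> zero_section"
    then obtain w where p: "p = (w, 0)" by (auto simp: zero_section_def)
    have "\<forall>y. \<bar>y - 0\<bar> < c \<longrightarrow> (\<forall>t\<in>{..0}. t \<in> sol_dom \<sigma> (F l) w y \<and>
        \<bar>sol \<sigma> (F l) t w y - sol \<sigma> (F l) t w 0\<bar> \<le> k * exp (- \<gamma> * \<bar>t\<bar>) * \<bar>y - 0\<bar>)"
    proof (intro allI impI ballI)
      fix y t :: real assume y: "\<bar>y - 0\<bar> < c" and t: "t \<in> {..0}"
      have "sol \<sigma> (F l) t w 0 = 0" by (rule complete_sol(2)[OF is_sol_zero]) simp
      then show "t \<in> sol_dom \<sigma> (F l) w y \<and>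
          \<bar>sol \<sigma> (F l) t w y - sol \<sigma> (F l) t w 0\<bar> \<le> k * exp (- \<gamma> * \<bar>t\<bar>) * \<bar>y - 0\<bar>"
        using main[of y t w] y t by simp
    qed
    then show "case p of (w, x) \<Rightarrow> \<forall>y. \<bar>y - x\<bar> < c \<longrightarrow> (\<forall>t\<in>{..0}. t \<in> sol_dom \<sigma> (F l) w y \<and>
        \<bar>sol \<sigma> (F l) t w y - sol \<sigma> (F l) t w x\<bar> \<le> k * exp (- \<gamma> * \<bar>t\<bar>) * \<bar>y - x\<bar>)"
      unfolding p prod.case .
  qed
  then show ?thesis unfolding hyperbolic_minimal_set_def using minimal_zero by blast
qed

text \<open>A minimal set other than the zero section avoids it, hence contains complete solutions on one
  side that are separated from zero, over every base point.\<close>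

lemma unique_minimal:
  assumes l: "l \<le> lp"
  shows "minimal_set \<sigma> (F l) M \<longleftrightarrow> M = zero_section"
proof
  assume M: "minimal_set \<sigma> (F l) M"
  show "M = zero_section"
  proof (rule ccontr)
    assume ne: "M \<noteq> zero_section"
    have nz: "(w, 0) \<notin> M" for w by (rule minimal_without_zero[OF M ne])
    have Mc: "compact M" "skew_invariant \<sigma> (F l) M" "M \<noteq> {}" using M by (auto simp: minimal_set_def)
    obtain w x where p: "(w, x) \<in> M" using Mc(3) by auto
    have "lp < l"
    proof (cases "0 < x")
      case True
      obtain \<rho> Q where "\<rho> > 0" "\<And>w. \<exists>u. is_sol l w u UNIV \<and> (\<forall>t. \<rho> \<le> u t \<and> u t \<le> Q)"
        using positive_part_separated[OF Mc(1,2) p True nz] by blast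
      then show ?thesis by (rule separated_imp_gt)
    next
      case False
      then have x: "0 < - x" using p nz[of w] by (cases "x = 0") auto
      have "compact (mirror ` M)" by (intro compact_continuous_image continuous_mirror Mc)
      moreover have "(w, - x) \<in> mirror ` M" using p by (simp add: in_mirror_image)
      moreover have "(v, 0) \<notin> mirror ` M" for v using nz by (simp add: in_mirror_image)
      ultimately obtain \<rho> Q where "\<rho> > 0" "\<And>w. \<exists>u. R.is_sol l w u UNIV \<and> (\<forall>t. \<rho> \<le> u t \<and> u t \<le> Q)"
        using R.positive_part_separated[OF _ reflect_invariant[OF Mc(2)] _ x] by blast
      then show ?thesis by (rule R.separated_imp_gt)
    qed
    then show False using l by simp
  qed
qed (simp add: minimal_zero)

lemma A_zero_below: "l < lm \<Longrightarrow> A l = zero_section"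
  using \<beta>_zero_below[of l] R.\<beta>_zero_below[of l] by (auto simp: A_eq zero_section_def)

lemma \<alpha>_collides: "collides_with_zero \<sigma> \<alpha> (at_right lp)"
proof -
  obtain b R where b: "\<And>w. ((\<lambda>l. - \<alpha> l w) \<longlongrightarrow> b w) (at_right lp)"
    "residual_set R" "flow_invariant \<sigma> R" "\<And>w. w \<in> R \<Longrightarrow> b w = 0"
    using R.\<beta>_collides unfolding collides_with_zero_def by blast
  have "((\<lambda>l. \<alpha> l w) \<longlongrightarrow> - b w) (at_right lp)" for w
    using tendsto_minus[OF b(1)[of w]] by simp
  then show ?thesis
    unfolding collides_with_zero_def using b by (intro exI[of _ "\<lambda>w. - b w"]) auto
qed

lemma three_hyperbolic:
  assumes l: "lp < l"
  shows "distinct [graph_of (\<alpha> l), zero_section, graph_of (\<beta> l)] \<and>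
    hyperbolic_minimal_set \<sigma> (F l) (graph_of (\<alpha> l)) \<and>
    hyperbolic_minimal_set \<sigma> (F l) zero_section \<and>
    hyperbolic_minimal_set \<sigma> (F l) (graph_of (\<beta> l)) \<and>
    fibre_less (graph_of (\<alpha> l)) zero_section \<and> fibre_less zero_section (graph_of (\<beta> l))"
proof -
  have pos: "0 < \<beta> l w" "\<alpha> l w < 0" for w
  proof -
    obtain \<rho> where "\<rho> > 0" "\<rho> \<le> \<beta> l w" using \<beta>_separated[OF l] by blast
    then show "0 < \<beta> l w" by simp
    obtain \<rho> where "\<rho> > 0" "\<rho> \<le> - \<alpha> l w" using R.\<beta>_separated[OF l] by blast
    then show "\<alpha> l w < 0" by simp
  qed
  have "(undefined, \<alpha> l undefined) \<in> graph_of (\<alpha> l)" "(undefined, \<beta> l undefined) \<in> graph_of (\<beta> l)"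
    by (auto simp: graph_of_def)
  moreover have "(undefined, \<alpha> l undefined) \<notin> zero_section" "(undefined, \<beta> l undefined) \<notin> zero_section"
    using pos[of undefined] by (auto simp: zero_section_def)
  moreover have "(undefined, \<alpha> l undefined) \<notin> graph_of (\<beta> l)"
    using pos[of undefined] by (auto simp: graph_of_def)
  ultimately have "graph_of (\<alpha> l) \<noteq> zero_section" "zero_section \<noteq> graph_of (\<beta> l)" "graph_of (\<alpha> l) \<noteq> graph_of (\<beta> l)"
    by metis+
  moreover have "hyperbolic_minimal_set \<sigma> (F l) (graph_of (\<alpha> l))"
    by (rule hyperbolic_graph[OF \<alpha>_continuous[OF l] \<alpha>_sol \<alpha>_exponentially_stable[OF l]])
  moreover have "hyperbolic_minimal_set \<sigma> (F l) (graph_of (\<beta> l))"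
    by (rule hyperbolic_graph[OF \<beta>_continuous[OF l] \<beta>_sol \<beta>_exponentially_stable[OF l]])
  moreover have "fibre_less (graph_of (\<alpha> l)) zero_section" "fibre_less zero_section (graph_of (\<beta> l))"
    using pos by (auto simp: fibre_less_def graph_of_def zero_section_def)
  ultimately show ?thesis using zero_hyperbolic[OF l] by simp
qed

end

section \<open>Concave slopes\<close>

text \<open>A point \<open>z > 0\<close> with \<open>g z > g 0\<close> would, by concavity, force a positive slope \<open>s\<close> at \<open>0\<close>; so
  \<open>g\<close> is maximal at \<open>0\<close> and, again by concavity, decreases from there.\<close>

lemma concave_antitone:
  fixes g :: "real \<Rightarrow> real"
  assumes conc: "concave_on UNIV g" and d: "(g has_real_derivative d) (at 0)" "d \<le> 0"
    and xy: "0 \<le> x" "x \<le> y"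
  shows "g y \<le> g x"
proof -
  have le0: "g z \<le> g 0" if z: "0 < z" for z
  proof (rule ccontr)
    assume "\<not> g z \<le> g 0"
    define s where "s = (g z - g 0) / z"
    have s: "s > 0" using \<open>\<not> g z \<le> g 0\<close> z by (simp add: s_def)
    have "((\<lambda>h. g h - s * h) has_real_derivative d - s) (at 0)"
      using d(1) by (auto intro!: derivative_eq_intros)
    moreover have "d - s < 0" using s d(2) by simp
    ultimately obtain e where e: "e > 0" "\<forall>h>0. h < e \<longrightarrow> g (0 + h) - s * (0 + h) < g 0 - s * 0"
      using DERIV_neg_dec_right by blast
    define h where "h = min (e / 2) z"
    have h: "0 < h" "h < e" "h \<le> z" using e z by (auto simp: h_def)
    have "(1 - h / z) * g 0 + (h / z) * g z \<le> g ((1 - h / z) *\<^sub>R 0 + (h / z) *\<^sub>R z)"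
      by (rule concave_onD[OF conc]) (use h z in auto)
    then have "g 0 + s * h \<le> g h" using z by (simp add: s_def field_simps)
    moreover have "g h - s * h < g 0" using e(2) h by simp
    ultimately show False by simp
  qed
  show ?thesis
  proof (cases "y = 0")
    case False
    then have y: "0 < y" using xy by simp
    have "(1 - x / y) * g 0 + (x / y) * g y \<le> g ((1 - x / y) *\<^sub>R 0 + (x / y) *\<^sub>R y)"
      by (rule concave_onD[OF conc]) (use xy y in auto)
    then have "(1 - x / y) * g 0 + (x / y) * g y \<le> g x" using y by simp
    moreover have "(1 - x / y) * g y \<le> (1 - x / y) * g 0"
      using le0[OF y] xy y by (intro mult_left_mono) auto
    ultimately show ?thesis by (simp add: algebra_simps)
  qed (use xy in simp)
qed

lemma concave_reflect: "concave_on UNIV g \<Longrightarrow> concave_on UNIV (\<lambda>x :: real. g (- x))"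
  unfolding concave_on_def
proof (rule convex_onI)
  fix t x y :: real assume g: "convex_on UNIV (\<lambda>x. - g x)" and t: "0 < t" "t < 1"
  have "- g ((1 - t) *\<^sub>R - x + t *\<^sub>R - y) \<le> (1 - t) * - g (- x) + t * - g (- y)"
    by (rule convex_onD[OF g]) (use t in auto)
  then show "- g (- ((1 - t) *\<^sub>R x + t *\<^sub>R y)) \<le> (1 - t) * - g (- x) + t * - g (- y)" by simp
qed simp

text \<open>If all slopes were constant on the interval, the concavity modulus would vanish identically.
  This is the only use of strict concavity; it needs one ergodic measure to exist.\<close>

lemma SDC_imp_not_constant:
  assumes "SDC \<sigma> f" "ergodic_measure \<sigma> m" and pq: "p < q"
  shows "\<exists>w. \<exists>x\<in>{p..q}. deriv (f w) x \<noteq> deriv (f w) p"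
proof (rule ccontr)
  assume "\<not> ?thesis"
  then have all: "\<forall>w. \<forall>x\<in>{p..q}. deriv (f w) x = deriv (f w) p" by blast
  have const: "deriv (f w) x = deriv (f w) p" if "p \<le> x" "x \<le> q" for w x
    using all[rule_format, of x w] that by simp
  define \<epsilon> where "\<epsilon> = (q - p) / 2"
  have \<epsilon>: "0 < \<epsilon>" "\<epsilon> \<le> (q - p) / 2" using pq by (auto simp: \<epsilon>_def)
  define J where "J = {x. {x - \<epsilon> / 2..x + \<epsilon> / 2} \<subseteq> {p..q}}"
  have "p \<le> (p + q) / 2 - \<epsilon> / 2" "(p + q) / 2 + \<epsilon> / 2 \<le> q"
    using pq by (simp_all add: \<epsilon>_def field_simps)
  then have "(p + q) / 2 \<in> J" by (simp add: J_def)
  then have J: "J \<noteq> {}" by blast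
  have "2 * deriv (f w) x - deriv (f w) (x - \<epsilon> / 2) - deriv (f w) (x + \<epsilon> / 2) = 0" if "x \<in> J" for w x
  proof -
    have "p \<le> x - \<epsilon> / 2" "x + \<epsilon> / 2 \<le> q" using that \<epsilon> by (auto simp: J_def)
    then show ?thesis using const[of x w] const[of "x - \<epsilon> / 2" w] const[of "x + \<epsilon> / 2" w] \<epsilon> by simp
  qed
  then have "b_mod f p q \<epsilon> w = 0" for w
    unfolding b_mod_def J_def[symmetric] using J by (simp cong: INF_cong_simp)
  then have "emeasure m {w. b_mod f p q \<epsilon> w > 0} = 0" by simp
  moreover have "emeasure m {w. b_mod f p q \<epsilon> w > 0} > 0"
    using assms \<epsilon> unfolding SDC_def by blast
  ultimately show False by simp
qed

section \<open>Bifurcation of the attractor\<close>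

theorem proposition6p5:
  fixes \<sigma> :: "real \<Rightarrow> 'w::metric_space \<Rightarrow> 'w"
    and f :: "'w \<Rightarrow> real \<Rightarrow> real"
    and lm lp :: real
    and A :: "real \<Rightarrow> ('w \<times> real) set"
    and \<alpha> \<beta> :: "real \<Rightarrow> 'w \<Rightarrow> real"
  assumes "compact (UNIV :: 'w set)"
    and "continuous_flow \<sigma>"
    and "minimal_flow \<sigma>"
    and "C0k 2 f"
    and "Co f"
    and "DC f"
    and "\<forall>\<omega>. f \<omega> 0 = 0"
    and "lm \<le> lp"
    and "sacker_sell_spectrum \<sigma> (\<lambda>\<omega>. deriv (f \<omega>) 0) = {- lp .. - lm}"
    and "\<forall>l. global_attractor \<sigma> (shifted f l) (A l)"
    and "\<forall>l. A l = (\<Union>\<omega>. {\<omega>} \<times> {\<alpha> l \<omega> .. \<beta> l \<omega>})"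
  shows
    "((\<forall>\<omega>. deriv (deriv (f \<omega>)) 0 \<ge> 0) \<longrightarrow>
        (\<forall>l < lp. \<forall>\<omega>. isCont (\<alpha> l) \<omega> \<longrightarrow> \<alpha> l \<omega> = 0)) \<and>
     ((\<forall>\<omega>. deriv (deriv (f \<omega>)) 0 \<le> 0) \<longrightarrow>
        (\<forall>l < lp. \<forall>\<omega>. isCont (\<beta> l) \<omega> \<longrightarrow> \<beta> l \<omega> = 0)) \<and>
     (SDC \<sigma> f \<and> (\<forall>\<omega>. deriv (deriv (f \<omega>)) 0 = 0) \<longrightarrow>
        (\<forall>l > lp. \<exists>Ml Mu.
            Ml = graph_of (\<alpha> l) \<and> Mu = graph_of (\<beta> l) \<and>
            distinct [Ml, zero_section, Mu] \<and>
            hyperbolic_minimal_set \<sigma> (shifted f l) Ml \<and>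
            hyperbolic_minimal_set \<sigma> (shifted f l) zero_section \<and>
            hyperbolic_minimal_set \<sigma> (shifted f l) Mu \<and>
            fibre_less Ml zero_section \<and> fibre_less zero_section Mu) \<and>
        collides_with_zero \<sigma> \<alpha> (at_right lp) \<and>
        collides_with_zero \<sigma> \<beta> (at_right lp) \<and>
        (\<forall>l\<le>lp. \<forall>M. minimal_set \<sigma> (shifted f l) M \<longleftrightarrow> M = zero_section) \<and>
        (\<forall>l < lm. A l = zero_section))"
proof -
  define fx where "fx w x = deriv (f w) x" for w x
  have ck: "\<forall>j<2. \<forall>w x. (deriv ^^ j) (f w) field_differentiable at x"
    "\<forall>j\<le>2. continuous_on UNIV (\<lambda>(w, x). (deriv ^^ j) (f w) x)"
    using assms(4) unfolding C0k_def by simp_all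
  have d1: "(f w has_real_derivative fx w x) (at x)" for w x
    using ck(1)[rule_format, of 0 w x] by (simp add: fx_def DERIV_deriv_iff_field_differentiable)
  have d2: "(fx w has_real_derivative deriv (deriv (f w)) x) (at x)" for w x
    using ck(1)[rule_format, of 1 w x] by (simp add: fx_def[abs_def] DERIV_deriv_iff_field_differentiable)
  have conc: "concave_on UNIV (fx w)" for w
    using assms(6) by (simp add: DC_def fx_def[abs_def])
  interpret D: dichotomy_family \<sigma> f fx A \<alpha> \<beta> lm lp
  proof
    show "continuous_on UNIV (\<lambda>(w, x). f w x)" using ck(2)[rule_format, of 0] by simp
    show "continuous_on UNIV (\<lambda>(w, x). fx w x)" using ck(2)[rule_format, of 1] by (simp add: fx_def)
    show "(f w has_real_derivative fx w x) (at x)" for w x by (rule d1)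
    show "sacker_sell_spectrum \<sigma> (\<lambda>w. fx w 0) = {- lp..- lm}" using assms(9) by (simp add: fx_def)
  qed (use assms in auto)
  interpret R: dichotomy_family \<sigma> "reflect f" "\<lambda>w x. fx w (- x)" "\<lambda>l. mirror ` A l" "\<lambda>l w. - \<beta> l w" "\<lambda>l w. - \<alpha> l w" lm lp
    by (rule D.reflect_dichotomy)
  have anti: "fx w y \<le> fx w x" if "deriv (deriv (f w)) 0 \<le> 0" "0 \<le> x" "x \<le> y" for w x y
    by (rule concave_antitone[OF conc d2 that])
  have anti': "fx w (- y) \<le> fx w (- x)" if "0 \<le> deriv (deriv (f w)) 0" "0 \<le> x" "x \<le> y" for w x y
  proof (rule concave_antitone[OF concave_reflect[OF conc], of _ _ x y])
    have "(fx w has_real_derivative deriv (deriv (f w)) 0) (at (- 0))" using d2[of w 0] by simp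
    from DERIV_mirror[THEN iffD1, OF this]
    show "((\<lambda>x. fx w (- x)) has_real_derivative - deriv (deriv (f w)) 0) (at 0)" by simp
  qed (use that in auto)
  have half: "half_line \<sigma> f fx A \<alpha> \<beta> lm lp" if "\<forall>w. deriv (deriv (f w)) 0 \<le> 0"
    by unfold_locales (use anti that in blast)
  have half': "half_line \<sigma> (reflect f) (\<lambda>w x. fx w (- x)) (\<lambda>l. mirror ` A l) (\<lambda>l w. - \<beta> l w) (\<lambda>l w. - \<alpha> l w) lm lp"
    if "\<forall>w. 0 \<le> deriv (deriv (f w)) 0"
    by unfold_locales (use anti' that in blast)
  show ?thesis
  proof (intro conjI[of "_ \<longrightarrow> _"] impI)
    assume *: "\<forall>w. 0 \<le> deriv (deriv (f w)) 0"
    interpret H: half_line \<sigma> "reflect f" "\<lambda>w x. fx w (- x)" "\<lambda>l. mirror ` A l" "\<lambda>l w. - \<beta> l w" "\<lambda>l w. - \<alpha> l w" lm lp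
      by (rule half'[OF *])
    show "\<forall>l<lp. \<forall>w. isCont (\<alpha> l) w \<longrightarrow> \<alpha> l w = 0"
      using H.\<beta>_zero_at_continuity by (metis continuous_minus neg_equal_0_iff_equal)
  next
    assume *: "\<forall>w. deriv (deriv (f w)) 0 \<le> 0"
    interpret H: half_line \<sigma> f fx A \<alpha> \<beta> lm lp by (rule half[OF *])
    show "\<forall>l<lp. \<forall>w. isCont (\<beta> l) w \<longrightarrow> \<beta> l w = 0"
      using H.\<beta>_zero_at_continuity by blast
  next
    assume **: "SDC \<sigma> f \<and> (\<forall>w. deriv (deriv (f w)) 0 = 0)"
    then have z: "\<forall>w. deriv (deriv (f w)) 0 \<le> 0" "\<forall>w. 0 \<le> deriv (deriv (f w)) 0" by simp_all
    obtain m where m: "ergodic_measure \<sigma> m" using D.ergodic_measure_exists by blast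
    have nf: "\<exists>w. fx w p < fx w 0" if p: "0 < p" for p
    proof -
      have "\<exists>w. \<exists>x\<in>{0..p}. deriv (f w) x \<noteq> deriv (f w) 0"
        by (rule SDC_imp_not_constant[OF _ m p]) (use ** in simp)
      then obtain w x where x: "0 \<le> x" "x \<le> p" "fx w x \<noteq> fx w 0"
        by (auto simp: fx_def)
      have "fx w p \<le> fx w x" "fx w x \<le> fx w 0" using z x by (auto intro: anti)
      then show ?thesis using x(3) by (intro exI[of _ w]) simp
    qed
    have nf': "\<exists>w. fx w (- p) < fx w (- 0)" if p: "0 < p" for p
    proof -
      have "- p < 0" using p by simp
      then have "\<exists>w. \<exists>x\<in>{- p..0}. deriv (f w) x \<noteq> deriv (f w) (- p)"
        by (rule SDC_imp_not_constant[OF _ m, rotated]) (use ** in simp)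
      then obtain w x where x: "- p \<le> x" "x \<le> 0" "fx w x \<noteq> fx w (- p)"
        by (auto simp: fx_def)
      have "fx w (- p) \<le> fx w (- (- x))" by (rule anti') (use z x in auto)
      moreover have "fx w (- (- x)) \<le> fx w (- 0)" by (rule anti') (use z x in auto)
      ultimately show ?thesis using x(3) by (intro exI[of _ w]) simp
    qed
    interpret H: half_line \<sigma> f fx A \<alpha> \<beta> lm lp by (rule half[OF z(1)])
    interpret H': half_line \<sigma> "reflect f" "\<lambda>w x. fx w (- x)" "\<lambda>l. mirror ` A l" "\<lambda>l w. - \<beta> l w" "\<lambda>l w. - \<alpha> l w" lm lp
      by (rule half'[OF z(2)])
    interpret P: pitchfork \<sigma> f fx A \<alpha> \<beta> lm lp
      by unfold_locales (use nf nf' in blast)+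
    show "(\<forall>l > lp. \<exists>Ml Mu.
            Ml = graph_of (\<alpha> l) \<and> Mu = graph_of (\<beta> l) \<and>
            distinct [Ml, zero_section, Mu] \<and>
            hyperbolic_minimal_set \<sigma> (shifted f l) Ml \<and>
            hyperbolic_minimal_set \<sigma> (shifted f l) zero_section \<and>
            hyperbolic_minimal_set \<sigma> (shifted f l) Mu \<and>
            fibre_less Ml zero_section \<and> fibre_less zero_section Mu) \<and>
        collides_with_zero \<sigma> \<alpha> (at_right lp) \<and>
        collides_with_zero \<sigma> \<beta> (at_right lp) \<and>
        (\<forall>l\<le>lp. \<forall>M. minimal_set \<sigma> (shifted f l) M \<longleftrightarrow> M = zero_section) \<and>
        (\<forall>l < lm. A l = zero_section)"
      using P.three_hyperbolic P.\<alpha>_collides P.\<beta>_collides P.unique_minimal P.A_zero_below by blast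
  qed
qed

end
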